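(* Let $n,d\ge1$ be integers and $1<p,q<\infty$. Let $W$ be a $(d\times d)$ matrix $A_p$ weight on $\mathbb{R}^n$ and let $\{f_k\}_{k=1}^\infty$ be a sequence of locally integrable functions $f_k:\mathbb{R}^n\to\mathbb{C}^d$. Then $$\left\|\left(\sum_{k=1}^\infty|\widetilde M_Wf_k|^q\right)^{1/q}\right\|_{L^p(\mathbb{R}^n)}\le C(n,d,p,q)\,[W]_{A_p}^{\frac1p+\max\left\{\frac1{q-1},\frac1{p-1}\right\}}\left\|\left(\sum_{k=1}^\infty|W^{1/p}f_k|^q\right)^{1/q}\right\|_{L^p(\mathbb{R}^n)},$$ where $C(n,d,p,q)$ is a finite constant depending only on $n,d,p,q$, and $\widetilde M_W$ is the Christ--Goldberg auxiliary maximal operator corresponding to $W$ and the exponent $p$.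
   Context: $|v|$ is the Euclidean norm on $\mathbb{C}^d$ and $|A|$ the operator norm on $\mathrm{M}_d(\mathbb{C})$. A $(d\times d)$ matrix weight on $\mathbb{R}^n$ is a locally integrable $W:\mathbb{R}^n\to \mathrm{M}_d(\mathbb{C})$ that is (Hermitian) positive-definite a.e. With $p'=p/(p-1)$, $$[W]_{A_p}:=\sup_Q\frac1{|Q|}\int_Q\Big(\frac1{|Q|}\int_Q|W(x)^{1/p}W(y)^{-1/p}|^{p'}dy\Big)^{p/p'}dx,$$ the supremum over bounded cubes $Q\subset\mathbb{R}^n$ with sides parallel to the axes; $W$ is a matrix $A_p$ weight if $[W]_{A_p}<\infty$. For each such cube $Q$, $\mathcal W_Q$ is a reducing operator of $W$ over $Q$ with respect to exponent $p$, i.e. a positive-definite matrix with $$\Big(\tfrac1{|Q|}\int_Q|W^{1/p}e|^p\Big)^{1/p}\le|\mathcal W_Qe|\le\sqrt d\,\Big(\tfrac1{|Q|}\int_Q|W^{1/p}e|^p\Big)^{1/p}\quad\text{for all }e\in\mathbb{C}^d$$ (such a matrix exists; a choice is fixed for each $Q$). The Christ--Goldberg auxiliary maximal operator is $$\widetilde M_Wf(x):=\sup_Q\frac1{|Q|}\int_Q|\mathcal W_Qf(y)|\,dy\;\mathbf 1_Q(x),$$ for locally integrable $f:\mathbb{R}^n\to\mathbb{C}^d$, the supremum over bounded cubes with sides parallel to the axes. *)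

theory Defs
  imports "HOL-Analysis.Analysis"
begin

section \<open>Powers and norms with values in the extended nonnegative reals\<close>

(* Only used with exponents s > 0, so that 0 and top are fixed. *)
definition ennpowr :: "ennreal \<Rightarrow> real \<Rightarrow> ennreal" where
  "ennpowr x s = (if x = top then top else ennreal (enn2real x powr s))"

definition Lp_norm :: "real \<Rightarrow> (real^'n \<Rightarrow> ennreal) \<Rightarrow> ennreal" where
  "Lp_norm p g = ennpowr (\<integral>\<^sup>+x. ennpowr (g x) p \<partial>lebesgue) (1 / p)"

definition lq_norm :: "real \<Rightarrow> (nat \<Rightarrow> ennreal) \<Rightarrow> ennreal" where
  "lq_norm q a = ennpowr (\<Sum>k. ennpowr (a k) q) (1 / q)"

definition locally_integrable :: "(real^'n \<Rightarrow> 'b::euclidean_space) \<Rightarrow> bool" where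
  "locally_integrable f \<longleftrightarrow> (\<forall>K. compact K \<longrightarrow> f absolutely_integrable_on K)"

section \<open>Complex matrices\<close>

definition ctranspose :: "complex^'d^'d \<Rightarrow> complex^'d^'d" where
  "ctranspose A = map_matrix cnj (transpose A)"

definition unitary :: "complex^'d^'d \<Rightarrow> bool" where
  "unitary U \<longleftrightarrow> ctranspose U ** U = mat 1 \<and> U ** ctranspose U = mat 1"

definition diag_mat :: "('d \<Rightarrow> real) \<Rightarrow> complex^'d^'d" where
  "diag_mat a = (\<chi> i j. if i = j then complex_of_real (a i) else 0)"

definition hermitian :: "complex^'d^'d \<Rightarrow> bool" where
  "hermitian A \<longleftrightarrow> ctranspose A = A"

definition pos_definite :: "complex^'d^'d \<Rightarrow> bool" where
  "pos_definite A \<longleftrightarrow> hermitian A \<and> (\<forall>v. v \<noteq> 0 \<longrightarrow> 0 < Re (\<Sum>i\<in>UNIV. cnj (v $ i) * (A *v v) $ i))"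

(* A^s by functional calculus: A = U diag(a) U* with U unitary gives A^s = U diag(a^s) U*.
   By the lemma below the result does not depend on the diagonalization; a diagonalization
   exists for every Hermitian A, with positive a if A is positive definite. *)
definition mat_powr :: "complex^'d^'d \<Rightarrow> real \<Rightarrow> complex^'d^'d" where
  "mat_powr A s = (THE B. \<exists>U a. unitary U \<and> A = U ** diag_mat a ** ctranspose U
                                \<and> B = U ** diag_mat (\<lambda>i. a i powr s) ** ctranspose U)"

lemma diag_mat_mult_right: "(P ** diag_mat a) $ i $ j = P $ i $ j * complex_of_real (a j)"
  by (simp add: matrix_matrix_mult_def diag_mat_def if_distrib cong: if_cong)

lemma diag_mat_mult_left: "(diag_mat a ** P) $ i $ j = complex_of_real (a i) * P $ i $ j"
  by (simp add: matrix_matrix_mult_def diag_mat_def if_distrib[of "\<lambda>z. z * _"] cong: if_cong)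

lemma functional_calculus_unique:
  assumes U: "unitary U" and V: "unitary V"
    and eq: "U ** diag_mat a ** ctranspose U = V ** diag_mat b ** ctranspose V"
  shows "U ** diag_mat (\<lambda>i. f (a i)) ** ctranspose U = V ** diag_mat (\<lambda>i. f (b i)) ** ctranspose V"
proof -
  define P where "P = ctranspose V ** U"
  have U1: "ctranspose U ** U = mat 1" "U ** ctranspose U = mat 1"
    and V1: "ctranspose V ** V = mat 1" "V ** ctranspose V = mat 1"
    using U V by (auto simp: unitary_def)
  have "P ** diag_mat a = ctranspose V ** (U ** diag_mat a ** ctranspose U) ** U"
    by (metis P_def U1(1) matrix_mul_assoc matrix_mul_rid)
  also have "\<dots> = diag_mat b ** P"
    unfolding eq by (metis P_def V1(1) matrix_mul_assoc matrix_mul_lid)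
  finally have PD: "P ** diag_mat a = diag_mat b ** P" .
  have "P $ i $ j * complex_of_real (f (a j)) = complex_of_real (f (b i)) * P $ i $ j" for i j
  proof -
    have "P $ i $ j * complex_of_real (a j) = complex_of_real (b i) * P $ i $ j"
      using arg_cong[OF PD, of "\<lambda>M. M $ i $ j"]
      by (simp add: diag_mat_mult_left diag_mat_mult_right)
    then show ?thesis by (cases "P $ i $ j = 0") auto
  qed
  then have *: "P ** diag_mat (\<lambda>i. f (a i)) = diag_mat (\<lambda>i. f (b i)) ** P"
    by (simp add: vec_eq_iff diag_mat_mult_left diag_mat_mult_right)
  have "U ** diag_mat (\<lambda>i. f (a i)) ** ctranspose U
      = V ** (P ** diag_mat (\<lambda>i. f (a i))) ** ctranspose U"
    by (metis P_def V1(2) matrix_mul_assoc matrix_mul_lid)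
  also have "\<dots> = V ** diag_mat (\<lambda>i. f (b i)) ** ctranspose V"
    unfolding * by (metis P_def U1(2) matrix_mul_assoc matrix_mul_rid)
  finally show ?thesis .
qed

lemma mat_powr_eq:
  assumes "unitary U" "A = U ** diag_mat a ** ctranspose U"
  shows "mat_powr A s = U ** diag_mat (\<lambda>i. a i powr s) ** ctranspose U"
  unfolding mat_powr_def using assms
  by (intro the_equality) (auto intro!: functional_calculus_unique[where f = "\<lambda>t. t powr s"])

(* The norm of the type complex^'d^'d is the Frobenius norm, hence the explicit operator norm. *)
definition op_norm :: "complex^'d^'d \<Rightarrow> real" where
  "op_norm A = onorm (\<lambda>v. A *v v)"

section \<open>Cubes and averages\<close>

(* Products of bounded intervals of a common length l > 0; each interval may or may not contain
   either of its endpoints. *)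
definition cubes :: "(real^'n) set set" where
  "cubes = {{x. \<forall>i. x $ i \<in> I i} |I.
     \<exists>a l. 0 < l \<and> (\<forall>i. {a i<..<a i + l} \<subseteq> I i \<and> I i \<subseteq> {a i..a i + l})}"

definition avg :: "(real^'n) set \<Rightarrow> (real^'n \<Rightarrow> ennreal) \<Rightarrow> ennreal" where
  "avg Q g = (\<integral>\<^sup>+x\<in>Q. g x \<partial>lebesgue) / emeasure lebesgue Q"

section \<open>Matrix weights, reducing operators and the auxiliary maximal operator\<close>

definition matrix_weight :: "(real^'n \<Rightarrow> complex^'d^'d) \<Rightarrow> bool" where
  "matrix_weight W \<longleftrightarrow> locally_integrable W \<and> (AE x in lebesgue. pos_definite (W x))"

definition Ap_char :: "real \<Rightarrow> (real^'n \<Rightarrow> complex^'d^'d) \<Rightarrow> ennreal" where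
  "Ap_char p W = (let p' = p / (p - 1) in
     SUP Q\<in>cubes. avg Q (\<lambda>x. ennpowr
       (avg Q (\<lambda>y. ennreal (op_norm (mat_powr (W x) (1 / p) ** mat_powr (W y) (- 1 / p)) powr p')))
       (p / p')))"

definition matrix_Ap_weight :: "real \<Rightarrow> (real^'n \<Rightarrow> complex^'d^'d) \<Rightarrow> bool" where
  "matrix_Ap_weight p W \<longleftrightarrow> matrix_weight W \<and> Ap_char p W < top"

definition reducing_operator ::
  "real \<Rightarrow> (real^'n \<Rightarrow> complex^'d^'d) \<Rightarrow> (real^'n) set \<Rightarrow> complex^'d^'d \<Rightarrow> bool" where
  "reducing_operator p W Q R \<longleftrightarrow> pos_definite R \<and>
     (\<forall>e. let m = ennpowr (avg Q (\<lambda>x. ennreal (norm (mat_powr (W x) (1 / p) *v e) powr p))) (1 / p)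
          in m \<le> ennreal (norm (R *v e)) \<and>
             ennreal (norm (R *v e)) \<le> ennreal (sqrt (real CARD('d))) * m)"

(* R assigns to each cube the chosen reducing operator. *)
definition christ_goldberg ::
  "((real^'n) set \<Rightarrow> complex^'d^'d) \<Rightarrow> (real^'n \<Rightarrow> complex^'d) \<Rightarrow> real^'n \<Rightarrow> ennreal" where
  "christ_goldberg R f x =
     (SUP Q\<in>cubes. avg Q (\<lambda>y. ennreal (norm (R Q *v f y))) * indicator Q x)"

end

theory Submission
  imports Defs
begin

text \<open>
  Write \<open>P x\<close> and \<open>J x\<close> for the powers of \<open>W x\<close> with exponents \<open>1 / p\<close> and \<open>- 1 / p\<close>, and let
  \<open>p' = p / (p - 1)\<close>. With \<open>w Q y = (\<Sum>b\<in>Basis. |J y (R Q b)|)\<close> and the scalar function \<open>h = |P f|\<close> one has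
  \<open>|R Q f| \<le> w Q * h\<close>, and the Muckenhoupt condition bounds the averages of \<open>w Q\<close> to the power p'.
  By the one-third trick the supremum over all cubes reduces to finitely many dyadic grids, hence to
  finite laminar families of cubes.

  In such a family pass from Q to the maximal smaller cubes P where the average of \<open>w Q * h\<close> or the norm
  of \<open>R P\<close> composed with the inverse of \<open>R Q\<close> jumps. These children fill at most half of Q, so the
  Muckenhoupt condition leaves them at most the fraction \<open>1 - \<theta>\<close> of the mass of \<open>w Q\<close> to the power p', with
  \<open>1 / \<theta>\<close> of order \<open>[W] powr (1 / (p - 1))\<close>. This geometric decay replaces the reverse Hoelder inequality:
  Hoelder's inequality with weights decaying along the tree bounds the integral of \<open>w Q * h\<close> over Q by
  a potential V, and V telescopes when summed over the tree.

  This gives the case \<open>q = p\<close> with exponent \<open>1 / p + 1 / (p - 1)\<close>. For \<open>q > p\<close> one interpolates with the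
  trivial bound for \<open>q = \<infinity>\<close>. For \<open>q < p\<close> let S be the sum of the q-th powers of the maximal functions.
  One tests against a power of \<open>\<Psi> = S powr ((p - 1) / q)\<close>; the maximal function \<open>sup w Q * average Q \<Psi>\<close>, which
  is bounded on the unweighted space with exponent p', provides the weight on the other side, and the
  remaining power of S is absorbed. The exponent is the same in all cases, and it is at most the
  claimed one because \<open>[W]\<close> is bounded below.
\<close>

section \<open>Powers and the inequality of Hoelder in the extended nonnegative reals\<close>

text \<open>The obstacle is that the weight belongs to the cube: passing to a smaller cube changes
  \<open>w Q\<close>, so no single scalar weight governs the operator. Stopping at large ratios
  controls this change. The potential estimate below Q is then made with the weight of Q alone,
  which is why the decay is demanded of one fixed \<open>\<sigma> Q\<close> on every member below Q.
  The exponent adds up two losses. The mass of \<open>\<sigma> Q\<close> per unit of measure is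
  \<open>A\<close>, of order [W] to the power 1 / (p - 1), and enters with the power q - 1; the rate
  \<open>\<theta>\<close> is proportional to 1 / \<open>A\<close> and enters with the power - q, one
  unit of which sums the geometric series. This makes \<open>A powr (2 * q - 1)\<close>, and for q =
  p the p-th root gives (2 p - 1) / (p (p - 1)) = 1 / p + 1 / (p - 1). The decay itself is the
  pairing |v . e| <= |J v| |P e|, integrated outside a set of at most half the measure. With the
  empty set it yields \<open>\<theta>\<close> <= 1, and this is the source of the lower bound for
  [W].\<close>

lemma ennpowr_ennreal: "0 \<le> r \<Longrightarrow> ennpowr (ennreal r) s = ennreal (r powr s)"
  by (simp add: ennpowr_def)

lemma ennpowr_top [simp]: "ennpowr top s = top"
  by (simp add: ennpowr_def)

lemma ennpowr_0 [simp]: "ennpowr 0 s = 0"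
  by (simp add: ennpowr_def)

lemma ennpowr_one [simp]: "ennpowr 1 s = 1"
  by (simp add: ennpowr_def)

lemma ennpowr_by_1 [simp]: "ennpowr x 1 = x"
  by (cases x) (auto simp: ennpowr_ennreal)

lemma ennpowr_eq_0_iff: "ennpowr x s = 0 \<longleftrightarrow> x = 0"
  by (cases x) (auto simp: ennpowr_ennreal)

lemma ennpowr_eq_top_iff: "ennpowr x s = top \<longleftrightarrow> x = top"
  by (cases x) (auto simp: ennpowr_ennreal)

lemma ennpowr_mono: "x \<le> y \<Longrightarrow> 0 \<le> s \<Longrightarrow> ennpowr x s \<le> ennpowr y s"
  by (cases x; cases y) (auto simp: ennpowr_ennreal top_unique intro!: powr_mono2 ennreal_leI)

lemma ennpowr_mult: "0 < s \<Longrightarrow> ennpowr (x * y) s = ennpowr x s * ennpowr y s"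
  by (cases x; cases y)
    (auto simp: ennpowr_ennreal powr_mult ennreal_mult_top ennreal_top_mult simp flip: ennreal_mult)

lemma ennpowr_ennpowr: "ennpowr (ennpowr x s) t = ennpowr x (s * t)"
  by (cases x) (auto simp: ennpowr_ennreal powr_powr)

lemma ennpowr_add: "0 < s \<Longrightarrow> 0 < t \<Longrightarrow> ennpowr x (s + t) = ennpowr x s * ennpowr x t"
  by (cases x) (auto simp: ennpowr_ennreal powr_add ennreal_mult)

lemma ennpowr_inverse_cancel: "0 < s \<Longrightarrow> ennpowr (ennpowr x s) (1 / s) = x"
  "0 < s \<Longrightarrow> ennpowr (ennpowr x (1 / s)) s = x"
  by (auto simp: ennpowr_ennpowr)

lemma ennpowr_le_iff: "0 < s \<Longrightarrow> ennpowr x s \<le> ennpowr y s \<longleftrightarrow> x \<le> y"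
  by (metis ennpowr_mono ennpowr_inverse_cancel(1) less_imp_le zero_less_divide_1_iff)

lemma ennpowr_SUP: 
  assumes "0 < s"
  shows "ennpowr (SUP i\<in>I. a i) s = (SUP i\<in>I. ennpowr (a i) s)"
proof (rule antisym)
  have "(SUP i\<in>I. a i) \<le> ennpowr (SUP i\<in>I. ennpowr (a i) s) (1 / s)"
  proof (rule SUP_least)
    fix i assume "i \<in> I"
    then have "ennpowr (a i) s \<le> (SUP i\<in>I. ennpowr (a i) s)" by (rule SUP_upper)
    then show "a i \<le> ennpowr (SUP i\<in>I. ennpowr (a i) s) (1 / s)"
      using assms by (metis ennpowr_mono ennpowr_inverse_cancel(1) less_imp_le zero_less_divide_1_iff)
  qed
  then show "ennpowr (SUP i\<in>I. a i) s \<le> (SUP i\<in>I. ennpowr (a i) s)"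
    using assms by (metis ennpowr_le_iff ennpowr_inverse_cancel(2))
next
  show "(SUP i\<in>I. ennpowr (a i) s) \<le> ennpowr (SUP i\<in>I. a i) s"
    using assms by (intro SUP_least ennpowr_mono SUP_upper) auto
qed

lemma borel_measurable_ennpowr [measurable]:
  assumes [measurable]: "f \<in> borel_measurable M"
  shows "(\<lambda>x. ennpowr (f x) s) \<in> borel_measurable M"
proof -
  have "(\<lambda>x. enn2real (f x) powr s) \<in> borel_measurable M"
    unfolding powr_def by measurable
  then show ?thesis
    unfolding ennpowr_def by (intro measurable_If) auto
qed

lemma ennpowr_sum_le:
  assumes "finite I" "0 < s"
  shows "ennpowr (\<Sum>i\<in>I. a i) s \<le> ennreal (real (card I) powr s) * (\<Sum>i\<in>I. ennpowr (a i) s)"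
proof (cases "I = {}")
  case False
  define m where "m = Max (a ` I)"
  have "m \<in> a ` I" unfolding m_def using assms False by (intro Max_in) auto
  then obtain j where j: "j \<in> I" "a j = m" by auto
  have "(\<Sum>i\<in>I. a i) \<le> (\<Sum>i\<in>I. a j)"
    using assms False by (intro sum_mono) (auto simp: j m_def)
  also have "\<dots> = ennreal (real (card I)) * a j" by (simp add: ennreal_of_nat_eq_real_of_nat)
  finally have "ennpowr (\<Sum>i\<in>I. a i) s \<le> ennpowr (ennreal (real (card I)) * a j) s"
    using assms by (intro ennpowr_mono) auto
  also have "\<dots> = ennreal (real (card I) powr s) * ennpowr (a j) s"
    using assms by (simp add: ennpowr_mult ennpowr_ennreal)
  also have "\<dots> \<le> ennreal (real (card I) powr s) * (\<Sum>i\<in>I. ennpowr (a i) s)"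
    using assms j by (intro mult_left_mono member_le_sum) auto
  finally show ?thesis .
qed simp

lemma ennpowr_young:
  assumes "0 < s" "0 < t" "s + t = 1"
  shows "ennpowr x s * ennpowr y t \<le> ennreal s * x + ennreal t * y"
proof (cases "x = top \<or> y = top")
  case True
  then show ?thesis using assms by (auto simp: ennreal_mult_top)
next
  case False
  then obtain a b where ab: "x = ennreal a" "y = ennreal b" "0 \<le> a" "0 \<le> b"
    by (cases x; cases y) auto
  have "a powr s * b powr t \<le> s * a + t * b"
    using Youngs_inequality_0[of s t a b] assms ab by (cases "a = 0 \<or> b = 0") auto
  then show ?thesis using ab assms
    by (simp add: ennpowr_ennreal flip: ennreal_mult ennreal_plus)
qed

text \<open>Powers with s + t = 1 instead of conjugate exponents keep every later application free
  of roots. Normalising divides by both integrals, so 0 and top are separated first: a zero integral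
  makes one factor vanish almost everywhere, which also settles 0 * top.\<close>

lemma nn_integral_Hoelder:
  assumes [measurable]: "f \<in> borel_measurable M" "g \<in> borel_measurable M"
    and st: "0 < s" "0 < t" "s + t = 1"
  shows "(\<integral>\<^sup>+x. ennpowr (f x) s * ennpowr (g x) t \<partial>M)
       \<le> ennpowr (\<integral>\<^sup>+x. f x \<partial>M) s * ennpowr (\<integral>\<^sup>+x. g x \<partial>M) t"
proof -
  let ?F = "\<integral>\<^sup>+x. f x \<partial>M" and ?G = "\<integral>\<^sup>+x. g x \<partial>M"
  consider "?F = 0 \<or> ?G = 0" | "?F \<noteq> 0" "?G \<noteq> 0" "?F = top \<or> ?G = top"
    | "?F \<noteq> 0" "?F \<noteq> top" "?G \<noteq> 0" "?G \<noteq> top"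
    by blast
  then show ?thesis
  proof cases
    case 1
    then have "(\<integral>\<^sup>+x. ennpowr (f x) s * ennpowr (g x) t \<partial>M) = 0"
      by (auto simp: nn_integral_0_iff_AE ennpowr_eq_0_iff elim: eventually_mono)
    then show ?thesis by simp
  next
    case 2
    then have "ennpowr ?F s * ennpowr ?G t = top"
      by (auto simp: ennreal_mult_eq_top_iff ennpowr_eq_0_iff ennpowr_eq_top_iff)
    then show ?thesis by simp
  next
    case 3
    have cF: "?F * inverse ?F = 1" and cG: "?G * inverse ?G = 1"
      using 3 by (simp_all add: ennreal_divide_self less_top flip: divide_ennreal_def)
    have "(\<integral>\<^sup>+x. ennpowr (f x) s * ennpowr (g x) t \<partial>M) =
      (\<integral>\<^sup>+x. (ennpowr ?F s * ennpowr ?G t) * (ennpowr (inverse ?F * f x) s * ennpowr (inverse ?G * g x) t) \<partial>M)"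
    proof (intro nn_integral_cong)
      fix x
      have f: "f x = ?F * (inverse ?F * f x)" and g: "g x = ?G * (inverse ?G * g x)"
        by (simp_all add: cF cG flip: mult.assoc)
      have "ennpowr (f x) s = ennpowr ?F s * ennpowr (inverse ?F * f x) s"
        "ennpowr (g x) t = ennpowr ?G t * ennpowr (inverse ?G * g x) t"
        using f g st by (metis ennpowr_mult)+
      then show "ennpowr (f x) s * ennpowr (g x) t = (ennpowr ?F s * ennpowr ?G t) * (ennpowr (inverse ?F * f x) s * ennpowr (inverse ?G * g x) t)"
        by (simp add: mult_ac)
    qed
    also have "\<dots> \<le> (\<integral>\<^sup>+x. (ennpowr ?F s * ennpowr ?G t) * (ennreal s * (inverse ?F * f x) + ennreal t * (inverse ?G * g x)) \<partial>M)"
      by (intro nn_integral_mono mult_left_mono ennpowr_young st) auto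
    also have "\<dots> = (ennpowr ?F s * ennpowr ?G t) * (ennreal s * (inverse ?F * ?F) + ennreal t * (inverse ?G * ?G))"
      by (simp add: nn_integral_cmult nn_integral_add)
    also have "\<dots> = ennpowr ?F s * ennpowr ?G t"
      using st cF cG by (simp add: mult.commute flip: ennreal_plus)
    finally show ?thesis .
  qed
qed

lemma nn_set_integral_Hoelder:
  assumes [measurable]: "f \<in> borel_measurable M" "g \<in> borel_measurable M" "A \<in> sets M"
    and st: "0 < s" "0 < t" "s + t = 1"
  shows "(\<integral>\<^sup>+x\<in>A. ennpowr (f x) s * ennpowr (g x) t \<partial>M)
       \<le> ennpowr (\<integral>\<^sup>+x\<in>A. f x \<partial>M) s * ennpowr (\<integral>\<^sup>+x\<in>A. g x \<partial>M) t"
proof -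
  have "(\<integral>\<^sup>+x\<in>A. ennpowr (f x) s * ennpowr (g x) t \<partial>M) =
     (\<integral>\<^sup>+x. ennpowr (f x * indicator A x) s * ennpowr (g x * indicator A x) t \<partial>M)"
    by (intro nn_integral_cong) (auto simp: indicator_def)
  also have "\<dots> \<le> ennpowr (\<integral>\<^sup>+x\<in>A. f x \<partial>M) s * ennpowr (\<integral>\<^sup>+x\<in>A. g x \<partial>M) t"
    by (intro nn_integral_Hoelder st) auto
  finally show ?thesis .
qed

lemma sum_Hoelder:
  assumes "finite I" "0 < s" "0 < t" "s + t = 1"
  shows "(\<Sum>i\<in>I. ennpowr (a i) s * ennpowr (b i) t) \<le> ennpowr (\<Sum>i\<in>I. a i) s * ennpowr (\<Sum>i\<in>I. b i) t"
  using nn_integral_Hoelder[of a "count_space I" b s t] assms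
  by (simp add: nn_integral_count_space_finite)

section \<open>Stopping trees in laminar families\<close>

definition laminar :: "'a set set \<Rightarrow> bool" where
  "laminar F \<longleftrightarrow> (\<forall>P\<in>F. \<forall>Q\<in>F. P \<inter> Q = {} \<or> P \<subseteq> Q \<or> Q \<subseteq> P)"

text \<open>\<open>s\<close> receives the parent as its second argument: the function whose average
  is tested belongs to the parent and changes with each generation.\<close>

definition stopping_children :: "'a set set \<Rightarrow> ('a set \<Rightarrow> 'a set \<Rightarrow> bool) \<Rightarrow> 'a set \<Rightarrow> 'a set set" where
  "stopping_children F s Q =
     {P \<in> F. P \<subset> Q \<and> s P Q \<and> (\<forall>P'\<in>F. P \<subset> P' \<longrightarrow> P' \<subset> Q \<longrightarrow> \<not> s P' Q)}"

lemma stopping_childrenD: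
  assumes "P \<in> stopping_children F s Q"
  shows "P \<in> F" "P \<subset> Q" "s P Q"
  using assms by (auto simp: stopping_children_def)

lemma finite_stopping_children: "finite F \<Longrightarrow> finite (stopping_children F s Q)"
  by (simp add: stopping_children_def)

lemma disjoint_stopping_children: "laminar F \<Longrightarrow> disjoint (stopping_children F s Q)"
proof (unfold disjoint_def, intro ballI impI)
  fix A B assume "laminar F" and AB: "A \<in> stopping_children F s Q" "B \<in> stopping_children F s Q" "A \<noteq> B"
  then consider "A \<inter> B = {}" | "A \<subset> B" | "B \<subset> A"
    unfolding laminar_def by (metis stopping_childrenD(1) psubsetI)
  then show "A \<inter> B = {}"
    using AB unfolding stopping_children_def by cases blast+
qed

lemma below_stopping_child:
  assumes "finite F" "P \<in> F" "P \<subset> Q" "s P Q"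
  obtains P' where "P' \<in> stopping_children F s Q" "P \<subseteq> P'"
proof -
  define A where "A = {P'\<in>F. P' \<subset> Q \<and> s P' Q}"
  have "finite A" "P \<in> A" using assms by (auto simp: A_def)
  then have "\<exists>m\<in>A. P \<subseteq> m \<and> (\<forall>b\<in>A. m \<subseteq> b \<longrightarrow> m = b)" by (rule finite_has_maximal2)
  then obtain P' where "P' \<in> A" "P \<subseteq> P'" and mx: "\<And>R. R \<in> A \<Longrightarrow> P' \<subseteq> R \<Longrightarrow> P' = R"
    by blast
  have "P' \<in> stopping_children F s Q"
    unfolding stopping_children_def
  proof (intro CollectI conjI ballI impI notI)
    fix R assume "R \<in> F" "P' \<subset> R" "R \<subset> Q" "s R Q"
    then show False using mx[of R] by (auto simp: A_def)
  qed (use \<open>P' \<in> A\<close> in \<open>auto simp: A_def\<close>)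
  then show ?thesis using \<open>P \<subseteq> P'\<close> by (rule that)
qed

lemma wf_psubset_finite:
  assumes "finite F"
  shows "wf {(P, Q). P \<in> F \<and> P \<subset> Q}"
proof (rule wf_subset[OF Wellfounded.wf_measure[of "\<lambda>Q. card {R \<in> F. R \<subset> Q}"]], rule subrelI)
  fix P Q assume "(P, Q) \<in> {(P, Q). P \<in> F \<and> P \<subset> Q}"
  then show "(P, Q) \<in> Wellfounded.measure (\<lambda>Q. card {R \<in> F. R \<subset> Q})"
    using assms by (auto intro!: psubset_card_mono)
qed

text \<open>Well-founded recursion along strict inclusion. Unfolded, \<open>V Q\<close> sums
  \<open>a\<close> over all chains of children starting at Q, each weighted by k to the power of its
  length.\<close>

lemma tree_potential_exists:
  fixes a :: "'a set \<Rightarrow> ennreal"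
  assumes "finite F" and Ch: "\<And>P Q. P \<in> Ch Q \<Longrightarrow> P \<in> F \<and> P \<subset> Q"
  shows "\<exists>V. \<forall>Q. V Q = a Q + k * (\<Sum>P\<in>Ch Q. V P)"
proof -
  let ?R = "{(P, Q). P \<in> F \<and> P \<subset> Q}"
  let ?H = "\<lambda>V Q. a Q + k * (\<Sum>P\<in>Ch Q. V P)"
  have "wfrec ?R ?H Q = a Q + k * (\<Sum>P\<in>Ch Q. wfrec ?R ?H P)" for Q
  proof -
    have "(\<Sum>P\<in>Ch Q. cut (wfrec ?R ?H) ?R Q P) = (\<Sum>P\<in>Ch Q. wfrec ?R ?H P)"
      using Ch by (intro sum.cong) (auto simp: cut_apply)
    then show ?thesis
      by (subst wfrec[OF wf_psubset_finite[OF assms(1)]]) simp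
  qed
  then show ?thesis by blast
qed

lemma nn_set_integral_Union_disjoint:
  assumes "finite C" "C \<subseteq> sets M" "disjoint C" and [measurable]: "f \<in> borel_measurable M"
  shows "(\<integral>\<^sup>+x\<in>\<Union>C. f x \<partial>M) = (\<Sum>P\<in>C. \<integral>\<^sup>+x\<in>P. f x \<partial>M)"
proof -
  have "indicator (\<Union>C) x = (\<Sum>P\<in>C. indicator P x :: ennreal)" for x
    using assms indicator_UN_disjoint[of C "\<lambda>x. x" x] by (auto simp: disjoint_family_on_def disjoint_def)
  then have "(\<integral>\<^sup>+x\<in>\<Union>C. f x \<partial>M) = (\<integral>\<^sup>+x. (\<Sum>P\<in>C. f x * indicator P x) \<partial>M)"
    by (simp add: sum_distrib_left)
  also have "\<dots> = (\<Sum>P\<in>C. \<integral>\<^sup>+x\<in>P. f x \<partial>M)"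
    using assms by (intro nn_integral_sum) auto
  finally show ?thesis .
qed

lemma nn_set_integral_split:
  assumes "P \<in> sets M" "U \<in> sets M" "U \<subseteq> P" and [measurable]: "f \<in> borel_measurable M"
  shows "(\<integral>\<^sup>+x\<in>P. f x \<partial>M) = (\<integral>\<^sup>+x\<in>P - U. f x \<partial>M) + (\<integral>\<^sup>+x\<in>U. f x \<partial>M)"
  using assms by (subst nn_integral_add[symmetric]) (auto intro!: nn_integral_cong simp: indicator_def)

lemma nn_set_integral_mono:
  "A \<subseteq> B \<Longrightarrow> (\<And>x. x \<in> A \<Longrightarrow> f x \<le> g x) \<Longrightarrow> (\<integral>\<^sup>+x\<in>A. f x \<partial>M) \<le> (\<integral>\<^sup>+x\<in>B. (g x::ennreal) \<partial>M)"
  by (intro nn_integral_mono) (auto simp: indicator_def)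

section \<open>Telescoping and decay along a stopping tree\<close>

locale stopping_tree =
  fixes M :: "'a measure" and F :: "'a set set" and s :: "'a set \<Rightarrow> 'a set \<Rightarrow> bool"
    and g :: "'a \<Rightarrow> ennreal" and \<kappa> :: real and V :: "'a set \<Rightarrow> ennreal"
  assumes finF: "finite F" and Fsets: "F \<subseteq> sets M" and lam: "laminar F"
    and g_meas [measurable]: "g \<in> borel_measurable M"
    and \<kappa>: "0 < \<kappa>" "\<kappa> < 1"
    and V: "V Q = (\<integral>\<^sup>+x\<in>Q - \<Union>(stopping_children F s Q). g x \<partial>M)
                    + ennreal \<kappa> * (\<Sum>P\<in>stopping_children F s Q. V P)"
begin

abbreviation Ch where "Ch \<equiv> stopping_children F s"

lemma Ch_facts: "finite (Ch Q)" "Ch Q \<subseteq> sets M" "disjoint (Ch Q)" "\<Union>(Ch Q) \<in> sets M" "\<Union>(Ch Q) \<subseteq> Q"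
  "P \<in> Ch Q \<Longrightarrow> P \<in> F \<and> P \<subset> Q"
proof -
  show f: "finite (Ch Q)" using finF by (rule finite_stopping_children)
  show s: "Ch Q \<subseteq> sets M" using Fsets by (auto dest: stopping_childrenD)
  show "disjoint (Ch Q)" using lam by (rule disjoint_stopping_children)
  show "\<Union>(Ch Q) \<in> sets M" using f s by (rule sets.finite_Union)
qed (auto dest: stopping_childrenD)

lemma integral_Ch:
  assumes "f \<in> borel_measurable M" "Q \<in> F"
  shows "(\<integral>\<^sup>+x\<in>Q. f x \<partial>M) = (\<integral>\<^sup>+x\<in>Q - \<Union>(Ch Q). f x \<partial>M) + (\<Sum>P\<in>Ch Q. \<integral>\<^sup>+x\<in>P. f x \<partial>M)"
  using assms Fsets Ch_facts(1-5)[of Q]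
  by (subst nn_set_integral_split[of Q M "\<Union>(Ch Q)"]) (auto simp: nn_set_integral_Union_disjoint)

lemma tree_induct [consumes 1]:
  assumes "Q \<in> F" "\<And>Q. Q \<in> F \<Longrightarrow> (\<And>P. P \<in> Ch Q \<Longrightarrow> X P) \<Longrightarrow> X Q"
  shows "X Q"
  using assms(1)
proof (induction Q rule: wf_induct_rule[OF wf_psubset_finite[OF finF]])
  case (1 Q)
  then show ?case using assms(2) Ch_facts(6) by blast
qed

definition sup_on where "sup_on B Q x = (SUP P\<in>{P\<in>F. P \<subseteq> Q}. indicator P x * (B P x :: ennreal))"

text \<open>Members not below a child are dominated by \<open>C * B Q\<close>, so the supremum at x
  is at most the sum of \<open>C * B\<close> over the tree members containing x. The potentials of
  these members weigh g at x by 1, \<open>\<kappa>\<close>, \<open>\<kappa>\<close> squared and so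
  on, according to how many generations of children still lie below them at x; the geometric series
  costs 1 / (1 - \<open>\<kappa>\<close>).\<close>

lemma tree_sup_bound:
  assumes [measurable]: "\<And>Q. Q \<in> F \<Longrightarrow> B Q \<in> borel_measurable M"
    and C: "1 \<le> C"
    and stop: "\<And>P Q x. P \<in> F \<Longrightarrow> Q \<in> F \<Longrightarrow> P \<subset> Q \<Longrightarrow> \<not> s P Q \<Longrightarrow> x \<in> P \<Longrightarrow> B P x \<le> C * B Q x"
    and bound: "\<And>Q. Q \<in> F \<Longrightarrow> C * (\<integral>\<^sup>+x\<in>Q. B Q x \<partial>M) \<le> C0 * V Q"
  shows "ennreal (1 - \<kappa>) * (\<integral>\<^sup>+x. (SUP Q\<in>F. indicator Q x * B Q x) \<partial>M) \<le> C0 * (\<integral>\<^sup>+x. g x \<partial>M)"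
proof -
  have m[measurable]: "sup_on B Q \<in> borel_measurable M" for Q
    unfolding sup_on_def using finF Fsets
    by (intro borel_measurable_SUP countable_finite borel_measurable_times borel_measurable_indicator assms) auto
  have pt: "sup_on B Q x * indicator Q x \<le> C * (B Q x * indicator Q x) + (\<Sum>P\<in>Ch Q. sup_on B P x * indicator P x)"
    if Q: "Q \<in> F" for Q x
  proof (cases "x \<in> Q")
    case True
    have "indicator P x * B P x \<le> C * B Q x + (\<Sum>P\<in>Ch Q. sup_on B P x * indicator P x)" (is "_ \<le> ?r")
      if P: "P \<in> F" "P \<subseteq> Q" for P
    proof -
      consider "x \<notin> P" | "x \<in> P" "P = Q" | "x \<in> P" "P \<subset> Q" "s P Q" | "x \<in> P" "P \<subset> Q" "\<not> s P Q"
        using P by auto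
      then show ?thesis
      proof cases
        case 2
        have "1 * B Q x \<le> C * B Q x" using C by (intro mult_right_mono) auto
        also have "\<dots> \<le> ?r" by simp
        finally show ?thesis using 2 by simp
      next
        case 3
        obtain P' where P': "P' \<in> Ch Q" "P \<subseteq> P'"
          using below_stopping_child[OF finF P(1) 3(2)] 3 by metis
        have "indicator P x * B P x \<le> sup_on B P' x"
          unfolding sup_on_def using P P' by (intro SUP_upper) auto
        also have "\<dots> = sup_on B P' x * indicator P' x" using 3 P' by (simp add: subset_eq)
        also have "\<dots> \<le> (\<Sum>P\<in>Ch Q. sup_on B P x * indicator P x)"
          using P' Ch_facts by (intro member_le_sum) auto
        also have "\<dots> \<le> ?r" by (simp add: add_increasing)
        finally show ?thesis .
      next
        case 4
        have "indicator P x * B P x \<le> C * B Q x" using stop[OF P(1) Q 4(2,3,1)] 4 by simp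
        also have "\<dots> \<le> ?r" by simp
        finally show ?thesis .
      qed simp
    qed
    then have "sup_on B Q x \<le> C * B Q x + (\<Sum>P\<in>Ch Q. sup_on B P x * indicator P x)"
      unfolding sup_on_def[of B Q] by (intro SUP_least) auto
    then show ?thesis using True by simp
  qed simp
  (* The term with V makes the induction telescope. *)
  have main: "ennreal (1 - \<kappa>) * (\<integral>\<^sup>+x\<in>Q. sup_on B Q x \<partial>M) + ennreal \<kappa> * (C0 * V Q) \<le> C0 * (\<integral>\<^sup>+x\<in>Q. g x \<partial>M)"
    if "Q \<in> F" for Q
    using that
  proof (induction Q rule: tree_induct)
    case (1 Q)
    let ?T = "\<lambda>P. \<integral>\<^sup>+x\<in>P. sup_on B P x \<partial>M"
    have [measurable]: "Q \<in> sets M" "\<And>P. P \<in> Ch Q \<Longrightarrow> P \<in> sets M" using 1 Fsets Ch_facts by auto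
    have "?T Q \<le> (\<integral>\<^sup>+x. C * (B Q x * indicator Q x) + (\<Sum>P\<in>Ch Q. sup_on B P x * indicator P x) \<partial>M)"
      using 1 by (intro nn_integral_mono pt) auto
    also have "\<dots> = C * (\<integral>\<^sup>+x\<in>Q. B Q x \<partial>M) + (\<Sum>P\<in>Ch Q. ?T P)"
      using 1 by (subst nn_integral_add) (auto simp: nn_integral_cmult nn_integral_sum)
    also have "\<dots> \<le> C0 * V Q + (\<Sum>P\<in>Ch Q. ?T P)" using 1 by (intro add_mono bound) auto
    finally have "ennreal (1 - \<kappa>) * ?T Q + ennreal \<kappa> * (C0 * V Q)
       \<le> ennreal (1 - \<kappa>) * (C0 * V Q + (\<Sum>P\<in>Ch Q. ?T P)) + ennreal \<kappa> * (C0 * V Q)"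
      by (intro add_mono mult_left_mono) auto
    also have "\<dots> = (ennreal (1 - \<kappa>) + ennreal \<kappa>) * (C0 * V Q) + (\<Sum>P\<in>Ch Q. ennreal (1 - \<kappa>) * ?T P)"
      by (simp add: distrib_left distrib_right sum_distrib_left add_ac)
    also have "ennreal (1 - \<kappa>) + ennreal \<kappa> = 1" using \<kappa> by (simp flip: ennreal_plus)
    also have "1 * (C0 * V Q) + (\<Sum>P\<in>Ch Q. ennreal (1 - \<kappa>) * ?T P) =
       C0 * (\<integral>\<^sup>+x\<in>Q - \<Union>(Ch Q). g x \<partial>M) + (\<Sum>P\<in>Ch Q. ennreal (1 - \<kappa>) * ?T P + ennreal \<kappa> * (C0 * V P))"
      by (subst V) (simp add: distrib_left sum_distrib_left sum.distrib mult_ac add_ac)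
    also have "\<dots> \<le> C0 * (\<integral>\<^sup>+x\<in>Q - \<Union>(Ch Q). g x \<partial>M) + (\<Sum>P\<in>Ch Q. C0 * (\<integral>\<^sup>+x\<in>P. g x \<partial>M))"
      by (intro add_mono sum_mono 1) auto
    also have "\<dots> = C0 * (\<integral>\<^sup>+x\<in>Q. g x \<partial>M)"
      using 1 by (subst (2) integral_Ch) (auto simp: distrib_left sum_distrib_left)
    finally show ?case .
  qed
  \<comment> \<open>F has no common top cube, so the tree is a forest. Its roots are the maximal
    members, which are disjoint and whose contributions therefore add up.\<close>
  define Mx where "Mx = {Q\<in>F. \<forall>P\<in>F. Q \<subseteq> P \<longrightarrow> Q = P}"
  have Mx: "finite Mx" "Mx \<subseteq> F" using finF by (auto simp: Mx_def)
  have "disjoint Mx"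
  proof (unfold disjoint_def, intro ballI impI)
    fix A B assume AB: "A \<in> Mx" "B \<in> Mx" "A \<noteq> B"
    then have "\<not> A \<subseteq> B" "\<not> B \<subseteq> A" "A \<in> F" "B \<in> F" unfolding Mx_def by blast+
    then show "A \<inter> B = {}" using lam unfolding laminar_def by metis
  qed
  note Mx = Mx this
  have [measurable]: "\<And>P. P \<in> Mx \<Longrightarrow> P \<in> sets M" using Mx Fsets by auto
  have "(SUP Q\<in>F. indicator Q x * B Q x) \<le> (\<Sum>Q\<in>Mx. sup_on B Q x * indicator Q x)" for x
  proof (rule SUP_least)
    fix P assume P: "P \<in> F"
    obtain Q where Q: "Q \<in> Mx" "P \<subseteq> Q"
      using finite_has_maximal2[OF finF P] unfolding Mx_def by blast
    have "indicator P x * B P x \<le> sup_on B Q x * indicator Q x"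
    proof (cases "x \<in> P")
      case True
      then have "indicator P x * B P x \<le> sup_on B Q x" unfolding sup_on_def using P Q by (intro SUP_upper) auto
      then show ?thesis using True Q by (auto simp: indicator_def)
    qed simp
    also have "\<dots> \<le> (\<Sum>Q\<in>Mx. sup_on B Q x * indicator Q x)"
      using Q Mx by (intro member_le_sum) auto
    finally show "indicator P x * B P x \<le> (\<Sum>Q\<in>Mx. sup_on B Q x * indicator Q x)" .
  qed
  then have "ennreal (1 - \<kappa>) * (\<integral>\<^sup>+x. (SUP Q\<in>F. indicator Q x * B Q x) \<partial>M)
     \<le> ennreal (1 - \<kappa>) * (\<integral>\<^sup>+x. (\<Sum>Q\<in>Mx. sup_on B Q x * indicator Q x) \<partial>M)"
    by (intro mult_left_mono nn_integral_mono) auto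
  also have "\<dots> = (\<Sum>Q\<in>Mx. ennreal (1 - \<kappa>) * (\<integral>\<^sup>+x\<in>Q. sup_on B Q x \<partial>M))"
    by (subst nn_integral_sum) (auto simp: sum_distrib_left)
  also have "\<dots> \<le> (\<Sum>Q\<in>Mx. C0 * (\<integral>\<^sup>+x\<in>Q. g x \<partial>M))"
  proof (rule sum_mono)
    fix Q assume "Q \<in> Mx"
    have "ennreal (1 - \<kappa>) * (\<integral>\<^sup>+x\<in>Q. sup_on B Q x \<partial>M)
      \<le> ennreal (1 - \<kappa>) * (\<integral>\<^sup>+x\<in>Q. sup_on B Q x \<partial>M) + ennreal \<kappa> * (C0 * V Q)" by simp
    also have "\<dots> \<le> C0 * (\<integral>\<^sup>+x\<in>Q. g x \<partial>M)" using \<open>Q \<in> Mx\<close> Mx by (intro main) auto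
    finally show "ennreal (1 - \<kappa>) * (\<integral>\<^sup>+x\<in>Q. sup_on B Q x \<partial>M) \<le> C0 * (\<integral>\<^sup>+x\<in>Q. g x \<partial>M)" .
  qed
  also have "\<dots> = C0 * (\<integral>\<^sup>+x\<in>\<Union>Mx. g x \<partial>M)"
    using Mx Fsets by (subst nn_set_integral_Union_disjoint) (auto simp: sum_distrib_left)
  also have "\<dots> \<le> C0 * (\<integral>\<^sup>+x. g x \<partial>M)"
    by (intro mult_left_mono nn_integral_mono) (auto simp: indicator_def)
  finally show ?thesis .
qed

text \<open>Two rates are balanced: a generation shrinks the mass of \<open>\<sigma>\<close> by 1 -
  \<open>\<theta>\<close>, while the potential pays \<open>\<kappa>\<close>. With
  \<open>\<eta>\<close> = 1 - \<open>\<theta>\<close> / 2, halfway between 1 -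
  \<open>\<theta>\<close> and 1, the choice of \<open>\<kappa>\<close> means that
  \<open>\<eta>\<close> to the power r equals \<open>\<kappa>\<close> to the power t. So the factors
  1 / \<open>\<eta>\<close> on the mass and \<open>\<kappa>\<close> on the potential cancel in
  Hoelder's inequality, and the mass still decays with the ratio (1 - \<open>\<theta>\<close>) /
  \<open>\<eta>\<close> < 1.\<close>

lemma tree_decay_bound:
  assumes [measurable]: "u \<in> borel_measurable M" "\<sigma> \<in> borel_measurable M"
    and st: "0 < r" "0 < t" "r + t = 1" and \<theta>: "0 < \<theta>" "\<theta> \<le> 1" and \<kappa>_eq: "\<kappa> = (1 - \<theta> / 2) powr (r / t)"
    and Q: "Q \<in> F" and u: "\<And>x. x \<in> Q \<Longrightarrow> u x \<le> ennpowr (\<sigma> x) r * ennpowr (g x) t"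
    and decay: "\<And>P. P \<in> F \<Longrightarrow> P \<subseteq> Q \<Longrightarrow> (\<integral>\<^sup>+x\<in>\<Union>(Ch P). \<sigma> x \<partial>M) \<le> ennreal (1 - \<theta>) * (\<integral>\<^sup>+x\<in>P. \<sigma> x \<partial>M)"
  shows "(\<integral>\<^sup>+x\<in>Q. u x \<partial>M) \<le> ennpowr (ennreal (2 / \<theta>) * (\<integral>\<^sup>+x\<in>Q. \<sigma> x \<partial>M)) r * ennpowr (V Q) t"
proof -
  have "P \<subseteq> Q \<longrightarrow> (\<integral>\<^sup>+x\<in>P. u x \<partial>M) \<le> ennpowr (ennreal (2 / \<theta>) * (\<integral>\<^sup>+x\<in>P. \<sigma> x \<partial>M)) r * ennpowr (V P) t"
    if "P \<in> F" for P
    using that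
  proof (induction P rule: tree_induct)
    case (1 P)
    show ?case
    proof
      assume PQ: "P \<subseteq> Q"
      define \<eta> where "\<eta> = 1 - \<theta> / 2"
      have \<eta>: "0 < \<eta>" "\<kappa> powr t = \<eta> powr r" using \<theta> st by (auto simp: \<eta>_def \<kappa>_eq powr_powr)
      let ?U = "\<Union>(Ch P)" and ?S = "\<lambda>P. \<integral>\<^sup>+x\<in>P. \<sigma> x \<partial>M"
      have [measurable]: "P \<in> sets M" "?U \<in> sets M" "\<And>P'. P' \<in> Ch P \<Longrightarrow> P' \<in> sets M" using 1 Fsets Ch_facts by auto
      have "(\<integral>\<^sup>+x\<in>P. u x \<partial>M) = (\<integral>\<^sup>+x\<in>P - ?U. u x \<partial>M) + (\<Sum>P'\<in>Ch P. \<integral>\<^sup>+x\<in>P'. u x \<partial>M)"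
        using 1 by (intro integral_Ch) auto
      also have "\<dots> \<le> (\<integral>\<^sup>+x\<in>P - ?U. ennpowr (\<sigma> x) r * ennpowr (g x) t \<partial>M) +
         (\<Sum>P'\<in>Ch P. ennpowr (ennreal (2 / \<theta>) * ?S P') r * ennpowr (V P') t)"
        using PQ Ch_facts(6)[of _ P] by (intro add_mono sum_mono 1[rule_format] nn_set_integral_mono u) auto
      also have "\<dots> \<le> ennpowr (?S (P - ?U)) r * ennpowr (\<integral>\<^sup>+x\<in>P - ?U. g x \<partial>M) t +
         (\<Sum>P'\<in>Ch P. ennpowr (ennreal (2 / \<theta> / \<eta>) * ?S P') r * ennpowr (ennreal \<kappa> * V P') t)"
      proof (intro add_mono nn_set_integral_Hoelder st sum_mono)
        fix P'
        have "ennpowr (ennreal (2 / \<theta> / \<eta>) * ?S P') r * ennpowr (ennreal \<kappa> * V P') t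
           = (ennreal ((2 / \<theta> / \<eta>) powr r) * ennreal (\<eta> powr r)) * (ennpowr (?S P') r * ennpowr (V P') t)"
          using st \<theta> \<eta> \<kappa> by (simp add: ennpowr_mult ennpowr_ennreal mult_ac)
        also have "ennreal ((2 / \<theta> / \<eta>) powr r) * ennreal (\<eta> powr r) = ennreal ((2 / \<theta>) powr r)"
          using \<theta> \<eta> by (simp add: powr_mult[symmetric] flip: ennreal_mult)
        also have "\<dots> * (ennpowr (?S P') r * ennpowr (V P') t) = ennpowr (ennreal (2 / \<theta>) * ?S P') r * ennpowr (V P') t"
          using st \<theta> by (simp add: ennpowr_mult ennpowr_ennreal mult_ac)
        finally show "ennpowr (ennreal (2 / \<theta>) * ?S P') r * ennpowr (V P') t
           \<le> ennpowr (ennreal (2 / \<theta> / \<eta>) * ?S P') r * ennpowr (ennreal \<kappa> * V P') t" by simp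
      qed auto
      also have "\<dots> \<le> ennpowr (?S (P - ?U)) r * ennpowr (\<integral>\<^sup>+x\<in>P - ?U. g x \<partial>M) t +
          ennpowr (\<Sum>P'\<in>Ch P. ennreal (2 / \<theta> / \<eta>) * ?S P') r * ennpowr (\<Sum>P'\<in>Ch P. ennreal \<kappa> * V P') t"
        by (intro add_mono sum_Hoelder st Ch_facts) auto
      also have "\<dots> \<le> ennpowr (?S (P - ?U) + (\<Sum>P'\<in>Ch P. ennreal (2 / \<theta> / \<eta>) * ?S P')) r * 
         ennpowr ((\<integral>\<^sup>+x\<in>P - ?U. g x \<partial>M) + (\<Sum>P'\<in>Ch P. ennreal \<kappa> * V P')) t"
        using sum_Hoelder[of "{True, False}" r t "\<lambda>i. if i then ?S (P - ?U) else (\<Sum>P'\<in>Ch P. ennreal (2 / \<theta> / \<eta>) * ?S P')"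
            "\<lambda>i. if i then (\<integral>\<^sup>+x\<in>P - ?U. g x \<partial>M) else (\<Sum>P'\<in>Ch P. ennreal \<kappa> * V P')"] st by simp
      also have "(\<integral>\<^sup>+x\<in>P - ?U. g x \<partial>M) + (\<Sum>P'\<in>Ch P. ennreal \<kappa> * V P') = V P"
        by (subst (2) V) (simp add: sum_distrib_left)
      also have "?S (P - ?U) + (\<Sum>P'\<in>Ch P. ennreal (2 / \<theta> / \<eta>) * ?S P') \<le> ennreal (2 / \<theta>) * ?S P"
      proof -
        have "(\<Sum>P'\<in>Ch P. ennreal (2 / \<theta> / \<eta>) * ?S P') = ennreal (2 / \<theta> / \<eta>) * ?S ?U"
          using Ch_facts(1-5)[of P] by (subst nn_set_integral_Union_disjoint) (auto simp: sum_distrib_left)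
        also have "\<dots> \<le> ennreal (2 / \<theta> / \<eta>) * (ennreal (1 - \<theta>) * ?S P)"
          using 1 PQ by (intro mult_left_mono decay) auto
        finally have "?S (P - ?U) + (\<Sum>P'\<in>Ch P. ennreal (2 / \<theta> / \<eta>) * ?S P')
           \<le> 1 * ?S P + ennreal (2 / \<theta> / \<eta>) * (ennreal (1 - \<theta>) * ?S P)"
          by (intro add_mono) (auto intro!: nn_set_integral_mono)
        also have "\<dots> = ennreal (1 + 2 / \<theta> / \<eta> * (1 - \<theta>)) * ?S P"
        proof -
          have "ennreal (1 + c * d) = 1 + ennreal c * ennreal d" if "0 \<le> c" "0 \<le> d" for c d
            using that by (simp add: ennreal_mult)
          from this[of "2 / \<theta> / \<eta>" "1 - \<theta>"]
          have "ennreal (1 + 2 / \<theta> / \<eta> * (1 - \<theta>)) = 1 + ennreal (2 / \<theta> / \<eta>) * ennreal (1 - \<theta>)"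
            using \<theta> \<eta> by simp
          then show ?thesis by (simp only: distrib_right mult.assoc)
        qed
        also have "\<dots> \<le> ennreal (2 / \<theta>) * ?S P"
        proof (intro mult_right_mono ennreal_leI)
          \<comment> \<open>The induction closes for a constant c with 1 + c (1 -
            \<open>\<theta>\<close>) / \<open>\<eta>\<close> <= c. For c = 2 /
            \<open>\<theta>\<close> this is the present inequality after clearing denominators; its
            two sides differ by half the square of \<open>\<theta>\<close>.\<close>
          have "\<theta> * \<eta> + 2 * (1 - \<theta>) \<le> 2 * \<eta>" by (simp add: \<eta>_def algebra_simps)
          then have "(\<theta> * \<eta> + 2 * (1 - \<theta>)) / (\<theta> * \<eta>) \<le> 2 * \<eta> / (\<theta> * \<eta>)"
            using \<theta> \<eta> by (intro divide_right_mono) auto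
          then show "1 + 2 / \<theta> / \<eta> * (1 - \<theta>) \<le> 2 / \<theta>"
            using \<theta> \<eta> by (simp add: add_divide_distrib)
        qed simp
        finally show ?thesis .
      qed
      finally show "(\<integral>\<^sup>+x\<in>P. u x \<partial>M) \<le> ennpowr (ennreal (2 / \<theta>) * ?S P) r * ennpowr (V P) t"
        using st by (simp add: ennpowr_mono mult_right_mono)
    qed
  qed
  then show ?thesis using Q by simp
qed

end

section \<open>Maximal operators of weighted laminar families\<close>

definition average :: "'a measure \<Rightarrow> 'a set \<Rightarrow> ('a \<Rightarrow> ennreal) \<Rightarrow> ennreal" where
  "average M Q u = (\<integral>\<^sup>+x\<in>Q. u x \<partial>M) / emeasure M Q"

lemma average_times_emeasure:
  assumes "emeasure M Q = ennreal m" "0 < m"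
  shows "average M Q u * ennreal m = (\<integral>\<^sup>+x\<in>Q. u x \<partial>M)"
  unfolding average_def using assms
  by (intro ennreal_divide_times[THEN trans]) (auto simp: ennreal_mult_divide_eq mult.commute)

lemma ennpowr_ennreal_mult:
  "0 \<le> a \<Longrightarrow> 0 \<le> b \<Longrightarrow> ennpowr (ennreal (a * b)) s = ennreal (a powr s) * ennreal (b powr s)"
  by (simp add: ennpowr_ennreal powr_mult flip: ennreal_mult)

lemma ennpowr_times_split:
  assumes "0 < m" "0 < s"
  shows "ennpowr (x * ennreal m) s = ennreal (m powr (s - 1)) * (ennpowr x s * ennreal m)"
proof -
  have "m powr s = m powr (s - 1) * m" using assms by (simp add: powr_diff)
  then have "ennreal (m powr s) = ennreal (m powr (s - 1)) * ennreal m"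
    using assms by (simp add: ennreal_mult)
  then show ?thesis using assms by (simp add: ennpowr_mult ennpowr_ennreal mult_ac)
qed

text \<open>For r < 1 this is the tangent of a concave power at 1, taken from Young's inequality;
  for r >= 1 the power lies below 1 - x. It makes 1 - \<open>\<kappa>\<close> at least linear in the
  decay rate.\<close>

lemma one_minus_powr_ge:
  fixes x r :: real
  assumes "0 \<le> x" "x \<le> 1" "0 < r"
  shows "min 1 r * x \<le> 1 - (1 - x) powr r"
proof (cases "r < 1")
  case True
  have "(1 - x) powr r * 1 powr (1 - r) \<le> r * (1 - x) + (1 - r) * 1" if "x < 1"
    using Youngs_inequality_0[of r "1 - r" "1 - x" 1] assms True that by auto
  then show ?thesis using assms True by (cases "x = 1") (auto simp: algebra_simps)
next
  case False
  have "(1 - x) powr r \<le> (1 - x) powr 1"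
    using assms False by (intro powr_mono') auto
  then show ?thesis using False assms by auto
qed

text \<open>\<open>\<rho> P Q\<close> is the price of replacing the weight of Q by that of P. The
  decay is assumed of a majorant \<open>\<sigma>\<close> and not of the power of w itself, since in
  the application the majorant is a sum of integrals attached to single vectors, for which decay can
  be proved.\<close>

locale weighted_family =
  fixes M :: "'a measure" and F :: "'a set set" and w \<sigma> :: "'a set \<Rightarrow> 'a \<Rightarrow> ennreal"
    and \<rho> :: "'a set \<Rightarrow> 'a set \<Rightarrow> ennreal" and K p A \<theta> :: real
  assumes p: "1 < p" and A: "0 < A" and K: "1 \<le> K" and \<theta>: "0 < \<theta>" "\<theta> \<le> 1"
    and finF: "finite F" and Fsets: "F \<subseteq> sets M" and lam: "laminar F"
    and pos: "Q \<in> F \<Longrightarrow> 0 < emeasure M Q" "Q \<in> F \<Longrightarrow> emeasure M Q < top"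
    and w_meas [measurable]: "w Q \<in> borel_measurable M"
    and \<sigma>_meas [measurable]: "\<sigma> Q \<in> borel_measurable M"
    and w_compare: "P \<in> F \<Longrightarrow> Q \<in> F \<Longrightarrow> P \<subset> Q \<Longrightarrow> w P x \<le> \<rho> P Q * w Q x"
    and \<rho>_large: "Q \<in> F \<Longrightarrow> G \<subseteq> {P \<in> F. P \<subset> Q \<and> \<not> \<rho> P Q \<le> ennreal K} \<Longrightarrow> disjoint G \<Longrightarrow>
       4 * (\<Sum>P\<in>G. emeasure M P) \<le> emeasure M Q"
    and \<sigma>_decay: "P \<in> F \<Longrightarrow> Q \<in> F \<Longrightarrow> P \<subseteq> Q \<Longrightarrow> E \<in> sets M \<Longrightarrow> E \<subseteq> P \<Longrightarrow>
       2 * emeasure M E \<le> emeasure M P \<Longrightarrow> (\<integral>\<^sup>+x\<in>E. \<sigma> Q x \<partial>M) \<le> ennreal (1 - \<theta>) * (\<integral>\<^sup>+x\<in>P. \<sigma> Q x \<partial>M)"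
    and \<sigma>_total: "Q \<in> F \<Longrightarrow> (\<integral>\<^sup>+x\<in>Q. \<sigma> Q x \<partial>M) \<le> ennreal A * emeasure M Q"
    and w_le_\<sigma>: "Q \<in> F \<Longrightarrow> ennpowr (w Q x) (p / (p - 1)) \<le> \<sigma> Q x"
begin

lemma average_times: "Q \<in> F \<Longrightarrow> average M Q u * emeasure M Q = (\<integral>\<^sup>+x\<in>Q. u x \<partial>M)"
  using pos[of Q] average_times_emeasure[of M Q _ u] by (cases "emeasure M Q") auto

lemma average_mono:
  "(\<And>x. x \<in> Q \<Longrightarrow> u x \<le> v x) \<Longrightarrow> average M Q u \<le> average M Q v"
  unfolding average_def by (intro divide_right_mono_ennreal nn_set_integral_mono) auto

lemma average_cmult:
  "Q \<in> F \<Longrightarrow> u \<in> borel_measurable M \<Longrightarrow> average M Q (\<lambda>x. c * u x) = c * average M Q u"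
  using Fsets unfolding average_def
  by (simp add: nn_integral_cmult mult.assoc ennreal_times_divide borel_measurable_times_ennreal subset_eq)

text \<open>Each of the two tests selects disjoint cubes filling at most a quarter of Q, the first
  by \<open>\<rho>_large\<close>, the second by Chebyshev with the constant 4. Together they stay
  within the half that \<open>\<sigma>_decay\<close> tolerates.\<close>

definition stop :: "('a set \<Rightarrow> 'a \<Rightarrow> ennreal) \<Rightarrow> 'a set \<Rightarrow> 'a set \<Rightarrow> bool" where
  "stop u P Q \<longleftrightarrow> \<not> \<rho> P Q \<le> ennreal K \<or> \<not> average M P (u Q) \<le> 4 * average M Q (u Q)"

text \<open>Chebyshev's inequality for disjoint cubes. An average equal to 0 or top over Q leaves no
  candidate for G, so the average can be cancelled at the end.\<close>

lemma average_large:
  assumes [measurable]: "v \<in> borel_measurable M" and Q: "Q \<in> F"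
    and G: "G \<subseteq> {P\<in>F. P \<subset> Q \<and> \<not> average M P v \<le> 4 * average M Q v}" "disjoint G"
  shows "4 * (\<Sum>P\<in>G. emeasure M P) \<le> emeasure M Q"
proof (cases "G = {}")
  case False
  have fG: "finite G" "G \<subseteq> sets M" "\<And>P. P \<in> G \<Longrightarrow> P \<in> F" "\<And>P. P \<in> G \<Longrightarrow> P \<subset> Q" using G finF Fsets by (auto intro: finite_subset)
  obtain P0 where P0: "P0 \<in> G" using False by auto
  have top: "average M Q v \<noteq> top"
  proof
    assume "average M Q v = top"
    then have "4 * average M Q v = top" by (simp add: ennreal_mult_top)
    then show False using G P0 by auto
  qed
  have "average M Q v \<noteq> 0"
  proof
    assume *: "average M Q v = 0"
    have "average M P0 v * emeasure M P0 = (\<integral>\<^sup>+x\<in>P0. v x \<partial>M)" using P0 fG by (intro average_times) auto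
    also have "\<dots> \<le> (\<integral>\<^sup>+x\<in>Q. v x \<partial>M)" using P0 fG(4) by (intro nn_set_integral_mono) auto
    also have "\<dots> = 0" using average_times[OF Q, of v] * by simp
    finally have "average M P0 v = 0" using pos(1)[OF fG(3)[OF P0]] by auto
    then show False using G P0 by auto
  qed
  have "average M Q v * (4 * (\<Sum>P\<in>G. emeasure M P)) = (\<Sum>P\<in>G. 4 * average M Q v * emeasure M P)"
    by (simp add: sum_distrib_left sum_distrib_right mult_ac)
  also have "\<dots> \<le> (\<Sum>P\<in>G. average M P v * emeasure M P)"
    using G by (intro sum_mono mult_right_mono) auto
  also have "\<dots> = (\<Sum>P\<in>G. \<integral>\<^sup>+x\<in>P. v x \<partial>M)"
    using fG by (intro sum.cong average_times) auto
  also have "\<dots> = (\<integral>\<^sup>+x\<in>\<Union>G. v x \<partial>M)"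
    using fG G by (subst nn_set_integral_Union_disjoint) auto
  also have "\<dots> \<le> (\<integral>\<^sup>+x\<in>Q. v x \<partial>M)" using fG(4) by (intro nn_set_integral_mono) auto
  also have "\<dots> = average M Q v * emeasure M Q" using Q by (simp add: average_times)
  finally show ?thesis
    using top \<open>average M Q v \<noteq> 0\<close> by (subst (asm) ennreal_mult_le_mult_iff) (auto simp: less_top)
qed simp

lemma stopping_children_small:
  assumes [measurable]: "\<And>Q. u Q \<in> borel_measurable M" and Q: "Q \<in> F"
  shows "2 * emeasure M (\<Union>(stopping_children F (stop u) Q)) \<le> emeasure M Q"
proof -
  let ?C = "stopping_children F (stop u) Q"
  let ?C1 = "{P\<in>?C. \<not> \<rho> P Q \<le> ennreal K}" and ?C2 = "{P\<in>?C. \<rho> P Q \<le> ennreal K}"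
  have C: "finite ?C" "disjoint ?C" "?C \<subseteq> sets M"
    using finF lam Fsets by (auto intro: finite_stopping_children disjoint_stopping_children dest: stopping_childrenD)
  have "?C1 \<subseteq> {P \<in> F. P \<subset> Q \<and> \<not> \<rho> P Q \<le> ennreal K}"
    by (auto dest: stopping_childrenD)
  moreover have "disjoint ?C1" "disjoint ?C2" using C(2) by (auto simp: disjoint_def)
  ultimately have 1: "4 * (\<Sum>P\<in>?C1. emeasure M P) \<le> emeasure M Q" using Q \<rho>_large by blast
  have "?C2 \<subseteq> {P\<in>F. P \<subset> Q \<and> \<not> average M P (u Q) \<le> 4 * average M Q (u Q)}"
    using stopping_childrenD[of _ F "stop u" Q] by (auto simp: stop_def)
  then have 2: "4 * (\<Sum>P\<in>?C2. emeasure M P) \<le> emeasure M Q"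
    using Q \<open>disjoint ?C2\<close> by (intro average_large[of "u Q"]) auto
  have "emeasure M (\<Union>?C) = (\<Sum>P\<in>?C. emeasure M P)"
    using C sum_emeasure[of "\<lambda>x. x" ?C M]
    by (auto simp: disjoint_family_on_def disjoint_def)
  also have "\<dots> = (\<Sum>P\<in>?C1. emeasure M P) + (\<Sum>P\<in>?C2. emeasure M P)"
    using C by (subst sum.union_disjoint[symmetric]) (auto intro!: sum.cong)
  finally have "2 * (2 * emeasure M (\<Union>?C)) = 4 * (\<Sum>P\<in>?C1. emeasure M P) + 4 * (\<Sum>P\<in>?C2. emeasure M P)"
    by (simp add: distrib_left flip: mult.assoc)
  also have "\<dots> \<le> 2 * emeasure M Q"
    using add_mono[OF 1 2] by (simp add: mult_2)
  finally have "2 * (2 * emeasure M (\<Union>?C)) \<le> 2 * emeasure M Q" .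
  then show ?thesis by (subst (asm) ennreal_mult_le_mult_iff) auto
qed

lemma stopping_tree_exists:
  assumes "g \<in> borel_measurable M" "0 < \<kappa>" "\<kappa> < 1"
  obtains V where "stopping_tree M F s g \<kappa> V"
proof -
  have "\<exists>V. \<forall>Q. V Q = (\<integral>\<^sup>+x\<in>Q - \<Union>(stopping_children F s Q). g x \<partial>M)
                    + ennreal \<kappa> * (\<Sum>P\<in>stopping_children F s Q. V P)"
    by (rule tree_potential_exists[OF finF]) (auto dest: stopping_childrenD)
  then obtain V where V: "\<forall>Q. V Q = (\<integral>\<^sup>+x\<in>Q - \<Union>(stopping_children F s Q). g x \<partial>M)
                    + ennreal \<kappa> * (\<Sum>P\<in>stopping_children F s Q. V P)" ..
  then have "stopping_tree M F s g \<kappa> V"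
    by (intro stopping_tree.intro finF Fsets lam assms) (rule V[rule_format])
  then show ?thesis by (rule that)
qed

section \<open>The two maximal operators and their stopping bounds\<close>

definition maximal :: "('a \<Rightarrow> ennreal) \<Rightarrow> 'a \<Rightarrow> ennreal" where
  "maximal h x = (SUP Q\<in>F. indicator Q x * average M Q (\<lambda>y. w Q y * h y))"

text \<open>Transposing the single operator h -> indicator Q * average of \<open>w Q * h\<close>
  moves the weight outside the average; this is the supremum of the transposes.\<close>

definition maximal_dual :: "('a \<Rightarrow> ennreal) \<Rightarrow> 'a \<Rightarrow> ennreal" where
  "maximal_dual v x = (SUP Q\<in>F. indicator Q x * (w Q x * average M Q v))"

lemma maximal_meas [measurable]: "maximal h \<in> borel_measurable M"
  unfolding maximal_def using finF Fsets
  by (intro borel_measurable_SUP countable_finite borel_measurable_times borel_measurable_indicator) auto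

lemma maximal_dual_meas [measurable]: "maximal_dual h \<in> borel_measurable M"
  unfolding maximal_dual_def using finF Fsets
  by (intro borel_measurable_SUP countable_finite borel_measurable_times borel_measurable_indicator) auto

text \<open>Common source of both maximal estimates: Hoelder splits \<open>v Q\<close> between a
  decaying weight \<open>\<tau> Q\<close> and the density g. The decay lemma contributes
  \<open>(2 / \<eta> * a) powr (q - 1)\<close>, and summing the potential costs 1 / (1 -
  \<open>\<kappa>\<close>), at most 2 / (\<open>\<eta>\<close> min 1 (q - 1)); this explains the
  constant.\<close>

lemma stopping_bound:
  assumes [measurable]: "\<And>Q. u Q \<in> borel_measurable M" "\<And>Q. v Q \<in> borel_measurable M"
    "\<And>Q. \<tau> Q \<in> borel_measurable M" "\<And>Q. B Q \<in> borel_measurable M" "g \<in> borel_measurable M"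
    and q: "1 < q" and \<eta>: "0 < \<eta>" "\<eta> \<le> 1" and C: "1 \<le> C" and a: "0 < a" and b: "0 < b"
    and stop: "\<And>P Q x. P \<in> F \<Longrightarrow> Q \<in> F \<Longrightarrow> P \<subset> Q \<Longrightarrow> \<not> stop u P Q \<Longrightarrow> x \<in> P \<Longrightarrow> B P x \<le> ennreal C * B Q x"
    and v: "\<And>Q x. Q \<in> F \<Longrightarrow> x \<in> Q \<Longrightarrow> v Q x \<le> ennpowr (\<tau> Q x) (1 - 1 / q) * ennpowr (g x) (1 / q)"
    and decay: "\<And>P Q E. P \<in> F \<Longrightarrow> Q \<in> F \<Longrightarrow> P \<subseteq> Q \<Longrightarrow> E \<in> sets M \<Longrightarrow> E \<subseteq> P \<Longrightarrow>
       2 * emeasure M E \<le> emeasure M P \<Longrightarrow> (\<integral>\<^sup>+x\<in>E. \<tau> Q x \<partial>M) \<le> ennreal (1 - \<eta>) * (\<integral>\<^sup>+x\<in>P. \<tau> Q x \<partial>M)"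
    and total: "\<And>Q. Q \<in> F \<Longrightarrow> (\<integral>\<^sup>+x\<in>Q. \<tau> Q x \<partial>M) \<le> ennreal a * emeasure M Q"
    and bound: "\<And>Q. Q \<in> F \<Longrightarrow> (\<integral>\<^sup>+x\<in>Q. B Q x \<partial>M) \<le> ennreal b * (ennpowr (average M Q (v Q)) q * emeasure M Q)"
  shows "(\<integral>\<^sup>+x. (SUP Q\<in>F. indicator Q x * B Q x) \<partial>M)
     \<le> ennreal (C * b * 2 powr q / min 1 (q - 1) * \<eta> powr (- q) * a powr (q - 1)) * (\<integral>\<^sup>+x. g x \<partial>M)"
proof -
  define \<kappa> where "\<kappa> = (1 - \<eta> / 2) powr (q - 1)"
  have \<kappa>: "0 < \<kappa>" "min 1 (q - 1) * (\<eta> / 2) \<le> 1 - \<kappa>" "\<kappa> < 1"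
  proof -
    show "0 < \<kappa>" using \<eta> by (auto simp: \<kappa>_def)
    show 1: "min 1 (q - 1) * (\<eta> / 2) \<le> 1 - \<kappa>" unfolding \<kappa>_def using \<eta> q by (intro one_minus_powr_ge) auto
    have "0 < min 1 (q - 1) * (\<eta> / 2)" using \<eta> q by auto
    then show "\<kappa> < 1" using 1 by linarith
  qed
  obtain V where "stopping_tree M F (stop u) g \<kappa> V"
    using stopping_tree_exists[of g \<kappa> "stop u"] \<kappa> by auto
  then interpret T: stopping_tree M F "stop u" g \<kappa> V .
  define C0 where "C0 = C * b * (2 / \<eta> * a) powr (q - 1)"
  have C0: "0 < C0" using C \<eta> a b by (auto simp: C0_def)
  have "ennreal (1 - \<kappa>) * (\<integral>\<^sup>+x. (SUP Q\<in>F. indicator Q x * B Q x) \<partial>M) \<le> ennreal C0 * (\<integral>\<^sup>+x. g x \<partial>M)"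
  proof (rule T.tree_sup_bound)
    fix Q assume Q: "Q \<in> F"
    define X where "X = average M Q (v Q)"
    obtain m where m: "emeasure M Q = ennreal m" "0 < m"
      using pos[OF Q] by (cases "emeasure M Q") auto
    have "X * ennreal m = (\<integral>\<^sup>+x\<in>Q. v Q x \<partial>M)"
      unfolding X_def by (rule average_times_emeasure[OF m])
    also have "\<dots> \<le> ennpowr (ennreal (2 / \<eta>) * (\<integral>\<^sup>+x\<in>Q. \<tau> Q x \<partial>M)) (1 - 1 / q) * ennpowr (V Q) (1 / q)"
    proof (rule T.tree_decay_bound)
      have "(1 - 1 / q) / (1 / q) = q - 1" using q by (simp add: field_simps)
      then show "\<kappa> = (1 - \<eta> / 2) powr ((1 - 1 / q) / (1 / q))" by (simp add: \<kappa>_def)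
      fix P assume P: "P \<in> F" "P \<subseteq> Q"
      show "(\<integral>\<^sup>+x\<in>\<Union>(T.Ch P). \<tau> Q x \<partial>M) \<le> ennreal (1 - \<eta>) * (\<integral>\<^sup>+x\<in>P. \<tau> Q x \<partial>M)"
        using P Q T.Ch_facts(4,5)[of P] by (intro decay stopping_children_small) auto
    qed (use q \<eta> Q v in auto)
    also have "\<dots> \<le> ennpowr (ennreal (2 / \<eta>) * (ennreal a * ennreal m)) (1 - 1 / q) * ennpowr (V Q) (1 / q)"
      using total[OF Q] m q by (intro mult_right_mono ennpowr_mono mult_left_mono) auto
    finally have "ennpowr (X * ennreal m) q \<le> ennpowr (\<dots>) q" using q by (intro ennpowr_mono) auto
    also have "\<dots> = ennpowr (ennreal (2 / \<eta> * (a * m))) (q - 1) * V Q"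
      using q \<eta> a m by (simp add: ennpowr_mult ennpowr_ennpowr left_diff_distrib flip: ennreal_mult)
    also have "\<dots> = ennreal (m powr (q - 1)) * (ennreal ((2 / \<eta> * a) powr (q - 1)) * V Q)"
      using ennpowr_ennreal_mult[of "2 / \<eta> * a" m "q - 1"] \<eta> a m by (simp add: mult_ac)
    finally have "ennreal (m powr (q - 1)) * (ennpowr X q * ennreal m) \<le> \<dots>"
      using ennpowr_times_split[of m q X] m q by simp
    then have "ennpowr X q * ennreal m \<le> ennreal ((2 / \<eta> * a) powr (q - 1)) * V Q"
      using m by (subst (asm) ennreal_mult_le_mult_iff) auto
    then have le: "ennreal C * (ennreal b * (ennpowr X q * ennreal m)) \<le> ennreal C * (ennreal b * (ennreal ((2 / \<eta> * a) powr (q - 1)) * V Q))"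
      by (intro mult_left_mono) auto
    have "ennreal C * (\<integral>\<^sup>+x\<in>Q. B Q x \<partial>M) \<le> ennreal C * (ennreal b * (ennpowr X q * ennreal m))"
      using bound[OF Q] unfolding X_def m(1) by (rule mult_left_mono) simp
    also note le
    also have "ennreal C * (ennreal b * (ennreal ((2 / \<eta> * a) powr (q - 1)) * V Q)) = ennreal C0 * V Q"
      unfolding C0_def using C b by (simp add: ennreal_mult mult.assoc)
    finally show "ennreal C * (\<integral>\<^sup>+x\<in>Q. B Q x \<partial>M) \<le> ennreal C0 * V Q" .
  qed (use C stop in auto)
  then have "ennreal (1 / (1 - \<kappa>)) * (ennreal (1 - \<kappa>) * (\<integral>\<^sup>+x. (SUP Q\<in>F. indicator Q x * B Q x) \<partial>M)) \<le> ennreal (1 / (1 - \<kappa>)) * (ennreal C0 * (\<integral>\<^sup>+x. g x \<partial>M))"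
    by (intro mult_left_mono) auto
  then have "(\<integral>\<^sup>+x. (SUP Q\<in>F. indicator Q x * B Q x) \<partial>M) \<le> ennreal (1 / (1 - \<kappa>) * C0) * (\<integral>\<^sup>+x. g x \<partial>M)"
    using \<kappa> C0 by (simp add: ennreal_mult[symmetric] flip: mult.assoc)
  also have "\<dots> \<le> ennreal (C * b * 2 powr q / min 1 (q - 1) * \<eta> powr (- q) * a powr (q - 1)) * (\<integral>\<^sup>+x. g x \<partial>M)"
  proof (intro mult_right_mono ennreal_leI)
    have "1 / (1 - \<kappa>) * C0 \<le> 1 / (min 1 (q - 1) * (\<eta> / 2)) * C0"
      using \<kappa> C0 \<eta> q by (intro mult_right_mono divide_left_mono) (auto intro!: mult_pos_pos)
    also have "\<dots> = C * b * 2 powr q / min 1 (q - 1) * \<eta> powr (- q) * a powr (q - 1)"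
      unfolding C0_def using \<eta> a
      by (simp add: powr_mult powr_divide powr_diff powr_minus field_simps del: min_less_iff_conj)
    finally show "1 / (1 - \<kappa>) * C0 \<le> C * b * 2 powr q / min 1 (q - 1) * \<eta> powr (- q) * a powr (q - 1)" .
  qed simp
  finally show ?thesis .
qed

text \<open>A two-weight inequality in which q is independent of p. The number
  \<open>\<beta> Q\<close> carries the mass of \<open>\<phi>\<close> on Q inside the average, where
  Hoelder trades it for \<open>\<sigma> Q\<close> and \<open>\<Phi>\<close>. Taking
  \<open>\<beta>\<close>, \<open>\<phi>\<close> and \<open>\<Phi>\<close> equal to 1 and q = p gives
  the scalar bound; the general form serves the case q < p.\<close>

lemma maximal_weighted_bound:
  assumes [measurable]: "h \<in> borel_measurable M" "\<phi> \<in> borel_measurable M" "\<Phi> \<in> borel_measurable M"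
    and q: "1 < q"
    and \<phi>: "\<And>Q. Q \<in> F \<Longrightarrow> (\<integral>\<^sup>+x\<in>Q. \<phi> x \<partial>M) \<le> ennpowr (\<beta> Q) q * emeasure M Q"
    and \<beta>: "\<And>Q x. Q \<in> F \<Longrightarrow> x \<in> Q \<Longrightarrow> \<beta> Q * w Q x \<le> ennpowr (\<sigma> Q x) (1 - 1 / q) * ennpowr (\<Phi> x) (1 / q)"
  shows "(\<integral>\<^sup>+x. ennpowr (maximal h x) q * \<phi> x \<partial>M)
     \<le> ennreal ((4 * K) powr q * 2 powr q / min 1 (q - 1) * \<theta> powr (- q) * A powr (q - 1))
        * (\<integral>\<^sup>+x. ennpowr (h x) q * \<Phi> x \<partial>M)"
proof -
  define u where "u Q x = w Q x * h x" for Q x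
  have u[measurable]: "u Q \<in> borel_measurable M" for Q unfolding u_def by measurable
  define B where "B Q x = ennpowr (average M Q (u Q)) q * \<phi> x" for Q x
  have "(\<integral>\<^sup>+x. (SUP Q\<in>F. indicator Q x * B Q x) \<partial>M)
     \<le> ennreal ((4 * K) powr q * 1 * 2 powr q / min 1 (q - 1) * \<theta> powr (- q) * A powr (q - 1))
        * (\<integral>\<^sup>+x. ennpowr (h x) q * \<Phi> x \<partial>M)"
  proof (rule stopping_bound[where u = u and v = "\<lambda>Q x. \<beta> Q * u Q x" and \<tau> = \<sigma>])
    fix P Q x assume PQ: "P \<in> F" "Q \<in> F" "P \<subset> Q" "\<not> stop u P Q" "x \<in> P"
    \<comment> \<open>Between stopping times the change of weight costs K and the change of average
      costs 4.\<close>
    have "average M P (u P) \<le> average M P (\<lambda>x. ennreal K * u Q x)"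
    proof (rule average_mono)
      fix x
      have "w P x \<le> \<rho> P Q * w Q x" using PQ by (intro w_compare) auto
      also have "\<dots> \<le> ennreal K * w Q x" using PQ by (intro mult_right_mono) (auto simp: stop_def)
      finally show "u P x \<le> ennreal K * u Q x" unfolding u_def by (simp add: mult_right_mono flip: mult.assoc)
    qed
    also have "\<dots> = ennreal K * average M P (u Q)" using PQ by (intro average_cmult) auto
    also have "\<dots> \<le> ennreal K * (4 * average M Q (u Q))"
      using PQ by (intro mult_left_mono) (auto simp: stop_def)
    also have "\<dots> = ennreal (4 * K) * average M Q (u Q)"
      using K by (simp add: ennreal_mult' mult_ac)
    finally have "ennpowr (average M P (u P)) q \<le> ennpowr (ennreal (4 * K) * average M Q (u Q)) q"
      using q by (intro ennpowr_mono) auto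
    also have "\<dots> = ennreal ((4 * K) powr q) * ennpowr (average M Q (u Q)) q"
      using q K by (simp add: ennpowr_mult ennpowr_ennreal)
    finally show "B P x \<le> ennreal ((4 * K) powr q) * B Q x"
      unfolding B_def by (simp add: mult_right_mono flip: mult.assoc)
  next
    fix Q x assume Q: "Q \<in> F" and "x \<in> Q"
    have "\<beta> Q * u Q x = (\<beta> Q * w Q x) * ennpowr (ennpowr (h x) q) (1 / q)"
      unfolding u_def using q by (simp add: ennpowr_ennpowr mult.assoc)
    also have "\<dots> \<le> (ennpowr (\<sigma> Q x) (1 - 1 / q) * ennpowr (\<Phi> x) (1 / q)) * ennpowr (ennpowr (h x) q) (1 / q)"
      using \<open>x \<in> Q\<close> Q by (intro mult_right_mono \<beta>) auto
    also have "\<dots> = ennpowr (\<sigma> Q x) (1 - 1 / q) * ennpowr (ennpowr (h x) q * \<Phi> x) (1 / q)"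
      using q by (simp add: ennpowr_mult mult_ac)
    finally show "\<beta> Q * u Q x \<le> ennpowr (\<sigma> Q x) (1 - 1 / q) * ennpowr (ennpowr (h x) q * \<Phi> x) (1 / q)" .
  next
    fix Q assume Q: "Q \<in> F"
    have "(\<integral>\<^sup>+x\<in>Q. B Q x \<partial>M) = ennpowr (average M Q (u Q)) q * (\<integral>\<^sup>+x\<in>Q. \<phi> x \<partial>M)"
      unfolding B_def using Q Fsets by (simp add: nn_integral_cmult mult.assoc subset_eq)
    also have "\<dots> \<le> ennpowr (average M Q (u Q)) q * (ennpowr (\<beta> Q) q * emeasure M Q)"
      using \<phi>[OF Q] by (intro mult_left_mono) auto
    also have "\<dots> = ennpowr (average M Q (\<lambda>x. \<beta> Q * u Q x)) q * emeasure M Q"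
      using q Q by (simp add: average_cmult ennpowr_mult mult_ac)
    finally show "(\<integral>\<^sup>+x\<in>Q. B Q x \<partial>M) \<le> ennreal 1 * (ennpowr (average M Q (\<lambda>x. \<beta> Q * u Q x)) q * emeasure M Q)"
      by simp
  qed (use \<sigma>_decay \<sigma>_total \<theta> A K q in \<open>auto simp: B_def intro!: ge_one_powr_ge_zero\<close>)
  also have "(\<lambda>x. SUP Q\<in>F. indicator Q x * B Q x) = (\<lambda>x. ennpowr (maximal h x) q * \<phi> x)"
  proof
    fix x
    have "ennpowr (maximal h x) q = (SUP Q\<in>F. indicator Q x * ennpowr (average M Q (u Q)) q)"
      unfolding maximal_def u_def using q by (subst ennpowr_SUP) (auto intro!: SUP_cong simp: indicator_def)
    then show "(SUP Q\<in>F. indicator Q x * B Q x) = ennpowr (maximal h x) q * \<phi> x"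
      by (simp add: SUP_mult_right_ennreal B_def mult.assoc)
  qed
  finally show ?thesis by simp
qed

text \<open>The averaged function is v without a weight, so the tree decays in the measure M itself
  with ratio 1/2 and \<open>\<theta>\<close> does not enter. A single power of A remains, from the
  integral of \<open>w Q\<close> to the power p / (p - 1).\<close>

lemma maximal_dual_bound:
  defines "p' \<equiv> p / (p - 1)"
  assumes [measurable]: "v \<in> borel_measurable M"
  shows "(\<integral>\<^sup>+x. ennpowr (maximal_dual v x) p' \<partial>M)
     \<le> ennreal ((4 * K) powr p' * 4 powr p' / min 1 (p' - 1) * A) * (\<integral>\<^sup>+x. ennpowr (v x) p' \<partial>M)"
proof -
  have p': "1 < p'" using p by (simp add: p'_def)
  define u where "u = (\<lambda>Q :: 'a set. v)"
  define B where "B Q x = ennpowr (w Q x * average M Q v) p'" for Q x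
  have "(\<integral>\<^sup>+x. (SUP Q\<in>F. indicator Q x * B Q x) \<partial>M)
     \<le> ennreal ((4 * K) powr p' * A * 2 powr p' / min 1 (p' - 1) * (1/2) powr (- p') * 1 powr (p' - 1))
        * (\<integral>\<^sup>+x. ennpowr (v x) p' \<partial>M)"
  proof (rule stopping_bound[where u = u and v = u and \<tau> = "\<lambda>_ _. 1"])
    fix P Q x assume PQ: "P \<in> F" "Q \<in> F" "P \<subset> Q" "\<not> stop u P Q" "x \<in> P"
    have "w P x \<le> \<rho> P Q * w Q x" using PQ by (intro w_compare) auto
    also have "\<dots> \<le> ennreal K * w Q x" using PQ by (intro mult_right_mono) (auto simp: stop_def)
    finally have "w P x * average M P v \<le> (ennreal K * w Q x) * (4 * average M Q v)"
      using PQ by (intro mult_mono) (auto simp: stop_def u_def)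
    also have "\<dots> = ennreal (4 * K) * (w Q x * average M Q v)"
      using K by (simp add: ennreal_mult' mult_ac)
    finally have "B P x \<le> ennpowr (ennreal (4 * K) * (w Q x * average M Q v)) p'"
      unfolding B_def using p' by (intro ennpowr_mono) auto
    then show "B P x \<le> ennreal ((4 * K) powr p') * B Q x"
      using p' K by (simp add: ennpowr_mult[of p' "ennreal _"] ennpowr_ennreal B_def)
  next
    fix P E assume P: "P \<in> F" and E: "E \<in> sets M" "2 * emeasure M E \<le> emeasure M P"
    have half: "ennreal (1/2) * ennreal 2 = 1" by (subst ennreal_mult[symmetric]) auto
    have "ennreal (1/2) * (2 * emeasure M E) = (ennreal (1/2) * ennreal 2) * emeasure M E"
      by (simp only: mult.assoc ennreal_numeral)
    also have "\<dots> = emeasure M E" by (simp only: half mult_1_left)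
    finally have "emeasure M E \<le> ennreal (1/2) * emeasure M P"
      using mult_left_mono[OF E(2), of "ennreal (1/2)"] by simp
    then show "(\<integral>\<^sup>+x\<in>E. 1 \<partial>M) \<le> ennreal (1 - 1/2) * (\<integral>\<^sup>+x\<in>P. 1 \<partial>M)"
      using P E Fsets by (simp add: subset_eq)
  next
    fix Q assume Q: "Q \<in> F"
    have "(\<integral>\<^sup>+x\<in>Q. B Q x \<partial>M) = (\<integral>\<^sup>+x\<in>Q. ennpowr (w Q x) p' \<partial>M) * ennpowr (average M Q v) p'"
      unfolding B_def using Q Fsets p'
      by (subst nn_integral_multc[symmetric]) (auto intro!: nn_integral_cong simp: ennpowr_mult mult_ac subset_eq)
    also have "\<dots> \<le> (ennreal A * emeasure M Q) * ennpowr (average M Q v) p'"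
      using order_trans[OF nn_set_integral_mono \<sigma>_total[OF Q]] w_le_\<sigma>[OF Q]
      by (intro mult_right_mono) (auto simp: p'_def)
    finally show "(\<integral>\<^sup>+x\<in>Q. B Q x \<partial>M) \<le> ennreal A * (ennpowr (average M Q (u Q)) p' * emeasure M Q)"
      by (simp add: u_def mult_ac)
  next
    show "1 \<le> (4 * K) powr p'" using K p' by (intro ge_one_powr_ge_zero) auto
  qed (use p' A Fsets in \<open>auto simp: u_def B_def ennpowr_ennpowr\<close>)
  also have "(4 * K) powr p' * A * 2 powr p' / min 1 (p' - 1) * (1/2) powr (- p') * 1 powr (p' - 1)
     = (4 * K) powr p' * 4 powr p' / min 1 (p' - 1) * A"
  proof -
    have "(2::real) powr p' * (1/2) powr (- p') = 4 powr p'"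
      by (simp add: powr_divide powr_minus_divide flip: powr_mult)
    then show ?thesis by (simp add: field_simps)
  qed
  also have "(\<lambda>x. SUP Q\<in>F. indicator Q x * B Q x) = (\<lambda>x. ennpowr (maximal_dual v x) p')"
    unfolding maximal_dual_def B_def using p' by (subst ennpowr_SUP) (auto intro!: SUP_cong simp: indicator_def)
  finally show ?thesis .
qed

end

section \<open>Vector-valued bounds\<close>

lemma ennpowr_add_finite:
  assumes "x \<noteq> 0" "x \<noteq> top"
  shows "ennpowr x (s + t) = ennpowr x s * ennpowr x t"
  using assms by (cases x) (auto simp: ennpowr_ennreal powr_add ennreal_mult)

text \<open>The absorption step of the case q < p: a finite quantity bounded by a smaller power of
  itself.\<close>

lemma ennpowr_le_cancel:
  assumes "x \<noteq> top" "0 < a" "a < 1" and le: "x \<le> c * ennpowr x (1 - a)"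
  shows "ennpowr x a \<le> c"
proof (cases "x = 0")
  case False
  have "ennpowr x a * ennpowr x (1 - a) = x"
    using ennpowr_add[of a "1 - a" x] assms by simp
  then have "ennpowr x (1 - a) * ennpowr x a \<le> ennpowr x (1 - a) * c"
    using le by (simp add: mult.commute)
  then show ?thesis
    using False assms(1) by (subst (asm) ennreal_mult_le_mult_iff) (auto simp: ennpowr_eq_0_iff ennpowr_eq_top_iff)
qed simp

text \<open>The last factor is the part of \<open>\<theta> powr (- q)\<close> that is free of A once
  \<open>\<theta>\<close> is expressed through A.\<close>

definition scalar_const :: "real \<Rightarrow> real \<Rightarrow> real \<Rightarrow> real" where
  "scalar_const p q K = (4 * K) powr q * 2 powr q / min 1 (q - 1) * 2 powr (p / (p - 1) * q)"

definition dual_const :: "real \<Rightarrow> real \<Rightarrow> real" where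
  "dual_const p K = (let p' = p / (p - 1) in (4 * K) powr p' * 4 powr p' / min 1 (p' - 1))"

text \<open>For q < p, the exponent 1 - q / p is the share of the dual operator in Hoelder's
  inequality, and p / q inverts the power q / p left by the absorption.\<close>

definition vector_const :: "real \<Rightarrow> real \<Rightarrow> real \<Rightarrow> real" where
  "vector_const p q K = (if p \<le> q then scalar_const p p K
     else (scalar_const p q K * dual_const p K powr (1 - q / p)) powr (p / q))"

lemma scalar_const_pos: "1 < q \<Longrightarrow> 1 \<le> K \<Longrightarrow> 0 < scalar_const p q K"
  by (auto simp: scalar_const_def intro!: mult_pos_pos divide_pos_pos)

lemma dual_const_pos: "1 < p \<Longrightarrow> 1 \<le> K \<Longrightarrow> 0 < dual_const p K"
  by (auto simp: dual_const_def Let_def intro!: mult_pos_pos divide_pos_pos)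

lemma vector_const_pos:
  assumes "1 < p" "1 < q" "1 \<le> K"
  shows "0 < vector_const p q K"
  using scalar_const_pos[of p K p] scalar_const_pos[of q K p] dual_const_pos[of p K] assms
  by (auto simp: vector_const_def)

locale sharp_weighted_family = weighted_family +
  assumes \<theta>_eq: "\<theta> = 2 powr (- (p / (p - 1))) / A"
begin

lemma maximal_weighted_bound':
  assumes "h \<in> borel_measurable M" "\<phi> \<in> borel_measurable M" "\<Phi> \<in> borel_measurable M" "1 < q"
    and "\<And>Q. Q \<in> F \<Longrightarrow> (\<integral>\<^sup>+x\<in>Q. \<phi> x \<partial>M) \<le> ennpowr (\<beta> Q) q * emeasure M Q"
    and "\<And>Q x. Q \<in> F \<Longrightarrow> x \<in> Q \<Longrightarrow> \<beta> Q * w Q x \<le> ennpowr (\<sigma> Q x) (1 - 1 / q) * ennpowr (\<Phi> x) (1 / q)"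
  shows "(\<integral>\<^sup>+x. ennpowr (maximal h x) q * \<phi> x \<partial>M)
     \<le> ennreal (scalar_const p q K * A powr (2 * q - 1)) * (\<integral>\<^sup>+x. ennpowr (h x) q * \<Phi> x \<partial>M)"
proof -
  have "\<theta> powr (- q) = 2 powr (p / (p - 1) * q) * A powr q"
    unfolding \<theta>_eq using A by (simp add: powr_divide powr_powr powr_minus_divide powr_mult)
  then have "\<theta> powr (- q) * A powr (q - 1) = 2 powr (p / (p - 1) * q) * A powr (2 * q - 1)"
    by (simp add: mult.assoc flip: powr_add)
  then have "(4 * K) powr q * 2 powr q / min 1 (q - 1) * \<theta> powr (- q) * A powr (q - 1)
      = scalar_const p q K * A powr (2 * q - 1)"
    by (simp add: scalar_const_def mult.assoc)
  then show ?thesis using maximal_weighted_bound[OF assms] by simp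
qed

lemma w_le_\<sigma>_powr:
  assumes "Q \<in> F"
  shows "w Q x \<le> ennpowr (\<sigma> Q x) (1 - 1 / p)"
proof -
  have "w Q x = ennpowr (ennpowr (w Q x) (p / (p - 1))) (1 - 1 / p)"
    using p by (simp add: ennpowr_ennpowr field_simps)
  also have "\<dots> \<le> ennpowr (\<sigma> Q x) (1 - 1 / p)"
    using assms p by (intro ennpowr_mono w_le_\<sigma>) auto
  finally show ?thesis .
qed

lemma maximal_bound:
  assumes [measurable]: "h \<in> borel_measurable M"
  shows "(\<integral>\<^sup>+x. ennpowr (maximal h x) p \<partial>M)
     \<le> ennreal (scalar_const p p K * A powr (2 * p - 1)) * (\<integral>\<^sup>+x. ennpowr (h x) p \<partial>M)"
  using maximal_weighted_bound'[of h "\<lambda>_. 1" "\<lambda>_. 1" p "\<lambda>_. 1"] p w_le_\<sigma>_powr Fsets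
  by (simp add: subset_eq)

text \<open>Write the weight as the product of its powers r and t and apply Hoelder to each average.
  This pointwise log-convexity takes the place of an interpolation theorem.\<close>

lemma maximal_geometric_mean:
  assumes [measurable]: "g \<in> borel_measurable M" "H \<in> borel_measurable M"
    and r: "0 < r" "0 < t" "r + t = 1" and h: "\<And>x. h x \<le> ennpowr (g x) r * ennpowr (H x) t"
  shows "maximal h x \<le> ennpowr (maximal g x) r * ennpowr (maximal H x) t"
  unfolding maximal_def[of h]
proof (rule SUP_least)
  fix Q assume Q: "Q \<in> F"
  then have [measurable]: "Q \<in> sets M" using Fsets by auto
  let ?G = "\<lambda>g. \<integral>\<^sup>+x\<in>Q. w Q x * g x \<partial>M"
  have "?G h \<le> (\<integral>\<^sup>+x\<in>Q. ennpowr (w Q x * g x) r * ennpowr (w Q x * H x) t \<partial>M)"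
  proof (intro nn_set_integral_mono)
    fix x
    have "w Q x = ennpowr (w Q x) r * ennpowr (w Q x) t"
      using ennpowr_add[OF r(1,2), of "w Q x"] r by simp
    then have "w Q x * h x \<le> (ennpowr (w Q x) r * ennpowr (w Q x) t) * (ennpowr (g x) r * ennpowr (H x) t)"
      using h[of x] by (metis mult_left_mono zero_le)
    then show "w Q x * h x \<le> ennpowr (w Q x * g x) r * ennpowr (w Q x * H x) t"
      using r by (simp add: ennpowr_mult mult_ac)
  qed simp
  also have "\<dots> \<le> ennpowr (?G g) r * ennpowr (?G H) t"
    using r by (intro nn_set_integral_Hoelder) auto
  also have "\<dots> = ennpowr (average M Q (\<lambda>y. w Q y * g y) * emeasure M Q) r
      * ennpowr (average M Q (\<lambda>y. w Q y * H y) * emeasure M Q) t"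
    using Q by (simp add: average_times)
  also have "\<dots> = (ennpowr (average M Q (\<lambda>y. w Q y * g y)) r * ennpowr (average M Q (\<lambda>y. w Q y * H y)) t)
       * (ennpowr (emeasure M Q) r * ennpowr (emeasure M Q) t)"
    using r by (simp add: ennpowr_mult mult_ac)
  also have "ennpowr (emeasure M Q) r * ennpowr (emeasure M Q) t = emeasure M Q"
    using ennpowr_add[OF r(1,2), of "emeasure M Q"] r by simp
  finally have "emeasure M Q * average M Q (\<lambda>y. w Q y * h y) \<le> emeasure M Q *
     (ennpowr (average M Q (\<lambda>y. w Q y * g y)) r * ennpowr (average M Q (\<lambda>y. w Q y * H y)) t)"
    using Q average_times[of Q "\<lambda>y. w Q y * h y"] by (simp add: mult.commute)
  then have *: "average M Q (\<lambda>y. w Q y * h y) \<le> ennpowr (average M Q (\<lambda>y. w Q y * g y)) r * ennpowr (average M Q (\<lambda>y. w Q y * H y)) t"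
    using pos[OF Q] by (subst (asm) ennreal_mult_le_mult_iff) auto
  show "indicator Q x * average M Q (\<lambda>y. w Q y * h y) \<le> ennpowr (maximal g x) r * ennpowr (maximal H x) t"
  proof (cases "x \<in> Q")
    case True
    have "average M Q (\<lambda>y. w Q y * g y) \<le> maximal g x" for g
      unfolding maximal_def using Q True by (intro SUP_upper2[of Q]) auto
    then have "ennpowr (average M Q (\<lambda>y. w Q y * g y)) r * ennpowr (average M Q (\<lambda>y. w Q y * H y)) t
       \<le> ennpowr (maximal g x) r * ennpowr (maximal H x) t"
      using r by (intro mult_mono ennpowr_mono) auto
    then show ?thesis using * True by simp
  qed simp
qed

text \<open>With H the l^q norm of the family, factor \<open>h k\<close> into \<open>g k\<close> to
  the power p / q and H to the power 1 - p / q, where the \<open>g k\<close> have l^p norm at most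
  H. The \<open>g k\<close> fall under the case q = p, the common factor H under the scalar bound,
  and Hoelder recombines them with the same constant.\<close>

lemma vector_maximal_bound_upper:
  fixes h :: "nat \<Rightarrow> 'a \<Rightarrow> ennreal"
  assumes pq: "p < q" and I: "finite I"
    and [measurable]: "\<And>k. h k \<in> borel_measurable M" and fin: "\<And>k x. h k x < top"
  shows "(\<integral>\<^sup>+x. ennpowr (\<Sum>k\<in>I. ennpowr (maximal (h k) x) q) (p / q) \<partial>M)
     \<le> ennreal (scalar_const p p K * A powr (2 * p - 1))
        * (\<integral>\<^sup>+x. ennpowr (\<Sum>k\<in>I. ennpowr (h k x) q) (p / q) \<partial>M)"
proof -
  have q: "1 < q" using p pq by simp
  define D where "D = ennreal (scalar_const p p K * A powr (2 * p - 1))"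
  define H where "H x = ennpowr (\<Sum>k\<in>I. ennpowr (h k x) q) (1 / q)" for x
  have [measurable]: "H \<in> borel_measurable M" unfolding H_def by measurable
  have Hfin: "H x \<noteq> top" for x
    unfolding H_def using fin I by (simp add: ennpowr_eq_top_iff less_top)
  have Hq: "ennpowr (H x) q = (\<Sum>k\<in>I. ennpowr (h k x) q)" for x
    unfolding H_def using q by (simp add: ennpowr_ennpowr)
  have Hp: "ennpowr (H x) p = ennpowr (\<Sum>k\<in>I. ennpowr (h k x) q) (p / q)" for x
    unfolding H_def using q by (simp add: ennpowr_ennpowr)
  have H0: "h k x = 0" if "H x = 0" "k \<in> I" for k x
    using that I unfolding H_def by (auto simp: ennpowr_eq_0_iff)
  \<comment> \<open>Where H x = 0, the negative power is 0 by the convention of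
    \<open>ennpowr\<close>, and every \<open>h k x\<close> with k in I vanishes too. Elsewhere H x
    is finite and positive, so exponents may be added freely.\<close>
  define g where "g k x = ennpowr (h k x) (q / p) * ennpowr (H x) (- (q - p) / p)" for k x
  have g[measurable]: "g k \<in> borel_measurable M" for k unfolding g_def by measurable
  have hg: "h k x \<le> ennpowr (g k x) (p / q) * ennpowr (H x) (1 - p / q)" if "k \<in> I" for k x
  proof (cases "H x = 0")
    case False
    have "ennpowr (g k x) (p / q) * ennpowr (H x) (1 - p / q)
      = h k x * (ennpowr (H x) (- (q - p) / q) * ennpowr (H x) (1 - p / q))"
      unfolding g_def using p q by (simp add: ennpowr_mult ennpowr_ennpowr mult.assoc)
    also have "ennpowr (H x) (- (q - p) / q) * ennpowr (H x) (1 - p / q) = ennpowr (H x) (- (q - p) / q + (1 - p / q))"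
      using False Hfin by (simp add: ennpowr_add_finite)
    also have "- (q - p) / q + (1 - p / q) = 0" using q by (simp add: field_simps)
    also have "ennpowr (H x) 0 = 1" using False Hfin[of x] by (cases "H x") (auto simp: ennpowr_ennreal)
    finally show ?thesis by simp
  qed (use H0 that in auto)
  have gp: "(\<Sum>k\<in>I. ennpowr (g k x) p) \<le> ennpowr (H x) p" for x
  proof (cases "H x = 0")
    case False
    have "(\<Sum>k\<in>I. ennpowr (g k x) p) = (\<Sum>k\<in>I. ennpowr (h k x) q * ennpowr (H x) (- (q - p)))"
      unfolding g_def using p by (intro sum.cong) (auto simp: ennpowr_mult ennpowr_ennpowr)
    also have "\<dots> = ennpowr (H x) (q + (- (q - p)))"
      using False Hfin by (subst ennpowr_add_finite) (auto simp: Hq sum_distrib_right)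
    finally show ?thesis by simp
  qed (use H0 in \<open>auto simp: g_def\<close>)
  define G where "G x = (\<Sum>k\<in>I. ennpowr (maximal (g k) x) p)" for x
  have [measurable]: "G \<in> borel_measurable M" unfolding G_def by measurable
  have pt: "ennpowr (\<Sum>k\<in>I. ennpowr (maximal (h k) x) q) (p / q)
      \<le> ennpowr (G x) (p / q) * ennpowr (ennpowr (maximal H x) p) (1 - p / q)" for x
  proof -
    have "ennpowr (maximal (h k) x) q \<le> ennpowr (maximal (g k) x) p * ennpowr (maximal H x) (q - p)" if "k \<in> I" for k
    proof -
      have "ennpowr (maximal (h k) x) q \<le> ennpowr (ennpowr (maximal (g k) x) (p / q) * ennpowr (maximal H x) (1 - p / q)) q"
        using p pq hg that by (intro ennpowr_mono maximal_geometric_mean) auto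
      also have "\<dots> = ennpowr (maximal (g k) x) p * ennpowr (maximal H x) (q - p)"
        using q by (simp add: ennpowr_mult ennpowr_ennpowr left_diff_distrib)
      finally show ?thesis .
    qed
    then have "(\<Sum>k\<in>I. ennpowr (maximal (h k) x) q) \<le> G x * ennpowr (maximal H x) (q - p)"
      unfolding G_def sum_distrib_right by (intro sum_mono) auto
    then have "ennpowr (\<Sum>k\<in>I. ennpowr (maximal (h k) x) q) (p / q) \<le> ennpowr (G x * ennpowr (maximal H x) (q - p)) (p / q)"
      using p q by (intro ennpowr_mono) auto
    also have "\<dots> = ennpowr (G x) (p / q) * ennpowr (ennpowr (maximal H x) p) (1 - p / q)"
      using p q by (simp add: ennpowr_mult ennpowr_ennpowr field_simps)
    finally show ?thesis .
  qed
  have "(\<integral>\<^sup>+x. G x \<partial>M) \<le> D * (\<integral>\<^sup>+x. ennpowr (H x) p \<partial>M)"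
  proof -
    have "(\<integral>\<^sup>+x. G x \<partial>M) = (\<Sum>k\<in>I. \<integral>\<^sup>+x. ennpowr (maximal (g k) x) p \<partial>M)"
      unfolding G_def by (intro nn_integral_sum) auto
    also have "\<dots> \<le> (\<Sum>k\<in>I. D * \<integral>\<^sup>+x. ennpowr (g k x) p \<partial>M)"
      unfolding D_def by (intro sum_mono maximal_bound) auto
    also have "\<dots> = D * (\<integral>\<^sup>+x. (\<Sum>k\<in>I. ennpowr (g k x) p) \<partial>M)"
      by (subst nn_integral_sum) (auto simp: sum_distrib_left)
    also have "\<dots> \<le> D * (\<integral>\<^sup>+x. ennpowr (H x) p \<partial>M)"
      using gp by (intro mult_left_mono nn_integral_mono) auto
    finally show ?thesis .
  qed
  then have "ennpowr (\<integral>\<^sup>+x. G x \<partial>M) (p / q) * ennpowr (\<integral>\<^sup>+x. ennpowr (maximal H x) p \<partial>M) (1 - p / q)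
    \<le> ennpowr (D * (\<integral>\<^sup>+x. ennpowr (H x) p \<partial>M)) (p / q) * ennpowr (D * (\<integral>\<^sup>+x. ennpowr (H x) p \<partial>M)) (1 - p / q)"
    using p pq unfolding D_def by (intro mult_mono ennpowr_mono maximal_bound) auto
  also have "\<dots> = D * (\<integral>\<^sup>+x. ennpowr (H x) p \<partial>M)"
    using ennpowr_add[of "p / q" "1 - p / q" "D * (\<integral>\<^sup>+x. ennpowr (H x) p \<partial>M)"] p pq by simp
  finally have "ennpowr (\<integral>\<^sup>+x. G x \<partial>M) (p / q) * ennpowr (\<integral>\<^sup>+x. ennpowr (maximal H x) p \<partial>M) (1 - p / q)
     \<le> D * (\<integral>\<^sup>+x. ennpowr (H x) p \<partial>M)" .
  moreover have "(\<integral>\<^sup>+x. ennpowr (\<Sum>k\<in>I. ennpowr (maximal (h k) x) q) (p / q) \<partial>M)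
    \<le> (\<integral>\<^sup>+x. ennpowr (G x) (p / q) * ennpowr (ennpowr (maximal H x) p) (1 - p / q) \<partial>M)"
    by (intro nn_integral_mono pt)
  moreover have "\<dots> \<le> ennpowr (\<integral>\<^sup>+x. G x \<partial>M) (p / q) * ennpowr (\<integral>\<^sup>+x. ennpowr (maximal H x) p \<partial>M) (1 - p / q)"
    using p pq by (intro nn_integral_Hoelder) auto
  ultimately show ?thesis unfolding Hp D_def by (meson order_trans)
qed

text \<open>The norm of S is tested on its extremal function: S to the power p / q is S times
  \<open>\<phi>\<close>, a power of S. The exponent \<open>\<nu>\<close> is dictated by the weight:
  \<open>w Q\<close> splits into the power 1 - \<open>\<nu>\<close> / q = p' (1 - 1 / q), controlled
  by \<open>\<sigma> Q\<close>, and the power \<open>\<nu>\<close> / q, which joins the average of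
  \<open>\<Psi>\<close> to form the dual maximal function. The same value satisfies p' (1 - q / p) =
  \<open>\<nu>\<close>, as Hoelder with the exponent p / q requires.\<close>

lemma vector_maximal_bound_lower:
  fixes h :: "nat \<Rightarrow> 'a \<Rightarrow> ennreal"
  assumes q: "1 < q" "q < p" and I: "finite I" and [measurable]: "\<And>k. h k \<in> borel_measurable M"
    and Y: "(\<integral>\<^sup>+x. ennpowr (\<Sum>k\<in>I. ennpowr (h k x) q) (p / q) \<partial>M) < top"
  shows "(\<integral>\<^sup>+x. ennpowr (\<Sum>k\<in>I. ennpowr (maximal (h k) x) q) (p / q) \<partial>M)
     \<le> ennreal ((scalar_const p q K * dual_const p K powr (1 - q / p)) powr (p / q) * A powr (2 * p - 1))
        * (\<integral>\<^sup>+x. ennpowr (\<Sum>k\<in>I. ennpowr (h k x) q) (p / q) \<partial>M)"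
proof -
  define p' where "p' = p / (p - 1)"
  define \<nu> where "\<nu> = (p - q) / (p - 1)"
  have \<nu>: "0 < \<nu>" "\<nu> < 1" using p q by (auto simp: \<nu>_def)
  then have \<nu>q: "\<nu> < q" using q by linarith
  define S where "S x = (\<Sum>k\<in>I. ennpowr (maximal (h k) x) q)" for x
  define T where "T x = (\<Sum>k\<in>I. ennpowr (h k x) q)" for x
  have [measurable]: "S \<in> borel_measurable M" "T \<in> borel_measurable M" unfolding S_def T_def by measurable
  define X where "X = (\<integral>\<^sup>+x. ennpowr (S x) (p / q) \<partial>M)"
  define Y where "Y = (\<integral>\<^sup>+x. ennpowr (T x) (p / q) \<partial>M)"
  have Yfin: "Y < top" using Y by (simp add: Y_def T_def)
  have Xfin: "X \<noteq> top"
  proof -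
    have "X \<le> (\<integral>\<^sup>+x. ennreal (real (card I) powr (p / q)) * (\<Sum>k\<in>I. ennpowr (ennpowr (maximal (h k) x) q) (p / q)) \<partial>M)"
      unfolding X_def S_def using I p q by (intro nn_integral_mono ennpowr_sum_le) auto
    also have "\<dots> = ennreal (real (card I) powr (p / q)) * (\<Sum>k\<in>I. \<integral>\<^sup>+x. ennpowr (maximal (h k) x) p \<partial>M)"
      using q by (simp add: nn_integral_cmult nn_integral_sum ennpowr_ennpowr)
    also have "\<dots> \<le> ennreal (real (card I) powr (p / q)) * (\<Sum>k\<in>I. ennreal (scalar_const p p K * A powr (2 * p - 1)) * Y)"
    proof (intro mult_left_mono sum_mono order_trans[OF maximal_bound])
      fix k assume "k \<in> I"
      have "ennpowr (h k x) p \<le> ennpowr (T x) (p / q)" for x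
      proof -
        have "ennpowr (h k x) p = ennpowr (ennpowr (h k x) q) (p / q)" using q by (simp add: ennpowr_ennpowr)
        also have "\<dots> \<le> ennpowr (T x) (p / q)"
          unfolding T_def using p q I \<open>k \<in> I\<close> by (intro ennpowr_mono member_le_sum) auto
        finally show ?thesis .
      qed
      then show "(\<integral>\<^sup>+x. ennpowr (h k x) p \<partial>M) \<le> Y" unfolding Y_def by (intro nn_integral_mono)
    qed auto
    also have "\<dots> < top" using Yfin I by (auto simp: ennreal_mult_less_top less_top[symmetric] ennreal_mult_eq_top_iff)
    finally show ?thesis by simp
  qed
  define \<Psi> where "\<Psi> x = ennpowr (S x) ((p - 1) / q)" for x
  define \<phi> where "\<phi> x = ennpowr (\<Psi> x) \<nu>" for x
  define \<Phi> where "\<Phi> x = ennpowr (maximal_dual \<Psi> x) \<nu>" for x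
  define \<beta> where "\<beta> Q = ennpowr (average M Q \<Psi>) (\<nu> / q)" for Q
  have [measurable]: "\<Psi> \<in> borel_measurable M" unfolding \<Psi>_def by measurable
  have [measurable]: "\<phi> \<in> borel_measurable M" "\<Phi> \<in> borel_measurable M" unfolding \<phi>_def \<Phi>_def by measurable
  define D where "D = scalar_const p q K * A powr (2 * q - 1)"
  define D' where "D' = dual_const p K * A"
  have D: "0 < D" "0 < D'" using scalar_const_pos[of q K p] dual_const_pos[of p K] p q K A by (auto simp: D_def D'_def)
  have single: "(\<integral>\<^sup>+x. ennpowr (maximal (h k) x) q * \<phi> x \<partial>M) \<le> ennreal D * (\<integral>\<^sup>+x. ennpowr (h k x) q * \<Phi> x \<partial>M)" for k
    unfolding D_def
  proof (rule maximal_weighted_bound')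
    fix Q assume Q: "Q \<in> F"
    have [measurable]: "Q \<in> sets M" using Q Fsets by auto
    \<comment> \<open>Jensen's inequality for the concave power \<open>\<nu>\<close>, in the form of
      Hoelder against the constant 1.\<close>
    have "(\<integral>\<^sup>+x\<in>Q. \<phi> x \<partial>M) = (\<integral>\<^sup>+x\<in>Q. ennpowr (\<Psi> x) \<nu> * ennpowr 1 (1 - \<nu>) \<partial>M)" by (simp add: \<phi>_def)
    also have "\<dots> \<le> ennpowr (\<integral>\<^sup>+x\<in>Q. \<Psi> x \<partial>M) \<nu> * ennpowr (\<integral>\<^sup>+x\<in>Q. 1 \<partial>M) (1 - \<nu>)"
      using \<nu> by (intro nn_set_integral_Hoelder) auto
    also have "\<dots> = ennpowr (average M Q \<Psi> * emeasure M Q) \<nu> * ennpowr (emeasure M Q) (1 - \<nu>)"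
      using Q by (simp add: average_times)
    also have "\<dots> = ennpowr (average M Q \<Psi>) \<nu> * (ennpowr (emeasure M Q) \<nu> * ennpowr (emeasure M Q) (1 - \<nu>))"
      using \<nu> by (simp add: ennpowr_mult mult.assoc)
    also have "ennpowr (emeasure M Q) \<nu> * ennpowr (emeasure M Q) (1 - \<nu>) = emeasure M Q"
      using ennpowr_add[of \<nu> "1 - \<nu>" "emeasure M Q"] \<nu> by simp
    finally show "(\<integral>\<^sup>+x\<in>Q. \<phi> x \<partial>M) \<le> ennpowr (\<beta> Q) q * emeasure M Q"
      using q by (simp add: \<beta>_def ennpowr_ennpowr)
    fix x assume x: "x \<in> Q"
    have "w Q x * average M Q \<Psi> \<le> maximal_dual \<Psi> x"
      unfolding maximal_dual_def using Q x by (intro SUP_upper2[of Q]) auto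
    then have 1: "ennpowr (w Q x * average M Q \<Psi>) (\<nu> / q) \<le> ennpowr (\<Phi> x) (1 / q)"
      unfolding \<Phi>_def using \<nu> \<nu>q q by (simp add: ennpowr_ennpowr ennpowr_mono)
    have e: "1 - \<nu> / q = p' * (1 - 1 / q)" using p q by (simp add: \<nu>_def p'_def field_simps)
    have 2: "ennpowr (w Q x) (1 - \<nu> / q) \<le> ennpowr (\<sigma> Q x) (1 - 1 / q)"
      unfolding e ennpowr_ennpowr[symmetric] p'_def using q Q by (intro ennpowr_mono w_le_\<sigma>) auto
    have "\<beta> Q * w Q x = \<beta> Q * (ennpowr (w Q x) (1 - \<nu> / q) * ennpowr (w Q x) (\<nu> / q))"
      using ennpowr_add[of "1 - \<nu> / q" "\<nu> / q" "w Q x"] \<nu> \<nu>q q by simp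
    also have "\<dots> = ennpowr (w Q x) (1 - \<nu> / q) * ennpowr (w Q x * average M Q \<Psi>) (\<nu> / q)"
      unfolding \<beta>_def using \<nu> \<nu>q q by (simp add: ennpowr_mult mult_ac)
    also have "\<dots> \<le> ennpowr (\<sigma> Q x) (1 - 1 / q) * ennpowr (\<Phi> x) (1 / q)"
      using 1 2 by (intro mult_mono) auto
    finally show "\<beta> Q * w Q x \<le> ennpowr (\<sigma> Q x) (1 - 1 / q) * ennpowr (\<Phi> x) (1 / q)" .
  qed (use q in auto)
  have "ennpowr (S x) (p / q) = S x * \<phi> x" for x
  proof -
    have "p / q = 1 + (p - 1) / q * \<nu>" using p q by (simp add: \<nu>_def field_simps)
    then have "ennpowr (S x) (p / q) = ennpowr (S x) 1 * ennpowr (S x) ((p - 1) / q * \<nu>)"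
      using p q \<nu> by (metis ennpowr_add zero_less_one divide_pos_pos mult_pos_pos diff_gt_0_iff_gt order.strict_trans)
    then show ?thesis by (simp add: \<phi>_def \<Psi>_def ennpowr_ennpowr)
  qed
  then have "X = (\<integral>\<^sup>+x. (\<Sum>k\<in>I. ennpowr (maximal (h k) x) q * \<phi> x) \<partial>M)"
    unfolding X_def by (simp add: S_def sum_distrib_right)
  also have "\<dots> = (\<Sum>k\<in>I. \<integral>\<^sup>+x. ennpowr (maximal (h k) x) q * \<phi> x \<partial>M)"
    by (intro nn_integral_sum) auto
  also have "\<dots> \<le> (\<Sum>k\<in>I. ennreal D * (\<integral>\<^sup>+x. ennpowr (h k x) q * \<Phi> x \<partial>M))"
    by (intro sum_mono single)
  also have "\<dots> = ennreal D * (\<integral>\<^sup>+x. T x * \<Phi> x \<partial>M)"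
    unfolding T_def sum_distrib_right by (subst nn_integral_sum) (auto simp: sum_distrib_left)
  also have "(\<integral>\<^sup>+x. T x * \<Phi> x \<partial>M) = (\<integral>\<^sup>+x. ennpowr (ennpowr (T x) (p / q)) (q / p) * ennpowr (ennpowr (maximal_dual \<Psi> x) p') (1 - q / p) \<partial>M)"
  proof (intro nn_integral_cong arg_cong2[where f = "(*)"])
    fix x show "T x = ennpowr (ennpowr (T x) (p / q)) (q / p)" using p q by (simp add: ennpowr_ennpowr)
    have "p' * (1 - q / p) = \<nu>" using p by (simp add: p'_def \<nu>_def field_simps)
    then show "\<Phi> x = ennpowr (ennpowr (maximal_dual \<Psi> x) p') (1 - q / p)"
      by (simp add: ennpowr_ennpowr \<Phi>_def)
  qed
  also have "\<dots> \<le> ennpowr Y (q / p) * ennpowr (\<integral>\<^sup>+x. ennpowr (maximal_dual \<Psi> x) p' \<partial>M) (1 - q / p)"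
    unfolding Y_def using p q by (intro nn_integral_Hoelder) auto
  also have "(\<integral>\<^sup>+x. ennpowr (maximal_dual \<Psi> x) p' \<partial>M) \<le> ennreal D' * (\<integral>\<^sup>+x. ennpowr (\<Psi> x) p' \<partial>M)"
    using maximal_dual_bound[of \<Psi>] by (simp add: D'_def dual_const_def p'_def Let_def)
  also have "(\<integral>\<^sup>+x. ennpowr (\<Psi> x) p' \<partial>M) = X"
    unfolding X_def \<Psi>_def p'_def using p by (simp add: ennpowr_ennpowr)
  finally have "X \<le> ennreal D * (ennpowr Y (q / p) * ennpowr (ennreal D' * X) (1 - q / p))"
    using p q by (simp add: ennpowr_mono mult_left_mono)
  also have "\<dots> = (ennreal (D * D' powr (1 - q / p)) * ennpowr Y (q / p)) * ennpowr X (1 - q / p)"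
    using D p q by (simp add: ennpowr_mult ennpowr_ennreal ennreal_mult mult_ac)
  finally have "ennpowr X (q / p) \<le> ennreal (D * D' powr (1 - q / p)) * ennpowr Y (q / p)"
    using Xfin p q by (intro ennpowr_le_cancel) auto
  then have "ennpowr (ennpowr X (q / p)) (p / q) \<le> ennpowr (ennreal (D * D' powr (1 - q / p)) * ennpowr Y (q / p)) (p / q)"
    using p q by (intro ennpowr_mono) auto
  then have "X \<le> ennreal ((D * D' powr (1 - q / p)) powr (p / q)) * Y"
    using p q D by (simp add: ennpowr_mult ennpowr_ennpowr ennpowr_ennreal)
  also have "(D * D' powr (1 - q / p)) powr (p / q) = (scalar_const p q K * dual_const p K powr (1 - q / p)) powr (p / q) * A powr (2 * p - 1)"
  proof -
    have "D * D' powr (1 - q / p) = (scalar_const p q K * dual_const p K powr (1 - q / p)) * A powr (2 * q - 1 + (1 - q / p))"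
      unfolding D_def D'_def using A dual_const_pos[of p K] p K
      by (subst powr_add) (simp add: powr_mult mult_ac)
    \<comment> \<open>D contributes the power 2 q - 1 of A and the dual operator the power 1 - q /
      p. After the root from the absorption the total agrees with the case q = p.\<close>
    moreover have "(2 * q - 1 + (1 - q / p)) * (p / q) = 2 * p - 1" using p q by (simp add: field_simps)
    ultimately show ?thesis
      using A dual_const_pos[of p K] scalar_const_pos[of q K p] p q K by (simp add: powr_mult powr_powr)
  qed
  finally show ?thesis by (simp add: X_def Y_def S_def T_def)
qed

lemma vector_maximal_bound:
  fixes h :: "nat \<Rightarrow> 'a \<Rightarrow> ennreal"
  assumes q: "1 < q" and I: "finite I" and [measurable]: "\<And>k. h k \<in> borel_measurable M" and fin: "\<And>k x. h k x < top"
  shows "(\<integral>\<^sup>+x. ennpowr (\<Sum>k\<in>I. ennpowr (maximal (h k) x) q) (p / q) \<partial>M)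
     \<le> ennreal (vector_const p q K * A powr (2 * p - 1))
        * (\<integral>\<^sup>+x. ennpowr (\<Sum>k\<in>I. ennpowr (h k x) q) (p / q) \<partial>M)" (is "?X \<le> ?c * ?Y")
proof -
  consider "p < q" | "p = q" | "q < p" "?Y = top" | "q < p" "?Y < top" by (force simp: less_top)
  then show ?thesis
  proof cases
    case 1
    then show ?thesis using vector_maximal_bound_upper[OF 1 I, of h] fin by (simp add: vector_const_def)
  next
    case 2
    have "?X = (\<Sum>k\<in>I. \<integral>\<^sup>+x. ennpowr (maximal (h k) x) q \<partial>M)"
      using 2 q by (simp add: nn_integral_sum)
    also have "\<dots> \<le> (\<Sum>k\<in>I. ?c * \<integral>\<^sup>+x. ennpowr (h k x) q \<partial>M)"
      using 2 maximal_bound by (intro sum_mono) (auto simp: vector_const_def)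
    also have "\<dots> = ?c * ?Y"
      using 2 q by (simp add: nn_integral_sum sum_distrib_left)
    finally show ?thesis .
  next
    case 3
    then show ?thesis using vector_const_pos[OF p q K] A by (simp add: ennreal_mult_top)
  next
    case 4
    then show ?thesis using vector_maximal_bound_lower[OF q 4(1) I, of h] by (simp add: vector_const_def)
  qed
qed

end

section \<open>The spectral theorem and powers of positive definite matrices\<close>

definition cdot :: "complex^'d \<Rightarrow> complex^'d \<Rightarrow> complex" where
  "cdot u v = (\<Sum>i\<in>UNIV. cnj (u $ i) * v $ i)"

lemma Re_cdot: "Re (cdot u v) = u \<bullet> v"
  by (simp add: cdot_def inner_vec_def inner_complex_def)

lemma Im_cdot: "Im (cdot u v) = (\<chi> i. \<i> * u $ i) \<bullet> v"
  by (simp add: cdot_def inner_vec_def inner_complex_def algebra_simps)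

lemma cdot_add_right: "cdot u (v + w) = cdot u v + cdot u w"
  by (simp add: cdot_def sum.distrib algebra_simps)

lemma cdot_scaleR_right: "cdot u (r *\<^sub>R v) = of_real r * cdot u v"
  by (simp add: cdot_def sum_distrib_left scaleR_conv_of_real[where 'a = complex] algebra_simps)

lemma cdot_scaleR_left: "cdot (r *\<^sub>R u) v = of_real r * cdot u v"
  by (simp add: cdot_def sum_distrib_left scaleR_conv_of_real[where 'a = complex] algebra_simps)

lemma cnj_cdot: "cnj (cdot u v) = cdot v u"
  by (simp add: cdot_def mult.commute)

lemma cdot_self: "cdot u u = of_real (u \<bullet> u)"
proof -
  have "Im (cdot u u) = 0" by (simp add: cdot_def)
  then show ?thesis by (simp add: complex_eq_iff Re_cdot)
qed

lemma ctranspose_nth: "ctranspose A $ i $ j = cnj (A $ j $ i)"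
  by (simp add: ctranspose_def map_matrix_def transpose_def)

lemma cdot_ctranspose: "cdot (A *v u) v = cdot u (ctranspose A *v v)"
proof -
  have "cdot (A *v u) v = (\<Sum>i\<in>UNIV. \<Sum>j\<in>UNIV. cnj (A $ i $ j) * cnj (u $ j) * v $ i)"
    by (simp add: cdot_def matrix_vector_mult_def sum_distrib_right)
  also have "\<dots> = (\<Sum>j\<in>UNIV. \<Sum>i\<in>UNIV. cnj (A $ i $ j) * cnj (u $ j) * v $ i)" by (rule sum.swap)
  also have "\<dots> = cdot u (ctranspose A *v v)"
    by (simp add: cdot_def matrix_vector_mult_def sum_distrib_left ctranspose_nth mult_ac)
  finally show ?thesis .
qed

lemma hermitian_inner: "hermitian A \<Longrightarrow> (A *v u) \<bullet> v = u \<bullet> (A *v v)"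
  by (metis Re_cdot cdot_ctranspose hermitian_def)

text \<open>Complex orthogonality to \<open>u i\<close> is real orthogonality to \<open>u i\<close>
  and to its multiple by the imaginary unit. These are fewer real conditions than the real dimension
  2 * \<open>CARD('d)\<close>.\<close>

lemma orthogonal_vector_exists:
  fixes u :: "'d \<Rightarrow> complex^'d"
  assumes "k \<notin> (I :: 'd set)"
  shows "\<exists>x. x \<noteq> 0 \<and> (\<forall>i\<in>I. cdot (u i) x = 0)"
proof -
  let ?E = "u ` I \<union> (\<lambda>i. \<chi> j. \<i> * u i $ j) ` I"
  have "dim ?E \<le> card ?E" by (intro dim_le_card') auto
  also have "\<dots> \<le> card (u ` I) + card ((\<lambda>i. \<chi> j. \<i> * u i $ j) ` I)" by (rule card_Un_le)
  also have "\<dots> \<le> card I + card I" by (intro add_mono card_image_le) auto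
  also have "\<dots> < DIM(complex^'d)"
  proof -
    have "I \<subset> UNIV" using assms by auto
    then have "card I < CARD('d)" by (intro psubset_card_mono) auto
    then show ?thesis by simp
  qed
  finally obtain x where x: "x \<noteq> 0" "\<And>y. y \<in> span ?E \<Longrightarrow> orthogonal x y"
    using orthogonal_to_subspace_exists by blast
  show ?thesis
  proof (intro exI conjI ballI)
    show "x \<noteq> 0" by (rule x(1))
    fix i assume "i \<in> I"
    then have "orthogonal x (u i)" "orthogonal x (\<chi> j. \<i> * u i $ j)"
      by (auto intro!: x(2) span_base)
    then show "cdot (u i) x = 0"
      by (simp add: complex_eq_iff Re_cdot Im_cdot orthogonal_def inner_commute)
  qed
qed

text \<open>The Rayleigh quotient attains its maximum on the unit sphere of S. By invariance the
  residual z = A v - a v lies in S, so v may be perturbed in its direction, and maximality forces z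
  = 0.\<close>

lemma constrained_eigenvector:
  fixes A :: "complex^'d^'d"
  assumes A: "hermitian A" and S: "closed S" "subspace S" "\<And>v. v \<in> S \<Longrightarrow> A *v v \<in> S"
    and x: "x \<in> S" "x \<noteq> 0"
  obtains v a where "v \<in> S" "norm v = 1" "A *v v = a *\<^sub>R v"
proof -
  let ?L = "(*v) A"
  have lin: "bounded_linear ?L" by (rule matrix_vector_mul_bounded_linear)
  interpret L: bounded_linear ?L by (rule lin)
  have "compact (S \<inter> sphere 0 1)" using S by (intro closed_Int_compact) auto
  moreover have "(1 / norm x) *\<^sub>R x \<in> S \<inter> sphere 0 1" using S x by (auto intro: subspace_scale)
  then have "S \<inter> sphere 0 1 \<noteq> {}" by blast
  moreover have "continuous_on (S \<inter> sphere 0 1) (\<lambda>v. v \<bullet> ?L v)"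
    by (intro continuous_intros linear_continuous_on lin)
  ultimately have "\<exists>v\<in>S \<inter> sphere 0 1. \<forall>y\<in>S \<inter> sphere 0 1. y \<bullet> ?L y \<le> v \<bullet> ?L v"
    by (rule continuous_attains_sup)
  then obtain v where v: "v \<in> S" "norm v = 1" and mx: "\<And>y. y \<in> S \<Longrightarrow> norm y = 1 \<Longrightarrow> y \<bullet> ?L y \<le> v \<bullet> ?L v"
    by (auto simp: dist_norm)
  define a where "a = v \<bullet> ?L v"
  have form: "y \<bullet> ?L y \<le> a * (y \<bullet> y)" if "y \<in> S" for y
  proof (cases "y = 0")
    case False
    let ?y = "(1 / norm y) *\<^sub>R y"
    have "?y \<bullet> ?L ?y \<le> a" unfolding a_def using that False S by (intro mx) (auto intro: subspace_scale)
    then have "(y \<bullet> ?L y) / (norm y)\<^sup>2 \<le> a" by (simp add: L.scaleR power2_eq_square)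
    then show ?thesis using False by (simp add: divide_le_eq power2_norm_eq_inner split: if_splits)
  qed (simp add: L.zero)
  define z where "z = ?L v - a *\<^sub>R v"
  have zS: "z \<in> S" unfolding z_def using S v by (intro subspace_diff subspace_scale) auto
  define c where "c = a * (z \<bullet> z) - z \<bullet> ?L z"
  have c: "0 \<le> c" using form[OF zS] by (simp add: c_def)
  have vv: "v \<bullet> v = 1" using v by (simp add: dot_square_norm)
  have quad: "2 * t * (z \<bullet> z) \<le> t\<^sup>2 * c" for t
  proof -
    have "v + t *\<^sub>R z \<in> S" using S v zS by (intro subspace_add subspace_scale) auto
    from form[OF this] have "v \<bullet> ?L v + t * (v \<bullet> ?L z) + t * (z \<bullet> ?L v) + t\<^sup>2 * (z \<bullet> ?L z)
       \<le> a * (1 + 2 * t * (v \<bullet> z) + t\<^sup>2 * (z \<bullet> z))"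
      by (simp add: L.add L.scaleR inner_add_left inner_add_right vv power2_eq_square algebra_simps inner_commute)
    moreover have "v \<bullet> ?L z = z \<bullet> ?L v" using hermitian_inner[OF A, of v z] by (simp add: inner_commute)
    moreover have "z \<bullet> ?L v = z \<bullet> z + a * (v \<bullet> z)"
      by (simp add: z_def inner_diff_left inner_diff_right algebra_simps inner_commute)
    ultimately show ?thesis by (simp add: c_def a_def algebra_simps)
  qed
  have "z \<bullet> z \<le> 0"
  proof (rule ccontr)
    assume "\<not> z \<bullet> z \<le> 0"
    then have zz: "0 < z \<bullet> z" by (simp only: not_le)
    \<comment> \<open>Small enough for the quadratic term of the perturbation to lose against the
      linear one; the summand 1 avoids dividing by c = 0.\<close>
    define t where "t = (z \<bullet> z) / (c + 1)"
    have t: "0 < t" "t * c \<le> z \<bullet> z" using zz c by (auto simp: t_def field_simps)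
    have "2 * t * (z \<bullet> z) \<le> t * (t * c)" using quad[of t] by (simp add: power2_eq_square mult_ac)
    also have "\<dots> \<le> t * (z \<bullet> z)" using t by (intro mult_left_mono) auto
    finally show False using t zz by (simp add: mult_pos_pos)
  qed
  then have "z = 0" by (metis inner_gt_zero_iff not_le)
  then show ?thesis using v by (intro that[of v a]) (auto simp: z_def)
qed

text \<open>Partial eigenbases are indexed by subsets of the index type of the matrix: adding one
  index means finding an eigenvector in the invariant orthogonal complement, and for
  \<open>UNIV\<close> the vectors are the columns of a unitary matrix.\<close>

lemma eigenbasis_exists:
  fixes A :: "complex^'d^'d" and I :: "'d set"
  assumes A: "hermitian A"
  shows "\<exists>u a. \<forall>i\<in>I. A *v u i = a i *\<^sub>R u i \<and> (\<forall>j\<in>I. cdot (u i) (u j) = (if i = j then 1 else 0))"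
proof -
  have "finite I" by simp
  then show ?thesis
  proof (induction I)
    case (insert k I)
    then obtain u a where e: "\<And>i. i \<in> I \<Longrightarrow> A *v u i = a i *\<^sub>R u i"
      and o: "\<And>i j. i \<in> I \<Longrightarrow> j \<in> I \<Longrightarrow> cdot (u i) (u j) = (if i = j then 1 else 0)"
      by blast
    define S where "S = {v. \<forall>i\<in>I. cdot (u i) v = 0}"
    obtain x where x: "x \<noteq> 0 \<and> (\<forall>i\<in>I. cdot (u i) x = 0)"
      using orthogonal_vector_exists[OF insert(2), of u] ..
    then have "x \<in> S" by (simp add: S_def)
    have "closed S"
    proof -
      have "closed {v. cdot (u i) v = 0}" for i
        unfolding cdot_def by (intro closed_Collect_eq continuous_intros)
      moreover have "S = (\<Inter>i\<in>I. {v. cdot (u i) v = 0})" by (auto simp: S_def)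
      ultimately show ?thesis by auto
    qed
    moreover have "subspace S"
      by (auto simp: S_def subspace_def cdot_add_right cdot_scaleR_right) (simp add: cdot_def)
    moreover have "A *v v \<in> S" if "v \<in> S" for v
    proof -
      have "cdot (u i) (A *v v) = 0" if "i \<in> I" for i
      proof -
        have "cdot (u i) (A *v v) = cdot (A *v u i) v"
          using A cdot_ctranspose[of A "u i" v] by (simp add: hermitian_def)
        then show ?thesis using e[OF that] \<open>v \<in> S\<close> that by (simp add: cdot_scaleR_left S_def)
      qed
      then show ?thesis by (simp add: S_def)
    qed
    ultimately obtain v b where v: "v \<in> S" "norm v = 1" "A *v v = b *\<^sub>R v"
      using constrained_eigenvector[OF A _ _ _ \<open>x \<in> S\<close> conjunct1[OF x]] by metis
    have "cdot v v = 1" using v by (simp add: cdot_self dot_square_norm)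
    moreover have "cdot (u i) v = 0" "cdot v (u i) = 0" if "i \<in> I" for i
      using v(1) that cnj_cdot[of "u i" v] by (auto simp: S_def)
    ultimately have "\<forall>i\<in>insert k I. A *v (u(k := v)) i = (a(k := b)) i *\<^sub>R (u(k := v)) i \<and>
       (\<forall>j\<in>insert k I. cdot ((u(k := v)) i) ((u(k := v)) j) = (if i = j then 1 else 0))"
      using e o v(3) insert(2) by auto
    then show ?case by blast
  qed simp
qed

lemma spectral_theorem:
  fixes A :: "complex^'d^'d"
  assumes A: "hermitian A"
  obtains U a where "unitary U" "A = U ** diag_mat a ** ctranspose U"
    "\<And>i. A *v column i U = a i *\<^sub>R column i U" "\<And>i. column i U \<noteq> 0"
proof -
  obtain u :: "'d \<Rightarrow> complex^'d" where "\<exists>a. \<forall>i\<in>UNIV. A *v u i = a i *\<^sub>R u i \<and> (\<forall>j\<in>UNIV. cdot (u i) (u j) = (if i = j then 1 else 0))"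
    using eigenbasis_exists[OF A, of UNIV] ..
  then obtain a :: "'d \<Rightarrow> real" where ua: "\<forall>i\<in>UNIV. A *v u i = a i *\<^sub>R u i \<and> (\<forall>j\<in>UNIV. cdot (u i) (u j) = (if i = j then 1 else 0))"
    ..
  have e: "A *v u i = a i *\<^sub>R u i" for i using ua by simp
  have o: "cdot (u i) (u j) = (if i = j then 1 else 0)" for i j using ua by (metis UNIV_I)
  define U where "U = (\<chi> i j. u j $ i)"
  have col: "column i U = u i" for i by (simp add: U_def column_def vec_eq_iff)
  have 1: "ctranspose U ** U = mat 1"
    using o by (simp add: vec_eq_iff matrix_matrix_mult_def ctranspose_nth U_def mat_def cdot_def)
  then have U: "unitary U" using matrix_left_right_inverse by (auto simp: unitary_def)
  have "A ** U = U ** diag_mat a"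
  proof -
    have "(A ** U) $ i $ j = (U ** diag_mat a) $ i $ j" for i j
    proof -
      have "(A ** U) $ i $ j = (A *v u j) $ i"
        by (simp add: matrix_matrix_mult_def matrix_vector_mult_def U_def)
      also have "\<dots> = (U ** diag_mat a) $ i $ j"
        unfolding e diag_mat_mult_right by (simp add: U_def scaleR_conv_of_real[where 'a = complex] mult.commute)
      finally show ?thesis .
    qed
    then show ?thesis by (simp add: vec_eq_iff)
  qed
  then have "A = U ** diag_mat a ** ctranspose U"
    using U by (metis unitary_def matrix_mul_assoc matrix_mul_rid)
  moreover have "u i \<noteq> 0" for i using o[of i i] by (auto simp: cdot_def)
  ultimately show ?thesis using U e by (intro that[of U a]) (auto simp: col)
qed

section \<open>Functional calculus for positive definite matrices\<close>

lemma pos_definite_inner: "pos_definite A \<longleftrightarrow> hermitian A \<and> (\<forall>v. v \<noteq> 0 \<longrightarrow> 0 < v \<bullet> (A *v v))"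
  unfolding pos_definite_def Re_cdot[unfolded cdot_def] by (rule refl)

lemma pos_definite_diagonalization:
  assumes "pos_definite A"
  obtains U a where "unitary U" "A = U ** diag_mat a ** ctranspose U" "\<And>i. 0 < a i"
proof -
  obtain U a where U: "unitary U" "A = U ** diag_mat a ** ctranspose U"
    and e: "\<And>i. A *v column i U = a i *\<^sub>R column i U" "\<And>i. column i U \<noteq> 0"
    using spectral_theorem assms by (metis pos_definite_def)
  have "0 < a i" for i
  proof -
    have "0 < column i U \<bullet> (A *v column i U)" using assms e(2) by (simp add: pos_definite_inner)
    then have "0 < a i * (column i U \<bullet> column i U)" using e by simp
    moreover have "0 < column i U \<bullet> column i U" using e(2)[of i] by simp
    ultimately show ?thesis by (rule zero_less_mult_pos2)
  qed
  then show ?thesis using U that by blast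
qed

lemma diag_mat_mult: "diag_mat a ** diag_mat b = diag_mat (\<lambda>i. a i * b i)"
  by (simp add: vec_eq_iff diag_mat_mult_right) (simp add: diag_mat_def)

lemma conj_diag_mult:
  assumes "unitary U"
  shows "(U ** diag_mat a ** ctranspose U) ** (U ** diag_mat b ** ctranspose U)
     = U ** diag_mat (\<lambda>i. a i * b i) ** ctranspose U"
proof -
  have "(U ** diag_mat a ** ctranspose U) ** (U ** diag_mat b ** ctranspose U)
     = U ** (diag_mat a ** ((ctranspose U ** U) ** diag_mat b)) ** ctranspose U"
    by (simp only: matrix_mul_assoc)
  then show ?thesis using assms by (simp add: unitary_def matrix_mul_lid diag_mat_mult)
qed

lemma conj_diag_one:
  fixes U :: "complex^'d^'d"
  shows "unitary U \<Longrightarrow> U ** diag_mat (\<lambda>_. 1) ** ctranspose U = mat 1"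
proof -
  have "diag_mat (\<lambda>_. 1) = (mat 1 :: complex^'d^'d)" by (simp add: vec_eq_iff diag_mat_def mat_def)
  then show "unitary U \<Longrightarrow> U ** diag_mat (\<lambda>_. 1) ** ctranspose U = mat 1"
    by (simp add: unitary_def matrix_mul_rid)
qed

lemma conj_diag_nth:
  "(U ** diag_mat a ** ctranspose U) $ i $ k = (\<Sum>j\<in>UNIV. U $ i $ j * of_real (a j) * cnj (U $ k $ j))"
  by (subst matrix_matrix_mult_def) (simp add: diag_mat_mult_right ctranspose_nth)

lemma hermitian_conj_diag: "hermitian (U ** diag_mat a ** ctranspose U)"
  by (simp add: hermitian_def vec_eq_iff ctranspose_nth conj_diag_nth mult_ac)

lemma hermitian_mat_powr: "pos_definite A \<Longrightarrow> hermitian (mat_powr A s)"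
  by (metis pos_definite_diagonalization mat_powr_eq hermitian_conj_diag)

lemma mat_powr_minus:
  assumes "pos_definite A"
  shows "mat_powr A s ** mat_powr A (- s) = mat 1"
proof -
  obtain U a where U: "unitary U" "A = U ** diag_mat a ** ctranspose U" "\<And>i. 0 < a i"
    using pos_definite_diagonalization[OF assms] by blast
  have "a i powr s * a i powr (- s) = 1" for i using U(3)[of i] by (simp add: powr_minus)
  then show ?thesis
    unfolding mat_powr_eq[OF U(1,2)] using U(1) by (simp add: conj_diag_mult conj_diag_one)
qed

section \<open>Measurability of matrix powers\<close>

fun matrix_power :: "complex^'d^'d \<Rightarrow> nat \<Rightarrow> complex^'d^'d" where
  "matrix_power A 0 = mat 1"
| "matrix_power A (Suc n) = A ** matrix_power A n"

lemma matrix_power_conj_diag: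
  assumes "unitary U"
  shows "matrix_power (U ** diag_mat a ** ctranspose U) n = U ** diag_mat (\<lambda>i. a i ^ n) ** ctranspose U"
  by (induction n) (auto simp: assms conj_diag_mult conj_diag_one)

lemma matrix_poly_conj_diag:
  assumes "unitary U"
  shows "(\<Sum>i\<le>n. c i *\<^sub>R matrix_power (U ** diag_mat a ** ctranspose U) i)
     = U ** diag_mat (\<lambda>j. \<Sum>i\<le>n. c i * a j ^ i) ** ctranspose U"
  unfolding matrix_power_conj_diag[OF assms]
  by (simp add: vec_eq_iff conj_diag_nth scaleR_conv_of_real[where 'a = complex] sum_distrib_left sum_distrib_right mult_ac)
    (intro allI sum.swap)

lemma continuous_matrix_power: "continuous_on UNIV (\<lambda>A :: complex^'d^'d. matrix_power A n)"
proof (induction n)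
  case (Suc n)
  show ?case
    by (simp add: matrix_matrix_mult_def) (intro continuous_intros Suc)
qed simp

lemma tendsto_conj_diag:
  assumes "\<And>i. (\<lambda>n. b n i) \<longlonglongrightarrow> a i"
  shows "(\<lambda>n. U ** diag_mat (b n) ** ctranspose U) \<longlonglongrightarrow> U ** diag_mat a ** ctranspose U"
  by (intro vec_tendstoI) (simp add: conj_diag_nth, intro tendsto_intros assms)

text \<open>One sequence must serve every t > 0, hence every spectrum simultaneously. Weierstrass is
  applied on compact intervals that exhaust the half-line and stay away from the singularity at
  0.\<close>

lemma powr_polynomial_approximation:
  obtains m :: "nat \<Rightarrow> nat" and c :: "nat \<Rightarrow> nat \<Rightarrow> real"
  where "\<And>t. 0 < t \<Longrightarrow> (\<lambda>n. \<Sum>i\<le>m n. c n i * t ^ i) \<longlonglongrightarrow> t powr s"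
proof -
  have "\<exists>g. real_polynomial_function g \<and> (\<forall>x\<in>{1 / real (Suc n)..real (Suc n)}. \<bar>x powr s - g x\<bar> < 1 / real (Suc n))" for n
  proof -
    have "continuous_on {1 / real (Suc n)..real (Suc n)} (\<lambda>x. x powr s)"
    proof (intro continuous_intros ballI)
      fix x assume "x \<in> {1 / real (Suc n)..real (Suc n)}"
      moreover have "0 < 1 / real (Suc n)" by simp
      ultimately have "0 < x" by (metis atLeastAtMost_iff order_less_le_trans)
      then show "x \<noteq> 0" by simp
    qed
    moreover have "0 < 1 / real (Suc n)" by simp
    ultimately obtain g where "real_polynomial_function g"
      "\<And>x. x \<in> {1 / real (Suc n)..real (Suc n)} \<Longrightarrow> \<bar>x powr s - g x\<bar> < 1 / real (Suc n)"
      using Stone_Weierstrass_real_polynomial_function[OF compact_Icc] by blast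
    then show ?thesis by blast
  qed
  then obtain g where g: "\<And>n. real_polynomial_function (g n)"
    "\<And>n x. x \<in> {1 / real (Suc n)..real (Suc n)} \<Longrightarrow> \<bar>x powr s - g n x\<bar> < 1 / real (Suc n)"
    by metis
  have "\<forall>n. \<exists>c m. g n = (\<lambda>x. \<Sum>i\<le>m. c i * x ^ i)" using g(1) by (simp add: real_polynomial_function_iff_sum)
  then obtain c m where gm: "\<And>n. g n = (\<lambda>x. \<Sum>i\<le>m n. c n i * x ^ i)" by metis
  show ?thesis
  proof (rule that)
    fix t :: real assume t: "0 < t"
    have "(\<lambda>n. g n t - t powr s) \<longlonglongrightarrow> 0"
    proof (rule Lim_null_comparison)
      have "eventually (\<lambda>n. 1 / real (Suc n) \<le> t) sequentially"
        using order_tendstoD(2)[OF lim_1_over_real_power[of 1, THEN LIMSEQ_Suc] t] by (auto elim: eventually_mono)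
      moreover have "eventually (\<lambda>n. t \<le> real (Suc n)) sequentially"
        using eventually_ge_at_top[of "nat \<lceil>t\<rceil>"] by eventually_elim linarith
      ultimately show "eventually (\<lambda>n. norm (g n t - t powr s) \<le> 1 / real (Suc n)) sequentially"
      proof eventually_elim
        case (elim n)
        then show ?case using g(2)[of t n] by (auto simp: abs_minus_commute)
      qed
      show "(\<lambda>n. 1 / real (Suc n)) \<longlonglongrightarrow> 0" using lim_1_over_real_power[of 1, THEN LIMSEQ_Suc] by simp
    qed
    then show "(\<lambda>n. \<Sum>i\<le>m n. c n i * t ^ i) \<longlonglongrightarrow> t powr s"
      by (simp add: gm LIM_zero_iff)
  qed
qed

text \<open>A diagonalization need not be chosen measurably: on positive definite matrices the power
  is a pointwise limit of polynomials in the matrix, which are continuous. The exceptional set is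
  null, hence Lebesgue measurable.\<close>

lemma borel_measurable_mat_powr:
  fixes W :: "real^'n \<Rightarrow> complex^'d^'d"
  assumes W: "W \<in> borel_measurable lebesgue" and PD: "AE x in lebesgue. pos_definite (W x)"
  shows "(\<lambda>x. if pos_definite (W x) then mat_powr (W x) s else mat 1) \<in> borel_measurable lebesgue"
proof -
  obtain m c where mc: "\<And>t. 0 < t \<Longrightarrow> (\<lambda>n. \<Sum>i\<le>m n. c n i * t ^ i) \<longlonglongrightarrow> t powr s"
    using powr_polynomial_approximation[of s] by metis
  define f where "f n A = (\<Sum>i\<le>m n. c n i *\<^sub>R matrix_power A i)" for n and A :: "complex^'d^'d"
  have "continuous_on UNIV (f n)" for n
    unfolding f_def by (intro continuous_intros continuous_matrix_power)
  then have fW: "(\<lambda>x. f n (W x)) \<in> borel_measurable lebesgue" for n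
    using W by (intro measurable_compose[OF W] borel_measurable_continuous_onI)
  obtain N where N: "N \<in> null_sets lebesgue" "{x \<in> space lebesgue. \<not> pos_definite (W x)} \<subseteq> N"
    using PD unfolding eventually_ae_filter by blast
  have "{x \<in> space lebesgue. \<not> pos_definite (W x)} \<in> null_sets lebesgue"
    by (rule null_sets_completion_subset[OF N(2,1)])
  then have "{x \<in> space lebesgue. \<not> pos_definite (W x)} \<in> sets lebesgue"
    by (rule null_setsD2)
  then have "space lebesgue - {x \<in> space lebesgue. \<not> pos_definite (W x)} \<in> sets lebesgue" by (rule sets.compl_sets)
  also have "space lebesgue - {x \<in> space lebesgue. \<not> pos_definite (W x)} = {x \<in> space lebesgue. pos_definite (W x)}" by auto
  finally have PDset: "{x \<in> space lebesgue. pos_definite (W x)} \<in> sets lebesgue" .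
  have lim: "(\<lambda>n. f n A) \<longlonglongrightarrow> mat_powr A s" if A: "pos_definite A" for A
  proof -
    obtain U a where U: "unitary U" "A = U ** diag_mat a ** ctranspose U" "\<And>i. 0 < a i"
      using pos_definite_diagonalization[OF A] by blast
    have "f n A = U ** diag_mat (\<lambda>j. \<Sum>i\<le>m n. c n i * a j ^ i) ** ctranspose U" for n
      unfolding f_def U(2) by (rule matrix_poly_conj_diag[OF U(1)])
    then show ?thesis
      unfolding mat_powr_eq[OF U(1,2)] by (simp only:) (intro tendsto_conj_diag mc U)
  qed
  show ?thesis
  proof (rule borel_measurable_LIMSEQ_metric)
    show "(\<lambda>x. if pos_definite (W x) then f n (W x) else mat 1) \<in> borel_measurable lebesgue" for n
      using PDset fW[of n] by (intro measurable_If) simp_all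
    fix x
    show "(\<lambda>n. if pos_definite (W x) then f n (W x) else mat 1) \<longlonglongrightarrow> (if pos_definite (W x) then mat_powr (W x) s else mat 1)"
      using lim by simp
  qed
qed

section \<open>Dyadic grids\<close>

text \<open>The alternation is forced by nesting: from a level to the next finer one the shift
  doubles modulo 1, which exchanges 1/3 and 2/3.\<close>

definition grid_shift :: "bool \<Rightarrow> int \<Rightarrow> real" where
  "grid_shift t k = (if t then (if even k then 1 / 3 else 2 / 3) else 0)"

text \<open>The side length is 1 / 2 powi k. Since t picks the shift separately in each coordinate,
  covering an arbitrary cube becomes a one-dimensional question.\<close>

definition grid_cube :: "('n \<Rightarrow> bool) \<Rightarrow> int \<Rightarrow> ('n \<Rightarrow> int) \<Rightarrow> (real^'n) set" where
  "grid_cube t k m = {x. \<forall>i. \<lfloor>2 powi k * x $ i + grid_shift (t i) k\<rfloor> = m i}"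

definition grid :: "('n \<Rightarrow> bool) \<Rightarrow> (real^'n) set set" where
  "grid t = range (\<lambda>(k, m). grid_cube t k m)"

lemma countable_grid: "countable (grid (t :: 'n::finite \<Rightarrow> bool))"
  unfolding grid_def by (intro countable_image) auto

lemma floor_double_eq:
  fixes a b :: real and N :: int
  assumes "\<lfloor>2 * a + of_int N\<rfloor> = \<lfloor>2 * b + of_int N\<rfloor>"
  shows "\<lfloor>a\<rfloor> = \<lfloor>b\<rfloor>"
proof -
  have "\<lfloor>2 * a\<rfloor> = \<lfloor>2 * b\<rfloor>" using assms by simp
  moreover have "\<lfloor>c\<rfloor> = \<lfloor>2 * c\<rfloor> div 2" for c :: real
    using floor_divide_real_eq_div[of 2 "2 * c"] by simp
  ultimately show ?thesis by metis
qed

lemma grid_refine: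
  assumes "\<lfloor>2 powi (k + int j) * x + grid_shift t (k + int j)\<rfloor> = \<lfloor>2 powi (k + int j) * y + grid_shift t (k + int j)\<rfloor>"
  shows "\<lfloor>2 powi k * x + grid_shift t k\<rfloor> = \<lfloor>2 powi k * y + grid_shift t k\<rfloor>"
  using assms
proof (induction j)
  case (Suc j)
  let ?k = "k + int j"
  have pw: "(2::real) powi (k + int (Suc j)) = 2 * 2 powi ?k"
    using power_int_add_1[of "2::real" ?k] by (simp add: add_ac mult.commute)
  obtain N :: int where N: "grid_shift t (k + int (Suc j)) = 2 * grid_shift t ?k + of_int N"
  proof (cases "t \<and> odd ?k")
    case True
    then have "grid_shift t (k + int (Suc j)) = 2 * grid_shift t ?k + of_int (- 1)"
      by (auto simp: grid_shift_def)
    then show ?thesis by (rule that)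
  next
    case False
    then have "grid_shift t (k + int (Suc j)) = 2 * grid_shift t ?k + of_int 0"
      by (auto simp: grid_shift_def)
    then show ?thesis by (rule that)
  qed
  have "\<lfloor>2 powi ?k * x + grid_shift t ?k\<rfloor> = \<lfloor>2 powi ?k * y + grid_shift t ?k\<rfloor>"
  proof (rule floor_double_eq)
    show "\<lfloor>2 * (2 powi ?k * x + grid_shift t ?k) + of_int N\<rfloor> = \<lfloor>2 * (2 powi ?k * y + grid_shift t ?k) + of_int N\<rfloor>"
      using Suc.prems unfolding pw N by (simp add: algebra_simps)
  qed
  then show ?case by (rule Suc.IH)
qed simp

lemma laminar_grid: "laminar (grid t)"
proof -
  have le: "grid_cube t k m \<inter> grid_cube t k' m' = {} \<or> grid_cube t k' m' \<subseteq> grid_cube t k m" if "k \<le> k'" for k k' m m'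
  proof (rule disjCI)
    assume "\<not> grid_cube t k' m' \<subseteq> grid_cube t k m"
    then obtain y where y: "y \<in> grid_cube t k' m'" "y \<notin> grid_cube t k m" by blast
    have k': "k + int (nat (k' - k)) = k'" using that by simp
    have "z \<notin> grid_cube t k m" if z: "z \<in> grid_cube t k' m'" for z
    proof
      assume zk: "z \<in> grid_cube t k m"
      have "\<lfloor>2 powi k * y $ i + grid_shift (t i) k\<rfloor> = \<lfloor>2 powi k * z $ i + grid_shift (t i) k\<rfloor>" for i
        using y(1) z grid_refine[of k "nat (k' - k)" "y $ i" "t i" "z $ i"] unfolding k' by (simp add: grid_cube_def)
      then show False using y(2) zk by (simp add: grid_cube_def)
    qed
    then show "grid_cube t k m \<inter> grid_cube t k' m' = {}" by blast
  qed
  have "P \<inter> Q = {} \<or> P \<subseteq> Q \<or> Q \<subseteq> P" if PQ: "P \<in> grid t" "Q \<in> grid t" for P Q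
  proof -
    obtain k m k' m' where e: "P = grid_cube t k m" "Q = grid_cube t k' m'"
      using PQ by (auto simp: grid_def)
    show ?thesis
      using le[of k k' m m'] le[of k' k m' m] e by (cases "k \<le> k'") (auto simp: Int_commute)
  qed
  then show ?thesis by (auto simp: laminar_def)
qed

lemma grid_cube_box:
  fixes t :: "'n::finite \<Rightarrow> bool" and m :: "'n \<Rightarrow> int"
  assumes l_def: "l = 1 / 2 powi k"
  obtains a where "grid_cube t k m = {x. \<forall>i. x $ i \<in> {a i..<a i + l}}"
proof
  define a where "a i = (of_int (m i) - grid_shift (t i) k) * l" for i
  have l: "0 < l" by (simp add: l_def)
  have eq: "\<lfloor>2 powi k * x + grid_shift (t i) k\<rfloor> = m i \<longleftrightarrow> x \<in> {a i..<a i + l}" for x i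
  proof -
    have x: "2 powi k * x = x / l" by (simp add: l_def)
    have "\<lfloor>2 powi k * x + grid_shift (t i) k\<rfloor> = m i
       \<longleftrightarrow> of_int (m i) - grid_shift (t i) k \<le> x / l \<and> x / l < of_int (m i) - grid_shift (t i) k + 1"
      unfolding x floor_eq_iff by linarith
    also have "\<dots> \<longleftrightarrow> x \<in> {a i..<a i + l}"
      using l by (simp add: a_def le_divide_eq divide_less_eq distrib_right)
    finally show ?thesis .
  qed
  show "grid_cube t k m = {x. \<forall>i. x $ i \<in> {a i..<a i + l}}"
    unfolding grid_cube_def eq ..
qed

lemma grid_subset_cubes: "grid t \<subseteq> cubes"
proof
  fix Q assume "Q \<in> grid t"
  then obtain k m where Q: "Q = grid_cube t k m" by (auto simp: grid_def)
  obtain a where "Q = {x. \<forall>i. x $ i \<in> {a i..<a i + 1 / 2 powi k}}"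
    using grid_cube_box[OF refl, of t k m] unfolding Q by blast
  then show "Q \<in> cubes"
    unfolding cubes_def
    by (auto intro!: exI[of _ "\<lambda>i. {a i..<a i + 1 / 2 powi k}"] exI[of _ a] exI[of _ "1 / 2 powi k"])
qed

lemma cube_box:
  assumes "Q = {x :: real^'n. \<forall>i. x $ i \<in> I i}" "0 < l" "\<And>i. {a i<..<a i + l} \<subseteq> I i \<and> I i \<subseteq> {a i..a i + l}"
  shows "Q \<in> sets lebesgue" "emeasure lebesgue Q = ennreal (l ^ CARD('n))"
proof -
  let ?a = "\<chi> i. a i" and ?b = "\<chi> i. a i + l"
  have sub: "box ?a ?b \<subseteq> Q" "Q \<subseteq> cbox ?a ?b"
    using assms(3) unfolding assms(1) by (fastforce simp: mem_box_cart subset_eq)+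
  have "measure lborel (cbox ?a ?b) = l ^ CARD('n)"
    using assms(2) by (subst content_cbox_cart) (auto simp: interval_ne_empty_cart)
  then have c: "emeasure lebesgue (cbox ?a ?b) = ennreal (l ^ CARD('n))"
    by (metis emeasure_eq_measure2 lmeasurable_cbox measure_completion fmeasurableD2 emeasure_eq_ennreal_measure sets_lborel borel_closed closed_cbox)
  have "negligible (cbox ?a ?b - box ?a ?b)" by (rule negligible_frontier_interval)
  then have "negligible (Q - box ?a ?b)" using sub by (elim negligible_subset) auto
  then have neg: "Q - box ?a ?b \<in> null_sets lebesgue" by (simp add: negligible_iff_null_sets)
  have Qe: "Q = box ?a ?b \<union> (Q - box ?a ?b)" using sub by auto
  show Q: "Q \<in> sets lebesgue"
    by (subst Qe) (intro sets.Un null_setsD2[OF neg], simp)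
  have neg2: "cbox ?a ?b - Q \<in> null_sets lebesgue"
    using negligible_subset[OF \<open>negligible (cbox ?a ?b - box ?a ?b)\<close>, of "cbox ?a ?b - Q"] sub
    by (auto simp: negligible_iff_null_sets)
  have "emeasure lebesgue Q = emeasure lebesgue (Q \<union> (cbox ?a ?b - Q))"
    using emeasure_Un_null_set[OF Q neg2] by simp
  also have "Q \<union> (cbox ?a ?b - Q) = cbox ?a ?b" using sub by auto
  finally show "emeasure lebesgue Q = ennreal (l ^ CARD('n))" using c by simp
qed

lemma cubes_measure:
  assumes "Q \<in> cubes"
  shows "Q \<in> sets lebesgue" "0 < emeasure lebesgue Q" "emeasure lebesgue Q < top"
proof -
  obtain I a l where "Q = {x. \<forall>i. x $ i \<in> I i}" "0 < l" "\<And>i. {a i<..<a i + l} \<subseteq> I i \<and> I i \<subseteq> {a i..a i + l}"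
    using assms unfolding cubes_def by blast
  from cube_box[OF this] \<open>0 < l\<close> show "Q \<in> sets lebesgue" "0 < emeasure lebesgue Q" "emeasure lebesgue Q < top"
    by auto
qed

text \<open>\<open>\<int>\<close> and \<open>\<int> - c\<close> are at distance 1/3, so a shorter interval avoids one of them.\<close>

lemma one_third_trick:
  fixes u v c :: real
  assumes "v - u < 1 / 3" "c = 1 / 3 \<or> c = 2 / 3"
  shows "(\<forall>x\<in>{u..v}. \<lfloor>x\<rfloor> = \<lfloor>u\<rfloor>) \<or> (\<forall>x\<in>{u..v}. \<lfloor>x + c\<rfloor> = \<lfloor>u + c\<rfloor>)"
proof (rule ccontr)
  assume "\<not> ?thesis"
  then obtain x y where x: "u \<le> x" "x \<le> v" "\<lfloor>x\<rfloor> \<noteq> \<lfloor>u\<rfloor>" and y: "u \<le> y" "y \<le> v" "\<lfloor>y + c\<rfloor> \<noteq> \<lfloor>u + c\<rfloor>"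
    by auto
  define n1 n2 where "n1 = \<lfloor>x\<rfloor>" "n2 = \<lfloor>y + c\<rfloor>"
  have 1: "u < of_int n1" "of_int n1 \<le> v"
    using x floor_mono[of u x] by (auto simp: n1_n2_def) linarith+
  have 2: "u + c < of_int n2" "of_int n2 \<le> v + c"
    using y floor_mono[of "u + c" "y + c"] by (auto simp: n1_n2_def) linarith+
  have "of_int (n2 - n1) - c < 1 / 3" "c - of_int (n2 - n1) < 1 / 3" using 1 2 assms(1) by auto
  then have "0 < real_of_int (n2 - n1)" "real_of_int (n2 - n1) < 1" using assms(2) by auto
  then show False by simp
qed

lemma cube_grid_cover:
  fixes Q :: "(real^'n) set"
  assumes "Q \<in> cubes"
  obtains t Q' where "Q' \<in> grid t" "Q \<subseteq> Q'" "emeasure lebesgue Q' \<le> ennreal (6 ^ CARD('n)) * emeasure lebesgue Q"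
proof -
  obtain I a l where Q: "Q = {x. \<forall>i. x $ i \<in> I i}" "0 < l" "\<And>i. {a i<..<a i + l} \<subseteq> I i \<and> I i \<subseteq> {a i..a i + l}"
    using assms unfolding cubes_def by blast
  \<comment> \<open>The finest level at which the scaled side is still below 1/3, so that 2 powi k *
    l < 1/3 <= 2 powi (k + 1) * l. The second inequality limits the side of the covering cube to 6
    l.\<close>
  define k where "k = \<lceil>log 2 (1 / (3 * l))\<rceil> - 1"
  have "2 powr real_of_int k < 2 powr log 2 (1 / (3 * l))" unfolding k_def by (intro powr_less_mono) linarith+
  also have "\<dots> = 1 / (3 * l)" using Q(2) by simp
  finally have k1: "2 powi k * l < 1 / 3" using Q(2) by (simp add: powr_real_of_int' field_simps)
  have "1 / (3 * l) = 2 powr log 2 (1 / (3 * l))" using Q(2) by simp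
  also have "\<dots> \<le> 2 powr real_of_int (k + 1)" unfolding k_def by (intro powr_mono) auto
  also have "\<dots> = 2 * 2 powi k" by (simp add: powr_add powr_real_of_int')
  finally have k2: "1 / 2 powi k \<le> 6 * l" using Q(2) by (simp add: field_simps)
  have "\<exists>t m. \<forall>x\<in>{a i..a i + l}. \<lfloor>2 powi k * x + grid_shift t k\<rfloor> = m" for i
  proof -
    let ?u = "2 powi k * a i" and ?v = "2 powi k * (a i + l)"
    define c where "c = grid_shift True k"
    have "?v - ?u < 1 / 3" using k1 by (simp add: algebra_simps)
    moreover have "c = 1 / 3 \<or> c = 2 / 3" by (simp add: c_def grid_shift_def)
    ultimately have "(\<forall>x\<in>{?u..?v}. \<lfloor>x\<rfloor> = \<lfloor>?u\<rfloor>) \<or> (\<forall>x\<in>{?u..?v}. \<lfloor>x + c\<rfloor> = \<lfloor>?u + c\<rfloor>)"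
      by (rule one_third_trick)
    moreover have im: "2 powi k * x \<in> {?u..?v}" if "x \<in> {a i..a i + l}" for x
      using that by (auto intro!: mult_left_mono)
    ultimately show ?thesis
    proof (elim disjE)
      assume *: "\<forall>x\<in>{?u..?v}. \<lfloor>x\<rfloor> = \<lfloor>?u\<rfloor>"
      have "\<lfloor>2 powi k * x + grid_shift False k\<rfloor> = \<lfloor>?u\<rfloor>" if "x \<in> {a i..a i + l}" for x
        using bspec[OF * im[OF that]] by (simp add: grid_shift_def)
      then show ?thesis by (intro exI[of _ False] exI[of _ "\<lfloor>?u\<rfloor>"] ballI)
    next
      assume *: "\<forall>x\<in>{?u..?v}. \<lfloor>x + c\<rfloor> = \<lfloor>?u + c\<rfloor>"
      have "\<lfloor>2 powi k * x + grid_shift True k\<rfloor> = \<lfloor>?u + c\<rfloor>" if "x \<in> {a i..a i + l}" for x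
        using bspec[OF * im[OF that]] by (simp only: c_def)
      then show ?thesis by (intro exI[of _ True] exI[of _ "\<lfloor>?u + c\<rfloor>"] ballI)
    qed
  qed
  then obtain t m where tm: "\<And>i x. x \<in> {a i..a i + l} \<Longrightarrow> \<lfloor>2 powi k * x + grid_shift (t i) k\<rfloor> = m i"
    by metis
  define Q' where "Q' = grid_cube t k m"
  have grid: "Q' \<in> grid t" by (auto simp: Q'_def grid_def)
  have sub: "Q \<subseteq> Q'"
    using Q(3) tm unfolding Q(1) Q'_def grid_cube_def by blast
  define l' :: real where "l' = 1 / 2 powi k"
  have l': "0 < l'" "l' \<le> 6 * l" using k2 by (auto simp: l'_def)
  obtain a' where "Q' = {x. \<forall>i. x $ i \<in> {a' i..<a' i + l'}}"
    using grid_cube_box[OF l'_def, of t m] unfolding Q'_def by blast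
  then have "emeasure lebesgue Q' = ennreal (l' ^ CARD('n))"
    by (rule cube_box(2)[OF _ l'(1)]) auto
  also have "\<dots> \<le> ennreal ((6 * l) ^ CARD('n))"
    using l' by (intro ennreal_leI power_mono) auto
  also have "\<dots> = ennreal (6 ^ CARD('n)) * emeasure lebesgue Q"
    using Q(2) by (simp add: cube_box(2)[OF Q] power_mult_distrib ennreal_mult)
  finally show ?thesis using grid sub by (intro that[of Q' t])
qed

section \<open>Weighted laminar families from operator weights\<close>

lemma stopping_constant_ge_one:
  fixes d \<gamma> p :: real
  assumes "1 \<le> d" "1 \<le> \<gamma>" "1 < p"
  shows "1 \<le> d\<^sup>2 * (4 * \<gamma> powr p * d) powr (1 / p)"
proof -
  have "1 \<le> \<gamma> powr p" using assms by (simp add: ge_one_powr_ge_zero)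
  then have "1 * 1 * 1 \<le> 4 * \<gamma> powr p * d" using assms by (intro mult_mono) auto
  then have "1 \<le> (4 * \<gamma> powr p * d) powr (1 / p)" using assms by (intro ge_one_powr_ge_zero) auto
  moreover have "1 \<le> d\<^sup>2" using assms by simp
  ultimately show ?thesis using mult_mono[of 1 "d\<^sup>2" 1] by fastforce
qed

text \<open>Complex matrices become self-adjoint operators on a real Euclidean space, with P and J
  inverse to each other at every point. \<open>opn\<close> enters only as an upper bound for the
  norm of \<open>P x\<close> after \<open>J y\<close>, and its measurability is not assumed.\<close>

locale operator_weight =
  fixes M :: "'a measure" and P J :: "'a \<Rightarrow> 'v::euclidean_space \<Rightarrow> 'v" and R RI :: "'a set \<Rightarrow> 'v \<Rightarrow> 'v"
    and \<Q> :: "'a set set" and opn :: "'a \<Rightarrow> 'a \<Rightarrow> real" and p p' \<alpha> \<gamma> :: real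
  assumes p: "1 < p" and p'_def: "p' = p / (p - 1)" and \<alpha>: "0 < \<alpha>" and \<gamma>: "1 \<le> \<gamma>"
    and linP: "linear (P x)" and linJ: "linear (J x)"
    and symP: "P x u \<bullet> v = u \<bullet> P x v" and symJ: "J x u \<bullet> v = u \<bullet> J x v"
    and JP: "J x (P x v) = v" and PJ: "P x (J x v) = v"
    and P_meas [measurable]: "(\<lambda>x. P x v) \<in> borel_measurable M"
    and J_meas [measurable]: "(\<lambda>x. J x v) \<in> borel_measurable M"
    and \<Q>_ne: "\<Q> \<noteq> {}" and \<Q>_sets: "Q \<in> \<Q> \<Longrightarrow> Q \<in> sets M"
    and \<Q>_pos: "Q \<in> \<Q> \<Longrightarrow> 0 < emeasure M Q" "Q \<in> \<Q> \<Longrightarrow> emeasure M Q < top"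
    and linR: "Q \<in> \<Q> \<Longrightarrow> linear (R Q)" and linRI: "Q \<in> \<Q> \<Longrightarrow> linear (RI Q)"
    and symR: "Q \<in> \<Q> \<Longrightarrow> R Q u \<bullet> v = u \<bullet> R Q v"
    and R_RI: "Q \<in> \<Q> \<Longrightarrow> R Q (RI Q v) = v" and RI_R: "Q \<in> \<Q> \<Longrightarrow> RI Q (R Q v) = v"
    and red_le: "Q \<in> \<Q> \<Longrightarrow> (\<integral>\<^sup>+x\<in>Q. ennreal (norm (P x e) powr p) \<partial>M) \<le> ennreal (norm (R Q e) powr p) * emeasure M Q"
    and red_ge: "Q \<in> \<Q> \<Longrightarrow> ennreal (norm (R Q e) powr p) * emeasure M Q \<le> ennreal (\<gamma> powr p) * (\<integral>\<^sup>+x\<in>Q. ennreal (norm (P x e) powr p) \<partial>M)"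
    and opn: "0 \<le> opn x y" "norm (P x (J y v)) \<le> opn x y * norm v"
    and Ap: "Q \<in> \<Q> \<Longrightarrow> average M Q (\<lambda>x. ennpowr (average M Q (\<lambda>y. ennreal (opn x y powr p'))) (p / p')) \<le> ennreal \<alpha>"
begin

lemma p': "1 < p'" "1 / p + 1 / p' = 1" "p / p' = p - 1" "p' / p = p' - 1" "(p' - 1) * p = p'" "p' = p / (p - 1)"
  using p by (auto simp: p'_def field_simps)

definition N :: "'a set \<Rightarrow> 'v \<Rightarrow> ennreal" where
  "N X v = (\<integral>\<^sup>+y\<in>X. ennreal (norm (J y v) powr p') \<partial>M)"

lemma emeasure_real:
  assumes "Q \<in> \<Q>"
  obtains m where "emeasure M Q = ennreal m" "0 < m"
  using \<Q>_pos[OF assms] by (cases "emeasure M Q") auto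

lemma symRI: "Q \<in> \<Q> \<Longrightarrow> RI Q u \<bullet> v = u \<bullet> RI Q v"
  by (metis R_RI symR)

text \<open>\<open>J y\<close> after \<open>P x\<close> is the adjoint of \<open>P x\<close> after
  \<open>J y\<close> and so has the same norm; the proof tests it on its own value.\<close>

lemma opn_dual: "norm (J y (P x v)) \<le> opn x y * norm v"
proof -
  let ?w = "J y (P x v)"
  have "norm ?w * norm ?w = ?w \<bullet> ?w" by (simp flip: power2_norm_eq_inner power2_eq_square)
  also have "\<dots> = P x (J y ?w) \<bullet> v" by (simp add: symP symJ)
  also have "\<dots> \<le> norm (P x (J y ?w)) * norm v" by (rule norm_cauchy_schwarz)
  also have "\<dots> \<le> (opn x y * norm ?w) * norm v" by (intro mult_right_mono opn) auto
  finally have "norm ?w * norm ?w \<le> norm ?w * (opn x y * norm v)" by (simp add: mult_ac)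
  then show ?thesis using opn(1)[of x y] by (cases "?w = 0") auto
qed

lemma N_le_opn:
  assumes "Q \<in> \<Q>"
  shows "N Q (P x v) \<le> ennreal (norm v powr p') * (\<integral>\<^sup>+y\<in>Q. ennreal (opn x y powr p') \<partial>M)"
proof (cases "v = 0")
  case True
  have "P x 0 = 0" "J y 0 = 0" for y using linP linJ by (auto simp: linear_0)
  then show ?thesis using True by (simp add: N_def)
next
  case False
  define c where "c = norm v powr p'"
  have c: "0 < c" using False by (simp add: c_def)
  \<comment> \<open>The constant is moved across the integral of the measurable left integrand, and
    only then compared with the integral of \<open>opn\<close>, from which it could not be extracted
    without measurability.\<close>
  have "N Q (P x v) = (\<integral>\<^sup>+y. ennreal c * (ennreal (1 / c) * (ennreal (norm (J y (P x v)) powr p') * indicator Q y)) \<partial>M)"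
    unfolding N_def using c by (simp add: ennreal_mult[symmetric] flip: mult.assoc)
  also have "\<dots> = ennreal c * (\<integral>\<^sup>+y. ennreal (1 / c) * (ennreal (norm (J y (P x v)) powr p') * indicator Q y) \<partial>M)"
    using assms \<Q>_sets by (intro nn_integral_cmult) (auto simp: powr_def)
  also have "\<dots> \<le> ennreal c * (\<integral>\<^sup>+y. ennreal (opn x y powr p') * indicator Q y \<partial>M)"
  proof (intro mult_left_mono nn_integral_mono)
    fix y
    have "norm (J y (P x v)) powr p' \<le> (opn x y * norm v) powr p'"
      using p' opn_dual by (intro powr_mono2) auto
    also have "\<dots> = opn x y powr p' * c" using opn(1) by (simp add: powr_mult c_def)
    finally have "1 / c * norm (J y (P x v)) powr p' \<le> opn x y powr p'" using c by (simp add: field_simps)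
    then have "ennreal (1 / c) * ennreal (norm (J y (P x v)) powr p') \<le> ennreal (opn x y powr p')"
      using c by (simp flip: ennreal_mult)
    then show "ennreal (1 / c) * (ennreal (norm (J y (P x v)) powr p') * indicator Q y) \<le> ennreal (opn x y powr p') * indicator Q y"
      by (simp add: mult_right_mono flip: mult.assoc)
  qed simp
  finally show ?thesis by (simp add: c_def)
qed

text \<open>The Muckenhoupt bound forces a finite inner average at some x in Q, and every v has the
  form \<open>P x (J x v)\<close> for that x.\<close>

lemma N_finite:
  assumes Q: "Q \<in> \<Q>"
  shows "N Q v < top"
proof -
  obtain m where m: "emeasure M Q = ennreal m" "0 < m" using emeasure_real[OF Q] .
  have "\<exists>x\<in>Q. average M Q (\<lambda>y. ennreal (opn x y powr p')) < top"
  proof (rule ccontr)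
    assume neg: "\<not> (\<exists>x\<in>Q. average M Q (\<lambda>y. ennreal (opn x y powr p')) < top)"
    then have *: "average M Q (\<lambda>y. ennreal (opn x y powr p')) = top" if "x \<in> Q" for x
      using that neg less_top by blast
    have "(\<integral>\<^sup>+x\<in>Q. top \<partial>M) \<le> (\<integral>\<^sup>+x\<in>Q. ennpowr (average M Q (\<lambda>y. ennreal (opn x y powr p'))) (p / p') \<partial>M)"
      using * by (intro nn_set_integral_mono) auto
    moreover have "(\<integral>\<^sup>+x\<in>Q. top \<partial>M) = top"
      using m \<Q>_sets[OF Q] by (subst nn_integral_cmult_indicator) (auto simp: ennreal_top_mult)
    ultimately have "average M Q (\<lambda>x. ennpowr (average M Q (\<lambda>y. ennreal (opn x y powr p'))) (p / p')) = top"
      by (subst average_def) (use m in \<open>simp add: top_unique ennreal_top_divide\<close>)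
    then show False using Ap[OF Q] by (simp add: top_unique)
  qed
  then obtain x where x: "average M Q (\<lambda>y. ennreal (opn x y powr p')) < top" by blast
  then have "(\<integral>\<^sup>+y\<in>Q. ennreal (opn x y powr p') \<partial>M) < top"
    unfolding average_times_emeasure[OF m, symmetric] by (simp add: ennreal_mult_less_top)
  then have "ennreal (norm (J x v) powr p') * (\<integral>\<^sup>+y\<in>Q. ennreal (opn x y powr p') \<partial>M) < top"
    by (simp add: ennreal_mult_less_top)
  moreover have "N Q v \<le> ennreal (norm (J x v) powr p') * (\<integral>\<^sup>+y\<in>Q. ennreal (opn x y powr p') \<partial>M)"
    using N_le_opn[OF Q, of x "J x v"] by (simp add: PJ)
  ultimately show ?thesis by (rule le_less_trans[rotated])
qed

lemma norm_powr_meas [measurable]: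
  "(\<lambda>x. ennreal (norm (P x v) powr s)) \<in> borel_measurable M" "(\<lambda>x. ennreal (norm (J x v) powr s)) \<in> borel_measurable M"
  unfolding powr_def by measurable

lemma ennpowr_norm_powr: "ennpowr (ennreal (norm u powr s)) t = ennreal (norm u powr (s * t))"
  by (simp add: ennpowr_ennreal powr_powr)

lemma dual_functional_bound:
  assumes Q: "Q \<in> \<Q>"
  shows "(\<integral>\<^sup>+y\<in>Q. ennreal (norm (J y v) powr (p' - 1) * norm (J y u)) \<partial>M) \<le> ennpowr (N Q v) (1 / p) * ennpowr (N Q u) (1 / p')"
proof -
  have "ennreal (norm (J y v) powr (p' - 1) * norm (J y u)) =
     ennpowr (ennreal (norm (J y v) powr p')) (1 / p) * ennpowr (ennreal (norm (J y u) powr p')) (1 / p')" for y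
    using p' p by (simp add: ennpowr_norm_powr ennreal_mult)
  then show ?thesis
    unfolding N_def using p p' \<Q>_sets[OF Q] by (simp only:) (intro nn_set_integral_Hoelder, auto)
qed

text \<open>l is the derivative of \<open>N Q\<close> at v divided by p', hence a norming functional of v for the norm
  \<open>N Q\<close> to the power 1/p'. It makes a reducing operator of the dual weight unnecessary.\<close>

lemma dual_functional_exists:
  assumes Q: "Q \<in> \<Q>"
  obtains l where "N Q v = ennreal (l \<bullet> v)"
    "\<And>u. ennreal \<bar>l \<bullet> u\<bar> \<le> ennpowr (N Q v) (1 / p) * ennpowr (N Q u) (1 / p')"
proof -
  note [measurable] = \<Q>_sets[OF Q]
  \<comment> \<open>The gradient in v of |J y v| to the power p', divided by p'; \<open>J y\<close>
    occurs twice because it is self-adjoint. Where \<open>J y v\<close> = 0 the vector vanishes,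
    whatever the sign of p' - 2.\<close>
  define z where "z y = indicat_real Q y *\<^sub>R (norm (J y v) powr (p' - 2) *\<^sub>R J y (J y v))" for y
  have [measurable]: "(\<lambda>y. J y (J y v)) \<in> borel_measurable M"
  proof (subst borel_measurable_euclidean_space, intro ballI)
    fix b :: 'v assume "b \<in> Basis"
    have "(\<lambda>y. J y (J y v) \<bullet> b) = (\<lambda>y. J y v \<bullet> J y b)" by (simp add: symJ)
    then show "(\<lambda>y. J y (J y v) \<bullet> b) \<in> borel_measurable M" by simp
  qed
  have [measurable]: "(\<lambda>y. norm (J y v) powr (p' - 2)) \<in> borel_measurable M"
    unfolding powr_def by measurable
  have zm[measurable]: "z \<in> borel_measurable M" unfolding z_def by measurable
  have zu: "\<bar>z y \<bullet> u\<bar> \<le> indicat_real Q y * (norm (J y v) powr (p' - 1) * norm (J y u))" for y u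
  proof -
    have "\<bar>z y \<bullet> u\<bar> = indicat_real Q y * (norm (J y v) powr (p' - 2) * \<bar>J y v \<bullet> J y u\<bar>)"
      by (simp add: z_def symJ abs_mult)
    also have "\<dots> \<le> indicat_real Q y * (norm (J y v) powr (p' - 2) * (norm (J y v) * norm (J y u)))"
      by (intro mult_left_mono Cauchy_Schwarz_ineq2) auto
    also have "norm (J y v) powr (p' - 2) * (norm (J y v) * norm (J y u)) = norm (J y v) powr (p' - 1) * norm (J y u)"
    proof (cases "J y v = 0")
      case False
      then have "norm (J y v) powr (p' - 2) * norm (J y v) = norm (J y v) powr (p' - 2) * norm (J y v) powr 1"
        by simp
      also have "\<dots> = norm (J y v) powr (p' - 2 + 1)" by (simp only: powr_add)
      finally show ?thesis by (simp flip: mult.assoc)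
    qed simp
    finally show ?thesis .
  qed
  have bound: "(\<integral>\<^sup>+y. ennreal \<bar>z y \<bullet> u\<bar> \<partial>M) \<le> ennpowr (N Q v) (1 / p) * ennpowr (N Q u) (1 / p')" for u
  proof -
    have "(\<integral>\<^sup>+y. ennreal \<bar>z y \<bullet> u\<bar> \<partial>M) \<le> (\<integral>\<^sup>+y\<in>Q. ennreal (norm (J y v) powr (p' - 1) * norm (J y u)) \<partial>M)"
    proof (intro nn_integral_mono)
      fix y
      show "ennreal \<bar>z y \<bullet> u\<bar> \<le> ennreal (norm (J y v) powr (p' - 1) * norm (J y u)) * indicator Q y"
        using ennreal_leI[OF zu[of y u]] by (cases "y \<in> Q") auto
    qed
    also note dual_functional_bound[OF Q]
    finally show ?thesis .
  qed
  have int: "integrable M z"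
  proof (rule integrableI_bounded)
    have "(\<integral>\<^sup>+y. ennreal (norm (z y)) \<partial>M) \<le> (\<integral>\<^sup>+y. (\<Sum>b\<in>Basis. ennreal \<bar>z y \<bullet> b\<bar>) \<partial>M)"
      by (intro nn_integral_mono) (simp add: norm_le_l1 ennreal_leI)
    also have "\<dots> = (\<Sum>b\<in>Basis. \<integral>\<^sup>+y. ennreal \<bar>z y \<bullet> b\<bar> \<partial>M)"
      by (intro nn_integral_sum) auto
    also have "\<dots> \<le> (\<Sum>b\<in>Basis. ennpowr (N Q v) (1 / p) * ennpowr (N Q b) (1 / p'))"
      by (intro sum_mono bound)
    also have "\<dots> < top"
      using N_finite[OF Q] by (auto simp: less_top[symmetric] ennreal_mult_eq_top_iff ennpowr_eq_top_iff)
    finally show "(\<integral>\<^sup>+y. ennreal (norm (z y)) \<partial>M) < \<infinity>" by simp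
  qed simp
  define l where "l = (\<integral>y. z y \<partial>M)"
  have lu: "l \<bullet> u = (\<integral>y. z y \<bullet> u \<partial>M)" for u
    unfolding l_def using int by (intro integral_inner_left[symmetric]) auto
  show ?thesis
  proof (rule that[of l])
    have zv: "z y \<bullet> v = indicat_real Q y * norm (J y v) powr p'" for y
    proof -
      have "z y \<bullet> v = indicat_real Q y * (norm (J y v) powr (p' - 2) * (norm (J y v))\<^sup>2)"
        by (simp add: z_def symJ power2_norm_eq_inner)
      also have "norm (J y v) powr (p' - 2) * (norm (J y v))\<^sup>2 = norm (J y v) powr p'"
      proof (cases "J y v = 0")
        case False
        then have "norm (J y v) powr (p' - 2) * (norm (J y v)) powr 2 = norm (J y v) powr (p' - 2 + 2)"
          by (simp only: powr_add)
        then show ?thesis using False by simp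
      qed simp
      finally show ?thesis .
    qed
    have "ennreal (l \<bullet> v) = (\<integral>\<^sup>+y. ennreal (z y \<bullet> v) \<partial>M)"
      unfolding lu using int by (intro nn_integral_eq_integral[symmetric] integrable_inner_left) (auto simp: zv)
    also have "\<dots> = N Q v"
      unfolding N_def by (intro nn_integral_cong) (simp add: zv indicator_def)
    finally show "N Q v = ennreal (l \<bullet> v)" by simp
    fix u
    have "ennreal \<bar>l \<bullet> u\<bar> \<le> (\<integral>\<^sup>+y. ennreal \<bar>z y \<bullet> u\<bar> \<partial>M)"
      unfolding lu using int integral_norm_bound_ennreal[of M "\<lambda>y. z y \<bullet> u"] by simp
    then show "ennreal \<bar>l \<bullet> u\<bar> \<le> ennpowr (N Q v) (1 / p) * ennpowr (N Q u) (1 / p')"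
      using bound by (rule order_trans)
  qed
qed

text \<open>Let l be the norming functional of v = \<open>R Q b\<close> and n = l . v. Bounding the
  square of |P x l| by the functional at \<open>P x (P x l)\<close> gives |P x l|^p <= n times the
  kernel integral to the power p / p'. On the other side n = \<open>R Q l\<close> . b <= |R Q l|,
  and red_ge returns to the integral of |P l|^p. So n^p is bounded by a multiple of n, and taking
  the root of n^(p - 1) produces the exponent 1 / (p - 1).\<close>

lemma N_reducing_bound:
  assumes Q: "Q \<in> \<Q>" and b: "norm b \<le> 1"
  shows "N Q (R Q b) \<le> ennreal (\<gamma> powr p' * \<alpha> powr (1 / (p - 1))) * emeasure M Q"
proof -
  note [measurable] = \<Q>_sets[OF Q]
  obtain m where m: "emeasure M Q = ennreal m" "0 < m" using emeasure_real[OF Q] .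
  define v where "v = R Q b"
  obtain l where l: "N Q v = ennreal (l \<bullet> v)"
    "\<And>u. ennreal \<bar>l \<bullet> u\<bar> \<le> ennpowr (N Q v) (1 / p) * ennpowr (N Q u) (1 / p')"
    using dual_functional_exists[OF Q] by metis
  show ?thesis
  proof (cases "N Q v = 0")
    case False
    define n where "n = l \<bullet> v"
    have n: "N Q v = ennreal n" "0 < n"
    proof -
      show "N Q v = ennreal n" using l(1) by (simp only: n_def)
      then show "0 < n" using False ennreal_neg[of n] by (cases "n \<le> 0") auto
    qed
    define g where "g x = average M Q (\<lambda>y. ennreal (opn x y powr p'))" for x
    define c where "c = n * m powr (p - 1)"
    have c: "0 < c" using n m by (simp add: c_def)
    have pt: "ennreal (norm (P x l) powr p) \<le> ennreal c * ennpowr (g x) (p / p')" for x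
    proof (cases "P x l = 0")
      case False
      have "norm (P x l) * norm (P x l) = l \<bullet> P x (P x l)"
        by (simp add: symP[symmetric] flip: power2_norm_eq_inner power2_eq_square)
      then have "ennreal (norm (P x l)) * ennreal (norm (P x l)) = ennreal \<bar>l \<bullet> P x (P x l)\<bar>"
        by (metis abs_of_nonneg ennreal_mult' mult_nonneg_nonneg norm_ge_zero)
      also have "\<dots> \<le> ennpowr (ennreal n) (1 / p) * ennpowr (N Q (P x (P x l))) (1 / p')"
        using l(2)[of "P x (P x l)"] n by simp
      also have "\<dots> \<le> ennpowr (ennreal n) (1 / p) * ennpowr (ennreal (norm (P x l) powr p') * (\<integral>\<^sup>+y\<in>Q. ennreal (opn x y powr p') \<partial>M)) (1 / p')"
        using p'(1) by (intro mult_left_mono ennpowr_mono N_le_opn Q) auto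
      also have "(\<integral>\<^sup>+y\<in>Q. ennreal (opn x y powr p') \<partial>M) = g x * ennreal m"
        unfolding g_def by (rule average_times_emeasure[OF m, symmetric])
      also have "ennpowr (ennreal n) (1 / p) * ennpowr (ennreal (norm (P x l) powr p') * (g x * ennreal m)) (1 / p')
         = ennreal (norm (P x l)) * (ennpowr (ennreal n) (1 / p) * ennpowr (g x * ennreal m) (1 / p'))"
        using p'(1) by (simp add: ennpowr_mult ennpowr_norm_powr mult_ac)
      finally have "ennreal (norm (P x l)) \<le> ennpowr (ennreal n) (1 / p) * ennpowr (g x * ennreal m) (1 / p')"
        using False by (subst (asm) ennreal_mult_le_mult_iff) auto
      then have "ennpowr (ennreal (norm (P x l))) p \<le> ennpowr (ennpowr (ennreal n) (1 / p) * ennpowr (g x * ennreal m) (1 / p')) p"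
        using p by (intro ennpowr_mono) auto
      also have "\<dots> = ennreal n * (ennpowr (g x) (p / p') * ennpowr (ennreal m) (p / p'))"
        using p p' by (simp add: ennpowr_mult ennpowr_ennpowr)
      also have "\<dots> = ennreal c * ennpowr (g x) (p / p')"
        using n m p'(3) by (simp add: c_def ennpowr_ennreal ennreal_mult mult_ac)
      finally show ?thesis by (simp add: ennpowr_ennreal)
    qed simp
    \<comment> \<open>Dividing by c first keeps the constant next to an integrand known to be
      measurable, as g need not be.\<close>
    have "(\<integral>\<^sup>+x\<in>Q. ennreal (norm (P x l) powr p) \<partial>M) = (\<integral>\<^sup>+x. ennreal c * (ennreal (1 / c) * ennreal (norm (P x l) powr p) * indicator Q x) \<partial>M)"
      using c by (simp add: ennreal_mult[symmetric] flip: mult.assoc)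
    also have "\<dots> = ennreal c * (\<integral>\<^sup>+x\<in>Q. ennreal (1 / c) * ennreal (norm (P x l) powr p) \<partial>M)"
      by (intro nn_integral_cmult) auto
    also have "\<dots> \<le> ennreal c * (\<integral>\<^sup>+x\<in>Q. ennpowr (g x) (p / p') \<partial>M)"
    proof (intro mult_left_mono nn_set_integral_mono)
      fix x
      have "ennreal (1 / c) * ennreal (norm (P x l) powr p) \<le> ennreal (1 / c) * (ennreal c * ennpowr (g x) (p / p'))"
        by (intro mult_left_mono pt) auto
      also have "\<dots> = ennpowr (g x) (p / p')" using c by (simp add: ennreal_mult[symmetric] flip: mult.assoc)
      finally show "ennreal (1 / c) * ennreal (norm (P x l) powr p) \<le> ennpowr (g x) (p / p')" .
    qed auto
    also have "(\<integral>\<^sup>+x\<in>Q. ennpowr (g x) (p / p') \<partial>M) \<le> ennreal \<alpha> * ennreal m"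
    proof -
      have "average M Q (\<lambda>x. ennpowr (g x) (p / p')) * ennreal m \<le> ennreal \<alpha> * ennreal m"
        unfolding g_def by (intro mult_right_mono Ap Q) auto
      then show ?thesis unfolding average_times_emeasure[OF m] .
    qed
    finally have 1: "(\<integral>\<^sup>+x\<in>Q. ennreal (norm (P x l) powr p) \<partial>M) \<le> ennreal c * (ennreal \<alpha> * ennreal m)"
      by (simp add: mult_left_mono)
    have "n = R Q l \<bullet> b" by (simp add: n_def v_def symR[OF Q])
    also have "\<dots> \<le> norm (R Q l) * norm b" by (rule norm_cauchy_schwarz)
    also have "\<dots> \<le> norm (R Q l)" using b by (simp add: mult_left_le)
    finally have "n powr p \<le> norm (R Q l) powr p" using n p by (intro powr_mono2) auto
    then have "ennreal (n powr p) * ennreal m \<le> ennreal (norm (R Q l) powr p) * emeasure M Q"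
      using m by (intro mult_mono ennreal_leI) auto
    also have "\<dots> \<le> ennreal (\<gamma> powr p) * (\<integral>\<^sup>+x\<in>Q. ennreal (norm (P x l) powr p) \<partial>M)" by (rule red_ge[OF Q])
    also have "\<dots> \<le> ennreal (\<gamma> powr p) * (ennreal c * (ennreal \<alpha> * ennreal m))"
      by (intro mult_left_mono 1) auto
    finally have "n powr p * m \<le> \<gamma> powr p * (c * (\<alpha> * m))"
      using n m c \<alpha> by (simp flip: ennreal_mult)
    then have "m * n powr p \<le> m * (\<gamma> powr p * (c * \<alpha>))" by (simp only: mult_ac)
    then have "n powr p \<le> \<gamma> powr p * (c * \<alpha>)" using m by (simp only: mult_le_cancel_left_pos)
    moreover have "n powr p = n * n powr (p - 1)" using n by (simp add: powr_diff)
    ultimately have "n * n powr (p - 1) \<le> n * (\<gamma> powr p * \<alpha> * m powr (p - 1))"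
      by (simp add: c_def mult_ac)
    then have "n powr (p - 1) \<le> \<gamma> powr p * \<alpha> * m powr (p - 1)" using n by simp
    then have "(n powr (p - 1)) powr (1 / (p - 1)) \<le> (\<gamma> powr p * \<alpha> * m powr (p - 1)) powr (1 / (p - 1))"
      using p by (intro powr_mono2) auto
    then have "n \<le> \<gamma> powr p' * \<alpha> powr (1 / (p - 1)) * m"
      using n m \<alpha> p by (simp add: powr_powr powr_mult p'_def)
    then show ?thesis
      using n m \<alpha> by (simp add: v_def ennreal_leI flip: ennreal_mult)
  qed (simp add: v_def)
qed

section \<open>Scalar weights of the cubes, their mass and their decay\<close>

definition D :: real where "D = real DIM('v)"

text \<open>A substitute for the operator norm of \<open>J y\<close> after \<open>R Q\<close>,
  equivalent up to a dimensional factor and visibly measurable.\<close>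

definition wt :: "'a set \<Rightarrow> 'a \<Rightarrow> ennreal" where
  "wt Q y = (if Q \<in> \<Q> then ennreal (\<Sum>b\<in>Basis. norm (J y (R Q b))) else 0)"

text \<open>A sum of powers in place of the power of a sum: its integrals are values of
  \<open>N\<close> at fixed vectors, so mass and decay can be estimated vector by vector.\<close>

definition \<sigma> :: "'a set \<Rightarrow> 'a \<Rightarrow> ennreal" where
  "\<sigma> Q y = (if Q \<in> \<Q> then ennreal (D powr p') * (\<Sum>b\<in>Basis. ennreal (norm (J y (R Q b)) powr p')) else 0)"

definition \<rho> :: "'a set \<Rightarrow> 'a set \<Rightarrow> ennreal" where
  "\<rho> X Q = ennreal (\<Sum>b\<in>Basis. norm (RI Q (R X b)))"

text \<open>One factor D counts the basis vectors, D to the power p' is the price of the sum of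
  powers, and the rest comes from \<open>N_reducing_bound\<close>.\<close>

definition A :: real where
  "A = D powr (p' + 1) * \<gamma> powr p' * \<alpha> powr (1 / (p - 1))"

text \<open>\<open>\<rho>\<close> is controlled by D squared entries; the remaining factor is the
  size of an entry from which \<open>red_ge\<close> yields an average of at least 4 D.\<close>

definition K :: real where "K = D\<^sup>2 * (4 * \<gamma> powr p * D) powr (1 / p)"

definition \<theta> :: real where "\<theta> = 2 powr (- (p / (p - 1))) / A"

lemma D: "1 \<le> D" by (simp add: D_def Suc_le_eq)

lemma A_pos: "0 < A" using D \<gamma> \<alpha> by (simp add: A_def)

lemma expand:
  assumes "linear (L :: 'v \<Rightarrow> 'v)"
  shows "norm (L z) \<le> norm z * (\<Sum>b\<in>Basis. norm (L b))"
proof -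
  have "L z = L (\<Sum>b\<in>Basis. (z \<bullet> b) *\<^sub>R b)" by (simp add: euclidean_representation)
  also have "\<dots> = (\<Sum>b\<in>Basis. (z \<bullet> b) *\<^sub>R L b)"
    using assms by (simp add: linear_sum linear_cmul)
  finally have "norm (L z) \<le> (\<Sum>b\<in>Basis. norm ((z \<bullet> b) *\<^sub>R L b))" by (simp only: norm_sum)
  also have "\<dots> \<le> (\<Sum>b\<in>Basis. norm z * norm (L b))"
    by (intro sum_mono) (auto intro!: mult_right_mono Basis_le_norm)
  finally show ?thesis by (simp add: sum_distrib_left)
qed

lemma wt_bound:
  assumes "Q \<in> \<Q>"
  shows "ennreal (norm (R Q f)) \<le> wt Q y * ennreal (norm (P y f))"
proof -
  have "norm (R Q f) \<le> (\<Sum>b\<in>Basis. \<bar>R Q f \<bullet> b\<bar>)" by (rule norm_le_l1)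
  also have "\<dots> \<le> (\<Sum>b\<in>Basis. norm (J y (R Q b)) * norm (P y f))"
  proof (rule sum_mono)
    fix b
    have "R Q f \<bullet> b = P y f \<bullet> J y (R Q b)" by (metis symJ JP symR assms)
    then show "\<bar>R Q f \<bullet> b\<bar> \<le> norm (J y (R Q b)) * norm (P y f)"
      by (metis Cauchy_Schwarz_ineq2 mult.commute)
  qed
  finally show ?thesis
    using assms by (simp add: wt_def sum_distrib_right ennreal_leI sum_nonneg flip: ennreal_mult)
qed

lemma wt_\<sigma>: "ennpowr (wt Q y) p' \<le> \<sigma> Q y"
proof (cases "Q \<in> \<Q>")
  case True
  have "wt Q y = (\<Sum>b\<in>Basis. ennreal (norm (J y (R Q b))))" using True by (simp add: wt_def)
  then have "ennpowr (wt Q y) p' \<le> ennreal (real (card (Basis :: 'v set)) powr p') * (\<Sum>b\<in>Basis. ennpowr (ennreal (norm (J y (R Q b)))) p')"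
    using ennpowr_sum_le[of "Basis :: 'v set" p' "\<lambda>b. ennreal (norm (J y (R Q b)))"] p' by simp
  then show ?thesis using True by (simp add: \<sigma>_def ennpowr_ennreal D_def)
qed (simp add: wt_def)

lemma \<sigma>_meas [measurable]: "\<sigma> Q \<in> borel_measurable M"
  unfolding \<sigma>_def by measurable

lemma wt_meas [measurable]: "wt Q \<in> borel_measurable M"
  unfolding wt_def by measurable

lemma \<sigma>_integral:
  assumes "Q \<in> \<Q>" "X \<in> sets M"
  shows "(\<integral>\<^sup>+y\<in>X. \<sigma> Q y \<partial>M) = ennreal (D powr p') * (\<Sum>b\<in>Basis. N X (R Q b))"
proof -
  note [measurable] = assms(2)
  have "(\<integral>\<^sup>+y\<in>X. \<sigma> Q y \<partial>M) = (\<integral>\<^sup>+y. ennreal (D powr p') * (\<Sum>b\<in>Basis. ennreal (norm (J y (R Q b)) powr p') * indicator X y) \<partial>M)"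
    unfolding \<sigma>_def by (simp only: assms(1) if_True sum_distrib_right mult.assoc)
  also have "\<dots> = ennreal (D powr p') * (\<integral>\<^sup>+y. (\<Sum>b\<in>Basis. ennreal (norm (J y (R Q b)) powr p') * indicator X y) \<partial>M)"
    by (intro nn_integral_cmult) measurable
  also have "\<dots> = ennreal (D powr p') * (\<Sum>b\<in>Basis. N X (R Q b))"
    unfolding N_def by (subst nn_integral_sum) measurable
  finally show ?thesis .
qed

lemma \<sigma>_total: 
  assumes Q: "Q \<in> \<Q>"
  shows "(\<integral>\<^sup>+y\<in>Q. \<sigma> Q y \<partial>M) \<le> ennreal A * emeasure M Q"
proof -
  have "(\<integral>\<^sup>+y\<in>Q. \<sigma> Q y \<partial>M) \<le> ennreal (D powr p') * (\<Sum>b\<in>(Basis :: 'v set). ennreal (\<gamma> powr p' * \<alpha> powr (1 / (p - 1))) * emeasure M Q)"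
    unfolding \<sigma>_integral[OF Q \<Q>_sets[OF Q]]
    by (intro mult_left_mono sum_mono N_reducing_bound Q) simp_all
  also have "\<dots> = ennreal (D powr p') * (ennreal D * (ennreal (\<gamma> powr p' * \<alpha> powr (1 / (p - 1))) * emeasure M Q))"
    by (simp add: D_def ennreal_of_nat_eq_real_of_nat)
  also have "\<dots> = ennreal A * emeasure M Q"
    using D by (simp add: A_def powr_add ennreal_mult mult_ac)
  finally show ?thesis .
qed

text \<open>The A-infinity property of the scalar weight |J v| to the power p', uniform in v. With v
  = \<open>R X z\<close>, choose e so that |R X e| = 1 and v . e = |z|. Then |z| <= |J y v| |P y e|
  at every y, and the average of |P e|^p over X is at most 1. Integrating over X - E, at least half
  of X, gives N (X - E) v >= (|z| / 2)^p' |X|, whereas N X v <= |z|^p' A |X|. The quotient is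
  \<open>\<theta>\<close>.\<close>

lemma N_lower:
  assumes X: "X \<in> \<Q>" and E: "E \<in> sets M" "E \<subseteq> X" "2 * emeasure M E \<le> emeasure M X"
  shows "ennreal \<theta> * N X v \<le> N (X - E) v"
proof (cases "v = 0")
  case True
  have "J y 0 = 0" for y using linJ by (auto simp: linear_0)
  then show ?thesis using True by (simp add: N_def)
next
  case False
  note [measurable] = \<Q>_sets[OF X] E(1)
  obtain m where m: "emeasure M X = ennreal m" "0 < m" using emeasure_real[OF X] .
  define z where "z = RI X v"
  have vz: "v = R X z" by (simp add: z_def R_RI[OF X])
  have z: "z \<noteq> 0" using False vz linear_0[OF linR[OF X]] by auto
  define e where "e = RI X ((1 / norm z) *\<^sub>R z)"
  have Re: "norm (R X e) = 1" using z by (simp add: e_def R_RI[OF X])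
  have "v \<bullet> e = z \<bullet> ((1 / norm z) *\<^sub>R z)" by (simp add: vz symR[OF X] e_def R_RI[OF X])
  also have "\<dots> = norm z" using z by (simp add: dot_square_norm power2_eq_square)
  finally have ve: "v \<bullet> e = norm z" .
  have pt: "norm z \<le> norm (J y v) * norm (P y e)" for y
  proof -
    have "norm z = J y v \<bullet> P y e" by (metis ve symP PJ)
    also have "\<dots> \<le> norm (J y v) * norm (P y e)" by (rule norm_cauchy_schwarz)
    finally show ?thesis .
  qed
  have half: "ennreal (m / 2) \<le> emeasure M (X - E)"
  proof -
    have "emeasure M E \<le> ennreal (m / 2)"
    proof (cases "emeasure M E")
      case (real r)
      then have "ennreal (2 * r) \<le> ennreal m" using E(3) m by (simp add: ennreal_mult)
      then show ?thesis using real m by (simp add: ennreal_leI)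
    qed (use E(3) m in \<open>auto simp: ennreal_mult_top top_unique\<close>)
    then have "ennreal m - ennreal (m / 2) \<le> ennreal m - emeasure M E" by (intro ennreal_minus_mono) auto
    also have "\<dots> = emeasure M (X - E)"
      using E m emeasure_mono[OF E(2), of M] by (subst emeasure_Diff) (auto simp: top_unique)
    finally show ?thesis using m by (simp add: ennreal_minus)
  qed
  have "ennreal (norm z * (m / 2)) = ennreal (norm z) * ennreal (m / 2)"
    using m by (intro ennreal_mult) auto
  also have "\<dots> \<le> ennreal (norm z) * emeasure M (X - E)"
    by (intro mult_left_mono half) auto
  also have "\<dots> = (\<integral>\<^sup>+y\<in>X - E. ennreal (norm z) \<partial>M)" by (simp add: nn_integral_cmult_indicator)
  also have "\<dots> \<le> (\<integral>\<^sup>+y\<in>X - E. ennpowr (ennreal (norm (J y v) powr p')) (1 / p') * ennpowr (ennreal (norm (P y e) powr p)) (1 / p) \<partial>M)"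
    using pt p p' by (intro nn_set_integral_mono) (auto simp: ennpowr_norm_powr ennreal_leI simp flip: ennreal_mult)
  also have "\<dots> \<le> ennpowr (N (X - E) v) (1 / p') * ennpowr (\<integral>\<^sup>+y\<in>X - E. ennreal (norm (P y e) powr p) \<partial>M) (1 / p)"
    unfolding N_def using p p' by (intro nn_set_integral_Hoelder) (auto simp: add.commute)
  also have "\<dots> \<le> ennpowr (N (X - E) v) (1 / p') * ennpowr (\<integral>\<^sup>+y\<in>X. ennreal (norm (P y e) powr p) \<partial>M) (1 / p)"
    using p by (intro mult_left_mono ennpowr_mono nn_set_integral_mono) auto
  also have "\<dots> \<le> ennpowr (N (X - E) v) (1 / p') * ennpowr (ennreal m) (1 / p)"
    using p red_le[OF X, of e] m Re by (intro mult_left_mono ennpowr_mono) auto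
  finally have "ennpowr (ennreal (norm z * (m / 2))) p' \<le> ennpowr (ennpowr (N (X - E) v) (1 / p') * ennpowr (ennreal m) (1 / p)) p'"
    using p' by (intro ennpowr_mono) auto
  also have "\<dots> = ennreal (m powr (p' - 1)) * N (X - E) v"
    using p' p m by (simp add: ennpowr_mult ennpowr_ennpowr ennpowr_ennreal powr_powr mult.commute)
  also have "ennpowr (ennreal (norm z * (m / 2))) p' = ennreal (m powr (p' - 1)) * ennreal ((norm z / 2) powr p' * m)"
  proof -
    have "(norm z * (m / 2)) powr p' = (norm z / 2) powr p' * m powr p'"
      using m by (simp flip: powr_mult)
    also have "m powr p' = m powr (p' - 1) * m" using m by (simp add: powr_diff)
    finally show ?thesis using m by (simp add: ennpowr_ennreal mult_ac flip: ennreal_mult)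
  qed
  finally have low: "ennreal ((norm z / 2) powr p' * m) \<le> N (X - E) v"
    using m by (subst (asm) ennreal_mult_le_mult_iff) auto
  have "N X v \<le> (\<integral>\<^sup>+y\<in>X. ennreal (norm z powr p') * \<sigma> X y \<partial>M)"
    unfolding N_def
  proof (intro nn_set_integral_mono)
    fix y
    have "linear (\<lambda>u. J y (R X u))"
      using linear_compose[OF linR[OF X] linJ] by (simp add: o_def)
    from expand[OF this, of z] have "ennreal (norm (J y v)) \<le> ennreal (norm z) * wt X y"
      using X by (simp add: wt_def vz ennreal_leI sum_nonneg flip: ennreal_mult)
    then have "ennpowr (ennreal (norm (J y v))) p' \<le> ennpowr (ennreal (norm z) * wt X y) p'"
      using p' by (intro ennpowr_mono) auto
    also have "\<dots> = ennreal (norm z powr p') * ennpowr (wt X y) p'"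
      using p' by (simp add: ennpowr_mult ennpowr_ennreal)
    also have "\<dots> \<le> ennreal (norm z powr p') * \<sigma> X y" by (intro mult_left_mono wt_\<sigma>) auto
    finally show "ennreal (norm (J y v) powr p') \<le> ennreal (norm z powr p') * \<sigma> X y"
      by (simp add: ennpowr_ennreal)
  qed simp
  also have "\<dots> = ennreal (norm z powr p') * (\<integral>\<^sup>+y\<in>X. \<sigma> X y \<partial>M)"
    by (simp add: mult.assoc nn_integral_cmult)
  also have "\<dots> \<le> ennreal (norm z powr p') * (ennreal A * ennreal m)"
    using \<sigma>_total[OF X] m by (intro mult_left_mono) auto
  finally have "ennreal \<theta> * N X v \<le> ennreal \<theta> * (ennreal (norm z powr p') * (ennreal A * ennreal m))"
    by (intro mult_left_mono) auto
  also have "\<dots> = ennreal (\<theta> * (norm z powr p' * (A * m)))"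
    using A_pos m by (simp add: \<theta>_def flip: ennreal_mult)
  also have "\<theta> * (norm z powr p' * (A * m)) = (norm z / 2) powr p' * m"
    using A_pos by (simp add: \<theta>_def p'(6)[symmetric] powr_divide powr_minus_divide)
  finally show ?thesis using low by (rule order_trans)
qed

text \<open>Taking E empty in \<open>N_lower\<close> compares N X b with itself, and 0 < N X b <
  top. The consequence \<open>A_ge\<close> bounds the characteristic from below.\<close>

lemma \<theta>: "0 < \<theta>" "\<theta> \<le> 1"
proof -
  show "0 < \<theta>" using A_pos by (simp add: \<theta>_def)
  obtain X where X: "X \<in> \<Q>" using \<Q>_ne by blast
  obtain m where m: "emeasure M X = ennreal m" "0 < m" using emeasure_real[OF X] .
  obtain b :: 'v where b: "b \<in> Basis" using nonempty_Basis by blast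
  then have b0: "b \<noteq> 0" by (rule nonzero_Basis)
  have le: "ennreal \<theta> * N X b \<le> N X b" using N_lower[OF X, of "{}" b] by simp
  have "N X b \<noteq> 0"
  proof
    assume "N X b = 0"
    then have "AE y in M. ennreal (norm (J y b) powr p') * indicator X y = 0"
      unfolding N_def using \<Q>_sets[OF X] by (subst (asm) nn_integral_0_iff_AE) auto
    moreover have "J y b \<noteq> 0" for y using PJ[of y b] b0 linear_0[OF linP[of y]] by auto
    ultimately have "AE y in M. y \<notin> X" by (elim eventually_mono) (auto simp: indicator_def split: if_splits)
    then have "emeasure M X = 0" using AE_iff_null_sets[OF \<Q>_sets[OF X]] by auto
    then show False using \<Q>_pos[OF X] by simp
  qed
  then obtain n where n: "N X b = ennreal n" "0 < n" using N_finite[OF X, of b] by (cases "N X b") auto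
  then have "ennreal (\<theta> * n) \<le> ennreal n" using le \<open>0 < \<theta>\<close> by (simp add: ennreal_mult)
  then show "\<theta> \<le> 1" using n \<open>0 < \<theta>\<close> by (simp add: mult_le_cancel_right2)
qed

lemma N_decay:
  assumes X: "X \<in> \<Q>" and E: "E \<in> sets M" "E \<subseteq> X" "2 * emeasure M E \<le> emeasure M X"
  shows "N E v \<le> ennreal (1 - \<theta>) * N X v"
proof -
  obtain n where n: "N X v = ennreal n" "0 \<le> n" using N_finite[OF X, of v] by (cases "N X v") auto
  have split: "N X v = N (X - E) v + N E v"
    unfolding N_def using E \<Q>_sets[OF X] by (intro nn_set_integral_split) auto
  then have "N (X - E) v \<le> ennreal n" "N E v \<le> ennreal n" using n by (metis le_iff_add add.commute)+
  then obtain a b where ab: "N (X - E) v = ennreal a" "N E v = ennreal b" "0 \<le> a" "0 \<le> b"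
    by (cases "N (X - E) v"; cases "N E v") (auto simp: top_unique)
  have "n = a + b" using split n ab by (simp flip: ennreal_plus)
  moreover have "\<theta> * n \<le> a" using N_lower[OF assms, of v] n ab \<theta> by (simp flip: ennreal_mult)
  ultimately have "b \<le> (1 - \<theta>) * n" by (simp add: algebra_simps)
  then show ?thesis using n ab \<theta> by (simp add: ennreal_leI flip: ennreal_mult)
qed

lemma K: "1 \<le> K"
  unfolding K_def using D \<gamma> p by (rule stopping_constant_ge_one)

text \<open>\<open>\<rho>\<close> is built from \<open>RI Q\<close> after \<open>R X\<close>, but
  the reducing inequality on X sees \<open>R X\<close> after \<open>RI Q\<close>. These are adjoint,
  so if all vectors \<open>R X (RI Q b)\<close> were short, every entry and hence
  \<open>\<rho>\<close> would be small.\<close>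

lemma \<rho>_large_average:
  assumes X: "X \<in> \<Q>" and Q: "Q \<in> \<Q>" and large: "\<not> \<rho> X Q \<le> ennreal K"
  shows "ennreal (4 * D) * emeasure M X \<le> (\<Sum>b\<in>Basis. \<integral>\<^sup>+x\<in>X. ennreal (norm (P x (RI Q b)) powr p) \<partial>M)"
proof -
  define \<kappa> where "\<kappa> = 4 * \<gamma> powr p * D"
  have \<kappa>: "0 < \<kappa>" using D \<gamma> by (simp add: \<kappa>_def)
  have "\<exists>b\<in>Basis. \<kappa> powr (1 / p) < norm (R X (RI Q b))"
  proof (rule ccontr)
    assume "\<not> ?thesis"
    then have le: "norm (R X (RI Q b)) \<le> \<kappa> powr (1 / p)" if "b \<in> Basis" for b using that by (auto simp: not_less)
    have "(\<Sum>b\<in>Basis. norm (RI Q (R X b))) \<le> (\<Sum>b\<in>Basis. \<Sum>c\<in>Basis. \<bar>RI Q (R X b) \<bullet> c\<bar>)"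
      by (intro sum_mono norm_le_l1)
    also have "\<dots> \<le> (\<Sum>b\<in>(Basis::'v set). \<Sum>c\<in>(Basis::'v set). \<kappa> powr (1 / p))"
    proof (intro sum_mono)
      fix b c :: 'v assume bc: "b \<in> Basis" "c \<in> Basis"
      have "\<bar>RI Q (R X b) \<bullet> c\<bar> = \<bar>b \<bullet> R X (RI Q c)\<bar>" by (simp add: symRI[OF Q] symR[OF X])
      also have "\<dots> \<le> norm b * norm (R X (RI Q c))" by (rule Cauchy_Schwarz_ineq2)
      also have "\<dots> \<le> \<kappa> powr (1 / p)" using bc le by simp
      finally show "\<bar>RI Q (R X b) \<bullet> c\<bar> \<le> \<kappa> powr (1 / p)" .
    qed
    also have "\<dots> = K" by (simp add: K_def \<kappa>_def D_def power2_eq_square)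
    finally show False using large by (simp add: \<rho>_def ennreal_leI)
  qed
  then obtain b where b: "b \<in> Basis" "\<kappa> powr (1 / p) < norm (R X (RI Q b))" by blast
  have "(\<kappa> powr (1 / p)) powr p \<le> norm (R X (RI Q b)) powr p" using b p by (intro powr_mono2) auto
  then have "ennreal \<kappa> * emeasure M X \<le> ennreal (norm (R X (RI Q b)) powr p) * emeasure M X"
    using p \<kappa> by (intro mult_right_mono ennreal_leI) (auto simp: powr_powr)
  also have "\<dots> \<le> ennreal (\<gamma> powr p) * (\<integral>\<^sup>+x\<in>X. ennreal (norm (P x (RI Q b)) powr p) \<partial>M)" by (rule red_ge[OF X])
  also have "\<dots> \<le> ennreal (\<gamma> powr p) * (\<Sum>b\<in>Basis. \<integral>\<^sup>+x\<in>X. ennreal (norm (P x (RI Q b)) powr p) \<partial>M)"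
    using b by (intro mult_left_mono member_le_sum) auto
  finally have "ennreal (\<gamma> powr p) * (ennreal (4 * D) * emeasure M X) \<le> \<dots>"
    using D by (simp add: \<kappa>_def ennreal_mult mult_ac)
  then show ?thesis using \<gamma> by (subst (asm) ennreal_mult_le_mult_iff) auto
qed

text \<open>The vectors \<open>RI Q b\<close> are normalised on Q: their averages of |P|^p add up to
  at most D, while every bad cube contributes at least 4 D. Hence the bad cubes fill at most a
  quarter.\<close>

lemma \<rho>_large_total:
  assumes Q: "Q \<in> \<Q>" and G: "finite G" "G \<subseteq> {X \<in> \<Q>. X \<subset> Q \<and> \<not> \<rho> X Q \<le> ennreal K}" "disjoint G"
  shows "4 * (\<Sum>X\<in>G. emeasure M X) \<le> emeasure M Q"
proof -
  have Gs: "G \<subseteq> sets M" using G \<Q>_sets by auto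
  have "ennreal D * (4 * (\<Sum>X\<in>G. emeasure M X)) = (\<Sum>X\<in>G. ennreal (4 * D) * emeasure M X)"
    using D by (simp add: ennreal_mult sum_distrib_left sum_distrib_right mult_ac)
  also have "\<dots> \<le> (\<Sum>X\<in>G. \<Sum>b\<in>Basis. \<integral>\<^sup>+x\<in>X. ennreal (norm (P x (RI Q b)) powr p) \<partial>M)"
    using G Q by (intro sum_mono \<rho>_large_average) auto
  also have "\<dots> = (\<Sum>b\<in>Basis. \<Sum>X\<in>G. \<integral>\<^sup>+x\<in>X. ennreal (norm (P x (RI Q b)) powr p) \<partial>M)" by (rule sum.swap)
  also have "\<dots> = (\<Sum>b\<in>Basis. \<integral>\<^sup>+x\<in>\<Union>G. ennreal (norm (P x (RI Q b)) powr p) \<partial>M)"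
    using G Gs by (intro sum.cong refl nn_set_integral_Union_disjoint[symmetric]) auto
  also have "\<dots> \<le> (\<Sum>b\<in>Basis. \<integral>\<^sup>+x\<in>Q. ennreal (norm (P x (RI Q b)) powr p) \<partial>M)"
    using G by (intro sum_mono nn_set_integral_mono) auto
  also have "\<dots> \<le> (\<Sum>b\<in>Basis. ennreal (norm (R Q (RI Q b)) powr p) * emeasure M Q)"
    by (intro sum_mono red_le Q)
  also have "\<dots> = ennreal D * emeasure M Q" by (simp add: R_RI[OF Q] D_def ennreal_of_nat_eq_real_of_nat)
  finally show ?thesis using D by (subst (asm) ennreal_mult_le_mult_iff) auto
qed

lemma wt_compare:
  assumes "X \<in> \<Q>" "Q \<in> \<Q>"
  shows "wt X y \<le> \<rho> X Q * wt Q y"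
proof -
  have lin: "linear (\<lambda>u. J y (R Q u))" using linear_compose[OF linR[OF assms(2)] linJ] by (simp add: o_def)
  have "(\<Sum>b\<in>Basis. norm (J y (R X b))) = (\<Sum>b\<in>Basis. norm (J y (R Q (RI Q (R X b)))))"
    by (simp add: R_RI[OF assms(2)])
  also have "\<dots> \<le> (\<Sum>b\<in>Basis. norm (RI Q (R X b)) * (\<Sum>c\<in>Basis. norm (J y (R Q c))))"
    by (intro sum_mono expand[OF lin])
  finally show ?thesis
    using assms by (simp add: wt_def \<rho>_def sum_distrib_right[symmetric] ennreal_leI sum_nonneg flip: ennreal_mult)
qed

lemma sharp_weighted_family:
  assumes F: "finite F" "F \<subseteq> \<Q>" "laminar F"
  shows "sharp_weighted_family M F wt \<sigma> \<rho> K p A \<theta>"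
proof unfold_locales
  fix Q X E assume "X \<in> F" "Q \<in> F" "X \<subseteq> Q" and E: "E \<in> sets M" "E \<subseteq> X" "2 * emeasure M E \<le> emeasure M X"
  then have X: "X \<in> \<Q>" "Q \<in> \<Q>" using F by auto
  have "(\<integral>\<^sup>+x\<in>E. \<sigma> Q x \<partial>M) = ennreal (D powr p') * (\<Sum>b\<in>Basis. N E (R Q b))"
    using X E by (intro \<sigma>_integral)
  also have "\<dots> \<le> ennreal (D powr p') * (\<Sum>b\<in>Basis. ennreal (1 - \<theta>) * N X (R Q b))"
    using X E by (intro mult_left_mono sum_mono N_decay) auto
  also have "\<dots> = ennreal (1 - \<theta>) * (ennreal (D powr p') * (\<Sum>b\<in>Basis. N X (R Q b)))"
    by (simp add: sum_distrib_left mult_ac)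
  also have "\<dots> = ennreal (1 - \<theta>) * (\<integral>\<^sup>+x\<in>X. \<sigma> Q x \<partial>M)"
    using X \<Q>_sets by (simp only: \<sigma>_integral)
  finally show "(\<integral>\<^sup>+x\<in>E. \<sigma> Q x \<partial>M) \<le> ennreal (1 - \<theta>) * (\<integral>\<^sup>+x\<in>X. \<sigma> Q x \<partial>M)" .
next
  fix Q G assume Q: "Q \<in> F" and G: "G \<subseteq> {P \<in> F. P \<subset> Q \<and> \<not> \<rho> P Q \<le> ennreal K}" "disjoint G"
  then have "finite G" "G \<subseteq> {X \<in> \<Q>. X \<subset> Q \<and> \<not> \<rho> X Q \<le> ennreal K}" "Q \<in> \<Q>"
    using F by (auto intro: finite_subset)
  then show "4 * (\<Sum>P\<in>G. emeasure M P) \<le> emeasure M Q"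
    using G by (intro \<rho>_large_total)
next
  fix Q x
  show "ennpowr (wt Q x) (p / (p - 1)) \<le> \<sigma> Q x" using wt_\<sigma> by (simp add: p'(6)[symmetric])
qed (use p A_pos K \<theta> F \<Q>_pos \<Q>_sets wt_compare \<sigma>_total in \<open>auto simp: subset_eq \<theta>_def\<close>)

end

section \<open>The Christ--Goldberg maximal operator\<close>

definition sup_average :: "'a measure \<Rightarrow> 'a set set \<Rightarrow> ('a set \<Rightarrow> 'a \<Rightarrow> ennreal) \<Rightarrow> 'a \<Rightarrow> ennreal" where
  "sup_average M S u x = (SUP Q\<in>S. indicator Q x * average M Q (u Q))"

lemma sup_average_meas:
  assumes "countable S" "S \<subseteq> sets M"
  shows "sup_average M S u \<in> borel_measurable M"
  unfolding sup_average_def using assms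
  by (intro borel_measurable_SUP borel_measurable_times borel_measurable_indicator) auto

context operator_weight
begin

lemma A_ge: "2 powr (- p') \<le> A"
  using \<theta>(2) A_pos unfolding \<theta>_def p'(6)[symmetric] by (simp add: divide_le_eq)

lemma vector_bound_finite:
  fixes h :: "nat \<Rightarrow> 'a \<Rightarrow> ennreal"
  assumes F: "finite F" "F \<subseteq> \<Q>" "laminar F" and q: "1 < q" and "finite I"
    and "\<And>k. h k \<in> borel_measurable M" "\<And>k x. h k x < top"
  shows "(\<integral>\<^sup>+x. ennpowr (\<Sum>k\<in>I. ennpowr (sup_average M F (\<lambda>Q y. wt Q y * h k y) x) q) (p / q) \<partial>M)
     \<le> ennreal (vector_const p q K * A powr (2 * p - 1))
        * (\<integral>\<^sup>+x. ennpowr (\<Sum>k\<in>I. ennpowr (h k x) q) (p / q) \<partial>M)"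
proof -
  interpret S: sharp_weighted_family M F wt \<sigma> \<rho> K p A \<theta>
    using F by (rule sharp_weighted_family)
  show ?thesis
    using S.vector_maximal_bound[OF q, of I h] assms by (simp add: S.maximal_def sup_average_def)
qed

text \<open>The finite bound is uniform in the family and in the number of functions, so monotone
  convergence applies twice: first S is exhausted by finite subfamilies, which stay laminar, with
  finitely many functions fixed, then the partial sums in k grow.\<close>

lemma vector_bound_countable:
  fixes h :: "nat \<Rightarrow> 'a \<Rightarrow> ennreal"
  assumes S: "countable S" "S \<subseteq> \<Q>" "laminar S" and q: "1 < q"
    and [measurable]: "\<And>k. h k \<in> borel_measurable M" and fin: "\<And>k x. h k x < top"
  shows "(\<integral>\<^sup>+x. ennpowr (\<Sum>k. ennpowr (sup_average M S (\<lambda>Q y. wt Q y * h k y) x) q) (p / q) \<partial>M)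
     \<le> ennreal (vector_const p q K * A powr (2 * p - 1))
        * (\<integral>\<^sup>+x. ennpowr (\<Sum>k. ennpowr (h k x) q) (p / q) \<partial>M)" (is "_ \<le> ?c * ?Y")
proof (cases "S = {}")
  case True
  then show ?thesis by (simp add: sup_average_def bot_ennreal)
next
  case False
  define F where "F j = from_nat_into S ` {..j}" for j :: nat
  have F: "finite (F j)" "F j \<subseteq> S" for j
    using from_nat_into[OF False] by (auto simp: F_def)
  have Fmono: "F i \<subseteq> F j" if "i \<le> j" for i j using that by (auto simp: F_def)
  have FU: "(\<Union>j. F j) = S"
  proof (intro equalityI subsetI)
    fix x assume "x \<in> S"
    then obtain n where "from_nat_into S n = x" using from_nat_into_surj[OF S(1)] by blast
    then have "x \<in> F n" by (auto simp: F_def)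
    then show "x \<in> (\<Union>j. F j)" by blast
  qed (use F in blast)
  define u where "u = (\<lambda>k Q y. wt Q y * h k y)"
  define G where "G j k x = ennpowr (sup_average M (F j) (u k) x) q" for j k x
  have Gm[measurable]: "G j k \<in> borel_measurable M" for j k
    unfolding G_def using F[of j] S \<Q>_sets
    by (intro borel_measurable_ennpowr sup_average_meas countable_finite) auto
  have Gmono: "incseq (\<lambda>j. G j k x)" for k x
    unfolding G_def sup_average_def using Fmono q by (intro incseq_SucI ennpowr_mono SUP_subset_mono) auto
  have GS: "ennpowr (sup_average M S (u k) x) q = (SUP j. G j k x)" for k x
  proof -
    have "sup_average M S (u k) x = (SUP j. sup_average M (F j) (u k) x)"
      unfolding sup_average_def FU[symmetric] by (rule SUP_UNION)
    then show ?thesis using q by (simp add: ennpowr_SUP G_def)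
  qed
  have fin_bound: "(\<integral>\<^sup>+x. ennpowr (\<Sum>k<m. ennpowr (sup_average M S (u k) x) q) (p / q) \<partial>M) \<le> ?c * ?Y" for m
  proof -
    have "(\<lambda>x. ennpowr (\<Sum>k<m. ennpowr (sup_average M S (u k) x) q) (p / q)) = (\<lambda>x. SUP j. ennpowr (\<Sum>k<m. G j k x) (p / q))"
      unfolding GS using Gmono p q by (simp add: ennreal_SUP_sum[symmetric] ennpowr_SUP)
    then have "(\<integral>\<^sup>+x. ennpowr (\<Sum>k<m. ennpowr (sup_average M S (u k) x) q) (p / q) \<partial>M)
       = (\<integral>\<^sup>+x. (SUP j. ennpowr (\<Sum>k<m. G j k x) (p / q)) \<partial>M)" by simp
    also have "\<dots> = (SUP j. \<integral>\<^sup>+x. ennpowr (\<Sum>k<m. G j k x) (p / q) \<partial>M)"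
    proof (rule nn_integral_monotone_convergence_SUP)
      show "incseq (\<lambda>j x. ennpowr (\<Sum>k<m. G j k x) (p / q))"
        using Gmono p q by (intro incseq_SucI le_funI ennpowr_mono sum_mono) (auto simp: incseq_Suc_iff)
    qed measurable
    also have "\<dots> \<le> ?c * ?Y"
    proof (rule SUP_least)
      fix j
      have "laminar (F j)" using S(3) F(2)[of j] unfolding laminar_def by blast
      then have "(\<integral>\<^sup>+x. ennpowr (\<Sum>k<m. G j k x) (p / q) \<partial>M) \<le> ?c * (\<integral>\<^sup>+x. ennpowr (\<Sum>k<m. ennpowr (h k x) q) (p / q) \<partial>M)"
        unfolding G_def u_def using F[of j] S(2) q fin by (intro vector_bound_finite) auto
      also have "\<dots> \<le> ?c * ?Y"
        using p q by (intro mult_left_mono nn_integral_mono ennpowr_mono sum_le_suminf) auto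
      finally show "(\<integral>\<^sup>+x. ennpowr (\<Sum>k<m. G j k x) (p / q) \<partial>M) \<le> ?c * ?Y" .
    qed
    finally show ?thesis .
  qed
  have Sm[measurable]: "sup_average M S (u k) \<in> borel_measurable M" for k
    using S \<Q>_sets by (intro sup_average_meas) auto
  have "(\<integral>\<^sup>+x. ennpowr (\<Sum>k. ennpowr (sup_average M S (u k) x) q) (p / q) \<partial>M)
     = (\<integral>\<^sup>+x. (SUP m. ennpowr (\<Sum>k<m. ennpowr (sup_average M S (u k) x) q) (p / q)) \<partial>M)"
    using p q by (simp add: suminf_eq_SUP ennpowr_SUP)
  also have "\<dots> = (SUP m. \<integral>\<^sup>+x. ennpowr (\<Sum>k<m. ennpowr (sup_average M S (u k) x) q) (p / q) \<partial>M)"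
  proof (rule nn_integral_monotone_convergence_SUP)
    show "incseq (\<lambda>m x. ennpowr (\<Sum>k<m. ennpowr (sup_average M S (u k) x) q) (p / q))"
      using p q by (intro incseq_SucI le_funI ennpowr_mono sum_mono2) auto
  qed measurable
  also have "\<dots> \<le> ?c * ?Y" by (intro SUP_least fin_bound)
  finally show ?thesis by (simp add: u_def)
qed

lemma norm_reducing_mono:
  assumes Q: "Q \<in> \<Q>" "Q' \<in> \<Q>" "Q \<subseteq> Q'" and s: "0 < s" "emeasure M Q' \<le> ennreal s * emeasure M Q"
  shows "norm (R Q e) \<le> \<gamma> * s powr (1 / p) * norm (R Q' e)"
proof -
  obtain m where m: "emeasure M Q = ennreal m" "0 < m" using emeasure_real[OF Q(1)] .
  have "ennreal (norm (R Q e) powr p) * ennreal m \<le> ennreal (\<gamma> powr p) * (\<integral>\<^sup>+x\<in>Q. ennreal (norm (P x e) powr p) \<partial>M)"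
    using red_ge[OF Q(1), of e] m by simp
  also have "\<dots> \<le> ennreal (\<gamma> powr p) * (\<integral>\<^sup>+x\<in>Q'. ennreal (norm (P x e) powr p) \<partial>M)"
    using Q by (intro mult_left_mono nn_set_integral_mono) auto
  also have "\<dots> \<le> ennreal (\<gamma> powr p) * (ennreal (norm (R Q' e) powr p) * emeasure M Q')"
    by (intro mult_left_mono red_le Q) auto
  also have "\<dots> \<le> ennreal (\<gamma> powr p) * (ennreal (norm (R Q' e) powr p) * (ennreal s * ennreal m))"
    using s m by (intro mult_left_mono) auto
  finally have "norm (R Q e) powr p * m \<le> \<gamma> powr p * (norm (R Q' e) powr p * (s * m))"
    using s m by (simp flip: ennreal_mult)
  then have "m * norm (R Q e) powr p \<le> m * (\<gamma> powr p * (norm (R Q' e) powr p * s))" by (simp only: mult_ac)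
  then have "norm (R Q e) powr p \<le> \<gamma> powr p * (norm (R Q' e) powr p * s)"
    using m by (simp only: mult_le_cancel_left_pos)
  then have "(norm (R Q e) powr p) powr (1 / p) \<le> (\<gamma> powr p * (norm (R Q' e) powr p * s)) powr (1 / p)"
    using p by (intro powr_mono2) auto
  then show ?thesis using p \<gamma> s by (simp add: powr_powr powr_mult mult_ac)
qed

text \<open>Enlarging Q to Q' costs s in the average and \<open>\<gamma> * s powr (1 / p)\<close> in
  the reducing operator, by \<open>norm_reducing_mono\<close>.\<close>

lemma average_le_sup_average:
  assumes Q: "Q \<in> \<Q>" "Q' \<in> S" "S \<subseteq> \<Q>" "Q \<subseteq> Q'" and s: "0 < s" "emeasure M Q' \<le> ennreal s * emeasure M Q" and x: "x \<in> Q"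
    and [measurable]: "(\<lambda>y. ennreal (norm (P y (f y)))) \<in> borel_measurable M"
  shows "average M Q (\<lambda>y. ennreal (norm (R Q (f y))))
     \<le> ennreal (\<gamma> * s powr (1 + 1 / p)) * sup_average M S (\<lambda>Q y. wt Q y * ennreal (norm (P y (f y)))) x"
proof -
  have Q': "Q' \<in> \<Q>" using Q by auto
  note [measurable] = \<Q>_sets[OF Q']
  obtain m where m: "emeasure M Q = ennreal m" "0 < m" using emeasure_real[OF Q(1)] .
  obtain m' where m': "emeasure M Q' = ennreal m'" "0 < m'" using emeasure_real[OF Q'] .
  have mm: "m' \<le> s * m" using s m m' by (simp flip: ennreal_mult)
  let ?u = "\<lambda>y. wt Q' y * ennreal (norm (P y (f y)))"
  have "average M Q (\<lambda>y. ennreal (norm (R Q (f y)))) * ennreal m = (\<integral>\<^sup>+y\<in>Q. ennreal (norm (R Q (f y))) \<partial>M)"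
    by (rule average_times_emeasure[OF m])
  also have "\<dots> \<le> (\<integral>\<^sup>+y\<in>Q'. ennreal (\<gamma> * s powr (1 / p)) * ?u y \<partial>M)"
  proof (intro nn_set_integral_mono Q)
    fix y
    have "ennreal (norm (R Q (f y))) \<le> ennreal (\<gamma> * s powr (1 / p)) * ennreal (norm (R Q' (f y)))"
      using norm_reducing_mono[OF Q(1) Q' Q(4) s, of "f y"] \<gamma> by (simp add: ennreal_leI flip: ennreal_mult)
    also have "\<dots> \<le> ennreal (\<gamma> * s powr (1 / p)) * ?u y"
      by (intro mult_left_mono wt_bound Q') auto
    finally show "ennreal (norm (R Q (f y))) \<le> ennreal (\<gamma> * s powr (1 / p)) * ?u y" .
  qed
  also have "\<dots> = ennreal (\<gamma> * s powr (1 / p)) * (\<integral>\<^sup>+y\<in>Q'. ?u y \<partial>M)"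
    by (simp add: mult.assoc nn_integral_cmult)
  also have "\<dots> = ennreal (\<gamma> * s powr (1 / p)) * (average M Q' ?u * ennreal m')"
    by (simp only: average_times_emeasure[OF m'])
  also have "\<dots> \<le> ennreal (\<gamma> * s powr (1 / p)) * (average M Q' ?u * ennreal (s * m))"
    using mm by (intro mult_left_mono ennreal_leI) auto
  also have "\<dots> = (ennreal (\<gamma> * s powr (1 + 1 / p)) * average M Q' ?u) * ennreal m"
    using s \<gamma> m by (simp add: powr_add ennreal_mult mult_ac)
  finally have "ennreal m * average M Q (\<lambda>y. ennreal (norm (R Q (f y)))) \<le> ennreal m * (ennreal (\<gamma> * s powr (1 + 1 / p)) * average M Q' ?u)"
    by (simp only: mult.commute[of "ennreal m"])
  then have "average M Q (\<lambda>y. ennreal (norm (R Q (f y)))) \<le> ennreal (\<gamma> * s powr (1 + 1 / p)) * average M Q' ?u"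
    using m by (subst (asm) ennreal_mult_le_mult_iff) auto
  also have "average M Q' ?u \<le> sup_average M S (\<lambda>Q y. wt Q y * ennreal (norm (P y (f y)))) x"
    unfolding sup_average_def using Q x by (intro SUP_upper2[of Q']) (auto simp: indicator_def)
  finally show ?thesis by (simp add: mult_left_mono)
qed

end

section \<open>From matrix weights to operator weights\<close>

lemma avg_eq_average: "avg Q g = average lebesgue Q g"
  by (simp add: avg_def average_def)

lemma average_cong_AE: "AE x in M. u x = v x \<Longrightarrow> average M Q u = average M Q v"
  unfolding average_def
  by (intro arg_cong2[where f = "(/)"] nn_integral_cong_AE refl) (auto elim!: eventually_mono)

lemma locally_integrable_measurable:
  fixes f :: "real^'n \<Rightarrow> 'b::euclidean_space"
  assumes "locally_integrable f"
  shows "f \<in> borel_measurable lebesgue"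
proof (rule borel_measurable_LIMSEQ_metric)
  fix i :: nat
  have "f absolutely_integrable_on cball 0 (real i)" using assms by (simp add: locally_integrable_def)
  then show "(\<lambda>x. indicat_real (cball 0 (real i)) x *\<^sub>R f x) \<in> borel_measurable lebesgue"
    by (auto simp: set_integrable_def)
next
  fix x
  have "eventually (\<lambda>i. indicat_real (cball 0 (real i)) x *\<^sub>R f x = f x) sequentially"
    using eventually_ge_at_top[of "nat \<lceil>norm x\<rceil>"]
  proof eventually_elim
    case (elim i)
    then have "norm x \<le> real i" by linarith
    then show ?case by simp
  qed
  then show "(\<lambda>i. indicat_real (cball 0 (real i)) x *\<^sub>R f x) \<longlonglongrightarrow> f x"
    by (rule tendsto_eventually)
qed

text \<open>The identity is inserted on the null set where W is not positive definite, so that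
  symmetry and inversion hold at every point, as \<open>operator_weight\<close> demands.\<close>

definition regular_powr :: "(real^'n \<Rightarrow> complex^'d^'d) \<Rightarrow> real \<Rightarrow> real^'n \<Rightarrow> complex^'d^'d" where
  "regular_powr W s x = (if pos_definite (W x) then mat_powr (W x) s else mat 1)"

lemma hermitian_regular_powr: "hermitian (regular_powr W s x)"
proof (cases "pos_definite (W x)")
  case False
  have "hermitian (mat 1)" by (simp add: hermitian_def vec_eq_iff ctranspose_nth mat_def)
  then show ?thesis using False by (simp add: regular_powr_def)
qed (simp add: regular_powr_def hermitian_mat_powr)

lemma regular_powr_minus: "regular_powr W s x ** regular_powr W (- s) x = mat 1"
  by (simp add: regular_powr_def mat_powr_minus matrix_mul_rid)

lemma mat_powr_one: "pos_definite A \<Longrightarrow> mat_powr A 1 = A"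
  using pos_definite_diagonalization[of A] mat_powr_eq[of _ A _ 1]
  by (metis (no_types, lifting) powr_one less_imp_le ext)

lemma matrix_vector_meas:
  fixes B :: "'a \<Rightarrow> complex^'d^'d" and v :: "'a \<Rightarrow> complex^'d"
  assumes "B \<in> borel_measurable M" "v \<in> borel_measurable M"
  shows "(\<lambda>x. B x *v v x) \<in> borel_measurable M"
proof (rule borel_measurable_continuous_Pair[OF assms])
  show "continuous_on UNIV (\<lambda>z. fst z *v snd z :: complex^'d)"
    unfolding matrix_vector_mult_def by (intro continuous_intros)
qed

lemma reducing_operatorD:
  fixes W :: "real^'n \<Rightarrow> complex^'d^'d"
  assumes red: "reducing_operator p W Q B" and Q: "Q \<in> cubes" and p: "1 < p" and PD: "AE x in lebesgue. pos_definite (W x)"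
  defines "I e \<equiv> \<integral>\<^sup>+x\<in>Q. ennreal (norm (regular_powr W (1 / p) x *v e) powr p) \<partial>lebesgue"
  shows "I e \<le> ennreal (norm (B *v e) powr p) * emeasure lebesgue Q"
    "ennreal (norm (B *v e) powr p) * emeasure lebesgue Q \<le> ennreal (sqrt (real CARD('d)) powr p) * I e"
proof -
  obtain m where m: "emeasure lebesgue Q = ennreal m" "0 < m"
    using cubes_measure[OF Q] by (cases "emeasure lebesgue Q") auto
  define a where "a = avg Q (\<lambda>x. ennreal (norm (mat_powr (W x) (1 / p) *v e) powr p))"
  have a: "a * ennreal m = I e"
    unfolding a_def avg_eq_average average_times_emeasure[OF m] I_def
    using PD by (intro nn_integral_cong_AE) (auto simp: regular_powr_def elim!: eventually_mono)
  have le: "ennpowr a (1 / p) \<le> ennreal (norm (B *v e))" "ennreal (norm (B *v e)) \<le> ennreal (sqrt (real CARD('d))) * ennpowr a (1 / p)"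
    using red by (auto simp: reducing_operator_def Let_def a_def)
  have "ennpowr (ennpowr a (1 / p)) p \<le> ennpowr (ennreal (norm (B *v e))) p"
    using p le by (intro ennpowr_mono) auto
  then have "a \<le> ennreal (norm (B *v e) powr p)" using p by (simp add: ennpowr_ennpowr ennpowr_ennreal)
  then show "I e \<le> ennreal (norm (B *v e) powr p) * emeasure lebesgue Q"
    unfolding a[symmetric] m by (intro mult_right_mono) auto
  have "ennpowr (ennreal (norm (B *v e))) p \<le> ennpowr (ennreal (sqrt (real CARD('d))) * ennpowr a (1 / p)) p"
    using p le by (intro ennpowr_mono) auto
  then have "ennreal (norm (B *v e) powr p) \<le> ennreal (sqrt (real CARD('d)) powr p) * a"
    using p by (simp add: ennpowr_mult ennpowr_ennpowr ennpowr_ennreal)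
  then have "ennreal (norm (B *v e) powr p) * ennreal m \<le> (ennreal (sqrt (real CARD('d)) powr p) * a) * ennreal m"
    by (intro mult_right_mono) auto
  then show "ennreal (norm (B *v e) powr p) * emeasure lebesgue Q \<le> ennreal (sqrt (real CARD('d)) powr p) * I e"
    unfolding a[symmetric] m by (simp only: mult.assoc)
qed

abbreviation cross_norm :: "real \<Rightarrow> (real^'n \<Rightarrow> complex^'d^'d) \<Rightarrow> real^'n \<Rightarrow> real^'n \<Rightarrow> real" where
  "cross_norm p W x y \<equiv> op_norm (regular_powr W (1 / p) x ** regular_powr W (- (1 / p)) y)"

text \<open>The inner averages agree only for those x at which W is positive definite, so the null
  set is discarded once in y and once more in x.\<close>

lemma regular_Ap:
  fixes W :: "real^'n \<Rightarrow> complex^'d^'d"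
  assumes Q: "Q \<in> cubes" and PD: "AE x in lebesgue. pos_definite (W x)"
  shows "average lebesgue Q (\<lambda>x. ennpowr (average lebesgue Q (\<lambda>y. ennreal
      (cross_norm p W x y powr (p / (p - 1))))) (p / (p / (p - 1)))) \<le> Ap_char p W"
proof -
  let ?p = "p / (p - 1)"
  have inner: "average lebesgue Q (\<lambda>y. ennreal (cross_norm p W x y powr ?p))
     = avg Q (\<lambda>y. ennreal (op_norm (mat_powr (W x) (1 / p) ** mat_powr (W y) (- 1 / p)) powr ?p))" if "pos_definite (W x)" for x
    unfolding avg_eq_average using PD that
    by (intro average_cong_AE) (auto simp: regular_powr_def elim!: eventually_mono)
  have "average lebesgue Q (\<lambda>x. ennpowr (average lebesgue Q (\<lambda>y. ennreal
      (cross_norm p W x y powr ?p))) (p / ?p))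
     = avg Q (\<lambda>x. ennpowr (avg Q (\<lambda>y. ennreal (op_norm (mat_powr (W x) (1 / p) ** mat_powr (W y) (- 1 / p)) powr ?p))) (p / ?p))"
  proof (subst avg_eq_average, rule average_cong_AE, use PD in eventually_elim)
    case (elim x)
    then show ?case by (simp only: inner)
  qed
  also have "\<dots> \<le> Ap_char p W"
    unfolding Ap_char_def Let_def using Q by (intro SUP_upper)
  finally show ?thesis .
qed

lemma operator_weight_matrix:
  fixes W :: "real^'n \<Rightarrow> complex^'d^'d"
  assumes p: "1 < p" and W: "matrix_weight W" and R: "\<forall>Q\<in>cubes. reducing_operator p W Q (R Q)"
    and \<alpha>: "0 < \<alpha>" "Ap_char p W \<le> ennreal \<alpha>"
  shows "operator_weight lebesgue (\<lambda>x v. regular_powr W (1 / p) x *v v) (\<lambda>x v. regular_powr W (- (1 / p)) x *v v)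
     (\<lambda>Q v. R Q *v v) (\<lambda>Q v. mat_powr (R Q) (- 1) *v v) cubes
     (cross_norm p W)
     p (p / (p - 1)) \<alpha> (sqrt (real CARD('d)))"
proof -
  have PD: "AE x in lebesgue. pos_definite (W x)" and Wm: "W \<in> borel_measurable lebesgue"
    using W by (auto simp: matrix_weight_def intro: locally_integrable_measurable)
  have Zm: "regular_powr W s \<in> borel_measurable lebesgue" for s
    using borel_measurable_mat_powr[OF Wm PD, of s] by (simp add: regular_powr_def[abs_def])
  have pdR: "pos_definite (R Q)" if "Q \<in> cubes" for Q using R that by (auto simp: reducing_operator_def)
  have lin: "linear (\<lambda>v. B *v v)" for B :: "complex^'d^'d"
    by (rule bounded_linear.linear[OF matrix_vector_mul_bounded_linear])
  have inv: "regular_powr W s x *v (regular_powr W t x *v v) = v" if "t = - s" for s t x v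
    unfolding that by (simp add: matrix_vector_mul_assoc regular_powr_minus)
  have ne: "(cubes :: (real^'n) set set) \<noteq> {}"
    using grid_subset_cubes[of "\<lambda>_. True"] by (auto simp: grid_def)
  show ?thesis
  proof (rule operator_weight.intro)
    fix x u v
    show "(regular_powr W (1 / p) x *v u) \<bullet> v = u \<bullet> (regular_powr W (1 / p) x *v v)"
      "(regular_powr W (- (1 / p)) x *v u) \<bullet> v = u \<bullet> (regular_powr W (- (1 / p)) x *v v)"
      by (intro hermitian_inner hermitian_regular_powr)+
    show "(\<lambda>x. regular_powr W (1 / p) x *v v) \<in> borel_measurable lebesgue"
      "(\<lambda>x. regular_powr W (- (1 / p)) x *v v) \<in> borel_measurable lebesgue"
      by (intro matrix_vector_meas Zm borel_measurable_const)+
  next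
    fix Q :: "(real^'n) set" and u v assume Q: "Q \<in> cubes"
    show "(R Q *v u) \<bullet> v = u \<bullet> (R Q *v v)" using pdR[OF Q] by (intro hermitian_inner) (simp add: pos_definite_def)
    show "R Q *v (mat_powr (R Q) (- 1) *v v) = v"
      using mat_powr_minus[OF pdR[OF Q], of 1] mat_powr_one[OF pdR[OF Q]] by (simp add: matrix_vector_mul_assoc)
    show "mat_powr (R Q) (- 1) *v (R Q *v v) = v"
      using mat_powr_minus[OF pdR[OF Q], of "- 1"] mat_powr_one[OF pdR[OF Q]] by (simp add: matrix_vector_mul_assoc)
  next
    fix x y v
    show "0 \<le> cross_norm p W x y"
      unfolding op_norm_def by (intro onorm_pos_le matrix_vector_mul_bounded_linear)
    show "norm (regular_powr W (1 / p) x *v (regular_powr W (- (1 / p)) y *v v))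
       \<le> cross_norm p W x y * norm v"
      unfolding op_norm_def matrix_vector_mul_assoc by (intro onorm matrix_vector_mul_bounded_linear)
  next
    fix x v
    show "regular_powr W (- (1 / p)) x *v (regular_powr W (1 / p) x *v v) = v"
      "regular_powr W (1 / p) x *v (regular_powr W (- (1 / p)) x *v v) = v"
      by (intro inv; simp)+
  next
    fix Q :: "(real^'n) set" and e assume Q: "Q \<in> cubes"
    then have rQ: "reducing_operator p W Q (R Q)" using R by blast
    show "(\<integral>\<^sup>+x\<in>Q. ennreal (norm (regular_powr W (1 / p) x *v e) powr p) \<partial>lebesgue) \<le> ennreal (norm (R Q *v e) powr p) * emeasure lebesgue Q"
      "ennreal (norm (R Q *v e) powr p) * emeasure lebesgue Q \<le> ennreal (sqrt (real CARD('d)) powr p) * (\<integral>\<^sup>+x\<in>Q. ennreal (norm (regular_powr W (1 / p) x *v e) powr p) \<partial>lebesgue)"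
      by (rule reducing_operatorD[OF rQ Q p PD])+
    show "average lebesgue Q (\<lambda>x. ennpowr (average lebesgue Q (\<lambda>y. ennreal
      (cross_norm p W x y powr (p / (p - 1))))) (p / (p / (p - 1)))) \<le> ennreal \<alpha>"
      by (rule order_trans[OF regular_Ap[OF Q PD] \<alpha>(2)])
  next
    show "1 \<le> sqrt (real CARD('d))" by (simp add: Suc_le_eq)
  qed (fact p \<alpha>(1) ne cubes_measure refl lin | rule lin)+
qed


section \<open>Assembly over the shifted grids\<close>

lemma Lp_lq_norm_power:
  assumes "0 < q"
  shows "Lp_norm p (\<lambda>x. lq_norm q (\<lambda>k. a k x)) = ennpowr (\<integral>\<^sup>+x. ennpowr (\<Sum>k. ennpowr (a k x) q) (p / q) \<partial>lebesgue) (1 / p)"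
  by (simp add: Lp_norm_def lq_norm_def ennpowr_ennpowr)

lemma ennpowr_suminf_sum_le:
  assumes I: "finite I" and q: "0 < q" and r: "0 < r" and c: "0 \<le> c"
    and le: "\<And>k. b k \<le> ennreal c * (\<Sum>t\<in>I. a t k)"
  shows "ennpowr (\<Sum>k. ennpowr (b k) q) r
    \<le> ennreal ((c * real (card I)) powr (q * r) * real (card I) powr r) * (\<Sum>t\<in>I. ennpowr (\<Sum>k. ennpowr (a t k) q) r)"
proof -
  let ?T = "real (card I)"
  have "ennpowr (b k) q \<le> ennreal ((c * ?T) powr q) * (\<Sum>t\<in>I. ennpowr (a t k) q)" for k
  proof -
    have "ennpowr (b k) q \<le> ennpowr (ennreal c * (\<Sum>t\<in>I. a t k)) q" using q le by (intro ennpowr_mono) auto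
    also have "\<dots> = ennreal (c powr q) * ennpowr (\<Sum>t\<in>I. a t k) q" using q c by (simp add: ennpowr_mult ennpowr_ennreal)
    also have "\<dots> \<le> ennreal (c powr q) * (ennreal (?T powr q) * (\<Sum>t\<in>I. ennpowr (a t k) q))"
      using I q by (intro mult_left_mono ennpowr_sum_le) auto
    also have "\<dots> = ennreal ((c * ?T) powr q) * (\<Sum>t\<in>I. ennpowr (a t k) q)"
      using c by (simp add: powr_mult ennreal_mult mult.assoc)
    finally show ?thesis .
  qed
  then have "(\<Sum>k. ennpowr (b k) q) \<le> (\<Sum>k. ennreal ((c * ?T) powr q) * (\<Sum>t\<in>I. ennpowr (a t k) q))"
    by (intro suminf_le) auto
  also have "\<dots> = ennreal ((c * ?T) powr q) * (\<Sum>t\<in>I. \<Sum>k. ennpowr (a t k) q)"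
    by (simp add: suminf_sum)
  finally have "ennpowr (\<Sum>k. ennpowr (b k) q) r \<le> ennpowr (ennreal ((c * ?T) powr q) * (\<Sum>t\<in>I. \<Sum>k. ennpowr (a t k) q)) r"
    using r by (intro ennpowr_mono) auto
  also have "\<dots> = ennreal ((c * ?T) powr (q * r)) * ennpowr (\<Sum>t\<in>I. \<Sum>k. ennpowr (a t k) q) r"
    using r by (simp add: ennpowr_mult ennpowr_ennreal powr_powr)
  also have "\<dots> \<le> ennreal ((c * ?T) powr (q * r)) * (ennreal (?T powr r) * (\<Sum>t\<in>I. ennpowr (\<Sum>k. ennpowr (a t k) q) r))"
    using I r by (intro mult_left_mono ennpowr_sum_le) auto
  finally show ?thesis by (simp add: ennreal_mult mult.assoc)
qed

theorem theorem6:
  fixes p q :: real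
  assumes "1 < p" and "1 < q"
  shows "\<exists>C::real. 0 < C \<and>
    (\<forall>(W :: real^'n \<Rightarrow> complex^'d^'d) (R :: (real^'n) set \<Rightarrow> complex^'d^'d)
      (f :: nat \<Rightarrow> real^'n \<Rightarrow> complex^'d).
       matrix_Ap_weight p W \<longrightarrow>
       (\<forall>Q\<in>cubes. reducing_operator p W Q (R Q)) \<longrightarrow>
       (\<forall>k. locally_integrable (f k)) \<longrightarrow>
       Lp_norm p (\<lambda>x. lq_norm q (\<lambda>k. christ_goldberg R (f k) x))
         \<le> ennreal C * ennpowr (Ap_char p W) (1 / p + max (1 / (q - 1)) (1 / (p - 1)))
            * Lp_norm p (\<lambda>x. lq_norm q (\<lambda>k. ennreal (norm (mat_powr (W x) (1 / p) *v f k x)))))"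
proof -
  note p = assms(1) and q = assms(2)
  define p' where "p' = p / (p - 1)"
  define \<gamma> where "\<gamma> = sqrt (real CARD('d))"
  define d where "d = real DIM(complex^'d)"
  define K where "K = d\<^sup>2 * (4 * \<gamma> powr p * d) powr (1 / p)"
  define c1 where "c1 = d powr (p' + 1) * \<gamma> powr p'"
  define s :: real where "s = 6 ^ CARD('n)"
  define C1 where "C1 = \<gamma> * s powr (1 + 1 / p)"
  define T where "T = real CARD('n \<Rightarrow> bool)"
  \<comment> \<open>The lower bound for the characteristic: the inequality \<open>A_ge\<close>, with
    A = \<open>c1 * \<alpha> powr (1 / (p - 1))\<close>, solved for \<open>\<alpha>\<close>.\<close>
  define a0 where "a0 = (2 powr (- p') / c1) powr (p - 1)"
  define e1 where "e1 = 1 / p + 1 / (p - 1)"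
  define e2 where "e2 = 1 / p + max (1 / (q - 1)) (1 / (p - 1))"
  \<comment> \<open>The constant for p-th powers of the norms. \<open>C1\<close> pays for enlarging
    a cube; the powers of the number T of grids come from moving the sum over grids outside the
    powers q and p / q, and from adding up the T integrals.\<close>
  define L where "L = (C1 * T) powr p * T powr (p / q) * T * (vector_const p q K * c1 powr (2 * p - 1))"
  define C where "C = L powr (1 / p) * a0 powr (e1 - e2)"
  have \<gamma>: "1 \<le> \<gamma>" by (simp add: \<gamma>_def Suc_le_eq)
  have d: "1 \<le> d" using DIM_positive[where 'a = "complex^'d"] unfolding d_def by linarith
  have K: "1 \<le> K" unfolding K_def using d \<gamma> p by (rule stopping_constant_ge_one)
  have c1: "0 < c1" using d \<gamma> by (simp add: c1_def)
  have s: "0 < s" by (simp add: s_def)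
  have C1: "0 < C1" using \<gamma> s by (simp add: C1_def)
  have T: "0 < T" by (simp add: T_def)
  have a0: "0 < a0" using c1 by (simp add: a0_def)
  have L: "0 < L" using C1 T c1 vector_const_pos[OF p q K] by (simp add: L_def)
  have C: "0 < C" using L a0 by (simp add: C_def)
  have "Lp_norm p (\<lambda>x. lq_norm q (\<lambda>k. christ_goldberg R (f k) x))
         \<le> ennreal C * ennpowr (Ap_char p W) e2
            * Lp_norm p (\<lambda>x. lq_norm q (\<lambda>k. ennreal (norm (mat_powr (W x) (1 / p) *v f k x))))"
    if Ap: "matrix_Ap_weight p W" and R: "\<forall>Q\<in>cubes. reducing_operator p W Q (R Q)"
      and f: "\<forall>k. locally_integrable (f k)"
    for W :: "real^'n \<Rightarrow> complex^'d^'d" and R and f :: "nat \<Rightarrow> real^'n \<Rightarrow> complex^'d"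
  proof -
    have W: "matrix_weight W" and Ap_fin: "Ap_char p W < top" using Ap by (auto simp: matrix_Ap_weight_def)
    have PD: "AE x in lebesgue. pos_definite (W x)" and Wm: "W \<in> borel_measurable lebesgue"
      using W by (auto simp: matrix_weight_def intro: locally_integrable_measurable)
    have Zm: "regular_powr W (1 / p) \<in> borel_measurable lebesgue"
      using borel_measurable_mat_powr[OF Wm PD, of "1 / p"] by (simp add: regular_powr_def[abs_def])
    have fm[measurable]: "f k \<in> borel_measurable lebesgue" for k using f by (auto intro: locally_integrable_measurable)
    note OW = operator_weight_matrix[OF p W R]
    \<comment> \<open>Stated for every positive upper bound of the characteristic, because
      \<open>operator_weight\<close> requires a positive number and the characteristic is not yet
      known to be one.\<close>
    have lower: "a0 \<le> \<alpha>" if \<alpha>: "0 < \<alpha>" "Ap_char p W \<le> ennreal \<alpha>" for \<alpha>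
    proof -
      interpret OW: operator_weight lebesgue "\<lambda>x v. regular_powr W (1 / p) x *v v" "\<lambda>x v. regular_powr W (- (1 / p)) x *v v"
        "\<lambda>Q v. R Q *v v" "\<lambda>Q v. mat_powr (R Q) (- 1) *v v" cubes
        "cross_norm p W" p p' \<alpha> \<gamma>
        unfolding p'_def \<gamma>_def by (rule OW[OF \<alpha>])
      have "2 powr (- p') \<le> c1 * \<alpha> powr (1 / (p - 1))"
        using OW.A_ge by (simp add: OW.A_def OW.D_def c1_def d_def)
      then have "2 powr (- p') / c1 \<le> \<alpha> powr (1 / (p - 1))" using c1 by (simp add: divide_le_eq mult.commute)
      then have "a0 \<le> (\<alpha> powr (1 / (p - 1))) powr (p - 1)"
        unfolding a0_def using p c1 by (intro powr_mono2) auto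
      then show ?thesis using \<alpha> p by (simp add: powr_powr)
    qed
    obtain \<alpha> where \<alpha>: "Ap_char p W = ennreal \<alpha>" "0 \<le> \<alpha>" using Ap_fin by (cases "Ap_char p W") auto
    \<comment> \<open>A vanishing characteristic would admit the upper bound \<open>a0 / 2\<close>,
      contradicting \<open>lower\<close>.\<close>
    have "\<alpha> \<noteq> 0" using lower[of "a0 / 2"] a0 \<alpha> by auto
    then have \<alpha>0: "0 < \<alpha>" using \<alpha> by simp
    then have \<alpha>a0: "a0 \<le> \<alpha>" using lower[of \<alpha>] \<alpha> by simp
    interpret OW: operator_weight lebesgue "\<lambda>x v. regular_powr W (1 / p) x *v v" "\<lambda>x v. regular_powr W (- (1 / p)) x *v v"
      "\<lambda>Q v. R Q *v v" "\<lambda>Q v. mat_powr (R Q) (- 1) *v v" cubes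
      "cross_norm p W" p p' \<alpha> \<gamma>
      unfolding p'_def \<gamma>_def using \<alpha>0 \<alpha> by (intro OW) auto
    have OWK: "OW.K = K" by (simp add: OW.K_def OW.D_def K_def d_def)
    have OWA: "OW.A = c1 * \<alpha> powr (1 / (p - 1))" by (simp add: OW.A_def OW.D_def c1_def d_def)
    define h where "h k x = ennreal (norm (regular_powr W (1 / p) x *v f k x))" for k x
    have hm[measurable]: "h k \<in> borel_measurable lebesgue" for k
      unfolding h_def by (intro measurable_compose[OF matrix_vector_meas[OF Zm fm]]) measurable
    define N where "N t k x = sup_average lebesgue (grid t) (\<lambda>Q y. OW.wt Q y * h k y) x" for t :: "'n \<Rightarrow> bool" and k x
    have Nm[measurable]: "N t k \<in> borel_measurable lebesgue" for t k
      unfolding N_def using countable_grid grid_subset_cubes cubes_measure(1) by (intro sup_average_meas) auto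
    define Y where "Y = (\<integral>\<^sup>+x. ennpowr (\<Sum>k. ennpowr (h k x) q) (p / q) \<partial>lebesgue)"
    define c where "c = vector_const p q K * (c1 * \<alpha> powr (1 / (p - 1))) powr (2 * p - 1)"
    have c0: "0 < c" using vector_const_pos[OF p q K] c1 \<alpha>0 by (simp add: c_def)
    have NY: "(\<integral>\<^sup>+x. ennpowr (\<Sum>k. ennpowr (N t k x) q) (p / q) \<partial>lebesgue) \<le> ennreal c * Y" for t
      unfolding N_def Y_def c_def OWK[symmetric] OWA[symmetric]
      using countable_grid grid_subset_cubes laminar_grid q
      by (intro OW.vector_bound_countable hm) (auto simp: h_def)
    have pt: "christ_goldberg R (f k) x \<le> ennreal C1 * (\<Sum>t\<in>UNIV. N t k x)" for k x
      unfolding christ_goldberg_def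
    proof (rule SUP_least)
      fix Q :: "(real^'n) set" assume Q: "Q \<in> cubes"
      show "avg Q (\<lambda>y. ennreal (norm (R Q *v f k y))) * indicator Q x \<le> ennreal C1 * (\<Sum>t\<in>UNIV. N t k x)"
      proof (cases "x \<in> Q")
        case True
        obtain t Q' where Q': "Q' \<in> grid t" "Q \<subseteq> Q'" "emeasure lebesgue Q' \<le> ennreal s * emeasure lebesgue Q"
          using cube_grid_cover[OF Q] unfolding s_def by metis
        have "average lebesgue Q (\<lambda>y. ennreal (norm (R Q *v f k y))) \<le> ennreal C1 * N t k x"
          unfolding C1_def N_def h_def
          using hm[of k] by (intro OW.average_le_sup_average[OF Q Q'(1) grid_subset_cubes Q'(2) s Q'(3) True]) (auto simp: h_def[abs_def])
        also have "\<dots> \<le> ennreal C1 * (\<Sum>t\<in>UNIV. N t k x)"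
          by (intro mult_left_mono member_le_sum) auto
        finally show ?thesis using True by (simp add: avg_eq_average)
      qed simp
    qed
    have "(\<integral>\<^sup>+x. ennpowr (\<Sum>k. ennpowr (christ_goldberg R (f k) x) q) (p / q) \<partial>lebesgue)
      \<le> (\<integral>\<^sup>+x. ennreal ((C1 * T) powr (q * (p / q)) * T powr (p / q)) * (\<Sum>t\<in>UNIV. ennpowr (\<Sum>k. ennpowr (N t k x) q) (p / q)) \<partial>lebesgue)"
      unfolding T_def using p q C1 pt by (intro nn_integral_mono ennpowr_suminf_sum_le) auto
    also have "\<dots> = ennreal ((C1 * T) powr p * T powr (p / q)) * (\<Sum>t\<in>UNIV. \<integral>\<^sup>+x. ennpowr (\<Sum>k. ennpowr (N t k x) q) (p / q) \<partial>lebesgue)"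
      using q by (simp add: nn_integral_cmult nn_integral_sum)
    also have "\<dots> \<le> ennreal ((C1 * T) powr p * T powr (p / q)) * (\<Sum>t\<in>(UNIV :: ('n \<Rightarrow> bool) set). ennreal c * Y)"
      by (intro mult_left_mono sum_mono NY) auto
    also have "(\<Sum>t\<in>(UNIV :: ('n \<Rightarrow> bool) set). ennreal c * Y) = ennreal T * (ennreal c * Y)"
      by (simp only: sum_constant T_def ennreal_of_nat_eq_real_of_nat)
    also have "ennreal ((C1 * T) powr p * T powr (p / q)) * (ennreal T * (ennreal c * Y)) = ennreal ((C1 * T) powr p * T powr (p / q) * T * c) * Y"
      using T c0 by (simp add: ennreal_mult mult.assoc)
    also have "(C1 * T) powr p * T powr (p / q) * T * c = L * \<alpha> powr (e1 * p)"
    proof -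
      have "1 / (p - 1) * (2 * p - 1) = e1 * p" using p by (simp add: e1_def field_simps)
      then show ?thesis using c1 \<alpha>0 by (simp add: c_def L_def powr_mult powr_powr)
    qed
    finally have "Lp_norm p (\<lambda>x. lq_norm q (\<lambda>k. christ_goldberg R (f k) x)) \<le> ennpowr (ennreal (L * \<alpha> powr (e1 * p)) * Y) (1 / p)"
      using p q by (subst Lp_lq_norm_power) (auto intro!: ennpowr_mono)
    also have "\<dots> = ennreal (L powr (1 / p) * \<alpha> powr e1) * ennpowr Y (1 / p)"
      using p L by (simp add: ennpowr_mult ennpowr_ennreal powr_mult powr_powr)
    also have "\<dots> \<le> ennreal (C * \<alpha> powr e2) * ennpowr Y (1 / p)"
    proof (intro mult_right_mono ennreal_leI)
      have "\<alpha> powr e1 = \<alpha> powr (e1 - e2) * \<alpha> powr e2" by (simp flip: powr_add)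
      also have "\<dots> \<le> a0 powr (e1 - e2) * \<alpha> powr e2"
        using a0 \<alpha>a0 by (intro mult_right_mono powr_mono2') (auto simp: e1_def e2_def)
      finally have "L powr (1 / p) * \<alpha> powr e1 \<le> L powr (1 / p) * (a0 powr (e1 - e2) * \<alpha> powr e2)"
        by (intro mult_left_mono) auto
      then show "L powr (1 / p) * \<alpha> powr e1 \<le> C * \<alpha> powr e2" by (simp add: C_def mult.assoc)
    qed simp
    also have "ennreal (C * \<alpha> powr e2) = ennreal C * ennpowr (Ap_char p W) e2"
      using C \<alpha> by (simp add: ennpowr_ennreal ennreal_mult)
    also have "ennpowr Y (1 / p) = Lp_norm p (\<lambda>x. lq_norm q (\<lambda>k. ennreal (norm (mat_powr (W x) (1 / p) *v f k x))))"
      unfolding Y_def using q PD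
      by (subst Lp_lq_norm_power) (auto simp: h_def regular_powr_def elim!: eventually_mono intro!: arg_cong2[where f = ennpowr] nn_integral_cong_AE)
    finally show ?thesis .
  qed
  then show ?thesis using C unfolding e2_def by blast
qed

end
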